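(* For any link $L$, any $L$-generating subset of the set of directed Polyak moves $$\{\Omega1a^\uparrow,\Omega1a^\downarrow,\Omega1b^\uparrow,\Omega1b^\downarrow,\Omega2a^\uparrow,\Omega2a^\downarrow,\Omega3a^\uparrow,\Omega3a^\downarrow\}$$ contains the moves $\Omega1a^\uparrow$, $\Omega1a^\downarrow$, $\Omega1b^\uparrow$ and $\Omega1b^\downarrow$.
   Context: Links are oriented, with at least one component; link diagrams are oriented generic planar diagrams in $\mathbb{R}^2$, up to planar isotopy. Each crossing has a sign $\pm1$. Moves: - $\Omega1a$, $\Omega1b$: forward ($\uparrow$) means a crossingless arc is replaced by an arc with a single curl with one positive crossing; the winding number (total number of counterclockwise full turns of the tangent vector) changes by $-1$ for $\Omega1a^\uparrow$ and by $+1$ for $\Omega1b^\uparrow$. Backward ($\downarrow$) is the inverse. - $\Omega2a$: forward means that of two disjoint neighbouring arcs oriented in the same direction, the left one (with respect to this direction) is pushed over the right one, creating a bigon with two crossings of opposite signs; backward is the inverse. - $\Omega3a$: three strands (top, middle, bottom) pairwise cross once, the top–middle and middle–bottom crossings being positive and the top–bottom crossing negative, and one strand is passed across the crossing of the other two. Orient the triangle formed by the three crossings by the cyclic order bottom$\to$middle$\to$top of its sides; let $n$ be the number of sides on which this orientation agrees with that of the diagram, $q=(-1)^n$. The move is forward ($\uparrow$) if it changes $q=-1$ to $q=+1$, backward ($\downarrow$) otherwise. A set $A$ of directed moves is $L$-generating if for any two diagrams $L_1,L_2$ of $L$, $L_2$ can be obtained from $L_1$ by a finite sequence of moves from $A$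 (each used only in its specified direction). *)

theory Defs
  imports "HOL-Complex_Analysis.Complex_Analysis"
begin

section \<open>Closed curves and links\<close>

text \<open>
  The plane is \<^typ>\<open>complex\<close> and three-space is \<^typ>\<open>complex \<times> real\<close>, with \<^term>\<open>fst\<close> the
  projection to the plane of the diagram and \<^term>\<open>snd\<close> the height above it.
  A component is a regular curve of class \<open>C\<^sup>1\<close>, parametrised by the real line with period 1;
  the direction of the parametrisation is the orientation.  Only the components with index
  below \<open>components\<close> are meaningful.
\<close>

record 'a curves =
  components :: nat
  curve :: "nat \<Rightarrow> real \<Rightarrow> 'a"

type_synonym link = "(complex \<times> real) curves"

text \<open>
  In a diagram, \<open>over D i s j t\<close> says that at the crossing \<open>curve D i s = curve D j t\<close> the branch
  of component \<open>i\<close> at parameter \<open>s\<close> is the upper one.  It carries no information elsewhere.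
\<close>

record diagram = "complex curves" +
  over :: "nat \<Rightarrow> real \<Rightarrow> nat \<Rightarrow> real \<Rightarrow> bool"

abbreviation velocity :: "('a::real_normed_vector, 'b) curves_scheme \<Rightarrow> nat \<Rightarrow> real \<Rightarrow> 'a" where
  "velocity X i s \<equiv> vector_derivative (curve X i) (at s)"

definition regular_closed_curves :: "('a::real_normed_vector, 'b) curves_scheme \<Rightarrow> bool" where
  "regular_closed_curves X \<longleftrightarrow>
     components X \<ge> 1 \<and>
     (\<forall>i<components X.
        curve X i C1_differentiable_on UNIV \<and>
        (\<forall>s. curve X i (s + 1) = curve X i s) \<and>
        (\<forall>s. velocity X i s \<noteq> 0))"

definition same_parameter :: "nat \<Rightarrow> real \<Rightarrow> nat \<Rightarrow> real \<Rightarrow> bool" where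
  "same_parameter i s j t \<longleftrightarrow> i = j \<and> s - t \<in> \<int>"

definition double_point :: "('a, 'b) curves_scheme \<Rightarrow> nat \<Rightarrow> real \<Rightarrow> nat \<Rightarrow> real \<Rightarrow> bool" where
  "double_point X i s j t \<longleftrightarrow>
     i < components X \<and> j < components X \<and> \<not> same_parameter i s j t \<and>
     curve X i s = curve X j t"

definition is_link :: "link \<Rightarrow> bool" where
  "is_link K \<longleftrightarrow> regular_closed_curves K \<and> (\<nexists>i s j t. double_point K i s j t)"

text \<open>
  Isotopy through links, continuous in the \<open>C\<^sup>1\<close> sense (otherwise knotted arcs could be pulled
  tight); by isotopy extension this is ambient isotopy.  The components are not numbered, hence
  the permutation.  Reparametrisations need no mention: an orientation preserving
  reparametrisation \<open>\<sigma>\<close> gives an isotopy via \<open>(1 - \<tau>) s + \<tau> \<sigma>(s)\<close>.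
\<close>

definition link_isotopic :: "link \<Rightarrow> link \<Rightarrow> bool" where
  "link_isotopic K K' \<longleftrightarrow>
     components K' = components K \<and>
     (\<exists>(H :: real \<Rightarrow> link) \<pi>.
        (\<forall>\<tau>\<in>{0..1}. is_link (H \<tau>) \<and> components (H \<tau>) = components K) \<and>
        (\<forall>i<components K.
           continuous_on ({0..1} \<times> UNIV) (\<lambda>(\<tau>, s). curve (H \<tau>) i s) \<and>
           continuous_on ({0..1} \<times> UNIV) (\<lambda>(\<tau>, s). velocity (H \<tau>) i s)) \<and>
        bij_betw \<pi> {..<components K} {..<components K} \<and>
        (\<forall>i<components K. curve (H 0) i = curve K i \<and> curve (H 1) i = curve K' (\<pi> i)))"


section \<open>Diagrams\<close>

definition cross :: "complex \<Rightarrow> complex \<Rightarrow> real" where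
  "cross u v = Re u * Im v - Im u * Re v"

definition is_diagram :: "diagram \<Rightarrow> bool" where
  "is_diagram D \<longleftrightarrow>
     regular_closed_curves D \<and>
     (\<forall>i s j t. double_point D i s j t \<longrightarrow>
        cross (velocity D i s) (velocity D j t) \<noteq> 0 \<and>
        over D i (s + 1) j t = over D i s j t \<and>
        (over D i s j t \<longleftrightarrow> \<not> over D j t i s)) \<and>
     (\<nexists>i s j t k u. double_point D i s j t \<and> double_point D j t k u \<and> double_point D i s k u)"

definition diagram_of :: "link \<Rightarrow> diagram \<Rightarrow> bool" where
  "diagram_of L D \<longleftrightarrow>
     is_diagram D \<and>
     (\<exists>K. link_isotopic L K \<and> components D = components K \<and>
        (\<forall>i<components D. \<forall>s. curve D i s = fst (curve K i s)) \<and>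
        (\<forall>i s j t. double_point D i s j t \<longrightarrow>
           (over D i s j t \<longleftrightarrow> snd (curve K i s) > snd (curve K j t))))"

definition crossing_sign :: "diagram \<Rightarrow> nat \<Rightarrow> real \<Rightarrow> nat \<Rightarrow> real \<Rightarrow> real" where
  "crossing_sign D i s j t =
     (if over D i s j t then sgn (cross (velocity D i s) (velocity D j t))
      else sgn (cross (velocity D j t) (velocity D i s)))"

definition total_winding :: "diagram \<Rightarrow> complex" where
  "total_winding D = (\<Sum>i<components D. winding_number (velocity D i) 0)"

definition plane_isotopy :: "(real \<Rightarrow> complex \<Rightarrow> complex) \<Rightarrow> bool" where
  "plane_isotopy \<Phi> \<longleftrightarrow>
     \<Phi> 0 = id \<and> (\<forall>\<tau>\<in>{0..1}. bij (\<Phi> \<tau>)) \<and>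
     continuous_on ({0..1} \<times> UNIV) (\<lambda>(\<tau>, z). \<Phi> \<tau> z) \<and>
     (\<exists>\<Phi>'. (\<forall>\<tau>\<in>{0..1}. \<forall>z. (\<Phi> \<tau> has_derivative \<Phi>' \<tau> z) (at z) \<and> inj (\<Phi>' \<tau> z)) \<and>
           (\<forall>v. continuous_on ({0..1} \<times> UNIV) (\<lambda>(\<tau>, z). \<Phi>' \<tau> z v)))"

definition reparametrisation :: "(real \<Rightarrow> real) \<Rightarrow> bool" where
  "reparametrisation \<sigma> \<longleftrightarrow>
     \<sigma> C1_differentiable_on UNIV \<and>
     (\<forall>s. vector_derivative \<sigma> (at s) > 0 \<and> \<sigma> (s + 1) = \<sigma> s + 1)"

definition planar_isotopic :: "diagram \<Rightarrow> diagram \<Rightarrow> bool" where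
  "planar_isotopic D D' \<longleftrightarrow>
     is_diagram D \<and> is_diagram D' \<and> components D' = components D \<and>
     (\<exists>\<Phi> \<pi> \<sigma>.
        plane_isotopy \<Phi> \<and>
        bij_betw \<pi> {..<components D} {..<components D} \<and>
        (\<forall>i<components D. reparametrisation (\<sigma> i) \<and>
           (\<forall>s. curve D' i s = \<Phi> 1 (curve D (\<pi> i) (\<sigma> i s)))) \<and>
        (\<forall>i s j t. double_point D' i s j t \<longrightarrow>
           over D' i s j t = over D (\<pi> i) (\<sigma> i s) (\<pi> j) (\<sigma> j t)))"


section \<open>Changing a diagram inside a disc\<close>

text \<open>
  A strand \<open>(i, a, b)\<close> is the arc of component \<open>i\<close> with parameters from \<open>a\<close> to \<open>b\<close>.
  The moves below are stated for a round disc; every embedded disc can be made round by a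
  planar isotopy, and planar isotopies may be inserted between moves.
\<close>

type_synonym strand = "nat \<times> real \<times> real"

definition on_strand :: "strand \<Rightarrow> nat \<Rightarrow> real \<Rightarrow> bool" where
  "on_strand S i s \<longleftrightarrow> (case S of (j, a, b) \<Rightarrow> \<exists>u\<in>{a..b}. same_parameter i s j u)"

definition inside_strand :: "strand \<Rightarrow> nat \<Rightarrow> real \<Rightarrow> bool" where
  "inside_strand S i s \<longleftrightarrow> (case S of (j, a, b) \<Rightarrow> \<exists>u\<in>{a<..<b}. same_parameter i s j u)"

text \<open>
  The closed disc with centre \<open>c\<close> and radius \<open>r\<close> meets \<open>D\<close> exactly in the given strands; the
  bounding circle is transverse to \<open>D\<close> and avoids the crossings.
\<close>

definition disc_meets_in :: "diagram \<Rightarrow> complex \<Rightarrow> real \<Rightarrow> strand list \<Rightarrow> bool" where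
  "disc_meets_in D c r Ss \<longleftrightarrow>
     r > 0 \<and>
     (\<forall>(i, a, b)\<in>set Ss.
        i < components D \<and> a < b \<and> b < a + 1 \<and>
        curve D i a \<in> sphere c r \<and> curve D i b \<in> sphere c r \<and>
        (curve D i a - c) \<bullet> velocity D i a < 0 \<and> (curve D i b - c) \<bullet> velocity D i b > 0 \<and>
        (\<nexists>j t. double_point D i a j t \<or> double_point D i b j t) \<and>
        (\<forall>s\<in>{a<..<b}. curve D i s \<in> ball c r)) \<and>
     (\<forall>i<components D. \<forall>s. curve D i s \<in> cball c r \<longrightarrow> (\<exists>S\<in>set Ss. on_strand S i s)) \<and>
     (\<forall>k<length Ss. \<forall>l<length Ss. k \<noteq> l \<longrightarrow>
        (\<nexists>i s. on_strand (Ss ! k) i s \<and> on_strand (Ss ! l) i s))"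

definition local_change :: "diagram \<Rightarrow> diagram \<Rightarrow> complex \<Rightarrow> real \<Rightarrow> strand list \<Rightarrow> bool" where
  "local_change D D' c r Ss \<longleftrightarrow>
     is_diagram D \<and> is_diagram D' \<and> components D' = components D \<and>
     disc_meets_in D c r Ss \<and> disc_meets_in D' c r Ss \<and>
     (\<forall>i<components D. \<forall>s. (\<forall>S\<in>set Ss. \<not> inside_strand S i s) \<longrightarrow> curve D' i s = curve D i s) \<and>
     (\<forall>i s j t. (\<forall>S\<in>set Ss. \<not> inside_strand S i s \<and> \<not> inside_strand S j t) \<and>
        double_point D i s j t \<longrightarrow> over D' i s j t = over D i s j t)"

definition simple_strand :: "diagram \<Rightarrow> strand \<Rightarrow> bool" where
  "simple_strand D S \<longleftrightarrow> (case S of (i, a, b) \<Rightarrow> inj_on (curve D i) {a..b})"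

text \<open>Pairs of parameters; for \<open>S = T\<close> the diagonal is included.\<close>

definition meetings :: "diagram \<Rightarrow> strand \<Rightarrow> strand \<Rightarrow> (real \<times> real) set" where
  "meetings D S T =
     (case (S, T) of ((i, a, b), (j, a', b')) \<Rightarrow>
        {(s, t). s \<in> {a..b} \<and> t \<in> {a'..b'} \<and> curve D i s = curve D j t})"

definition strand_over :: "diagram \<Rightarrow> strand \<Rightarrow> strand \<Rightarrow> real \<times> real \<Rightarrow> bool" where
  "strand_over D S T p \<longleftrightarrow> over D (fst S) (fst p) (fst T) (snd p)"

definition strand_sign :: "diagram \<Rightarrow> strand \<Rightarrow> strand \<Rightarrow> real \<times> real \<Rightarrow> real" where
  "strand_sign D S T p = crossing_sign D (fst S) (fst p) (fst T) (snd p)"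

definition start_point :: "diagram \<Rightarrow> strand \<Rightarrow> complex" where
  "start_point D S = curve D (fst S) (fst (snd S))"

definition end_point :: "diagram \<Rightarrow> strand \<Rightarrow> complex" where
  "end_point D S = curve D (fst S) (snd (snd S))"

definition ccw_on_circle ::
    "complex \<Rightarrow> real \<Rightarrow> complex \<Rightarrow> complex \<Rightarrow> complex \<Rightarrow> complex \<Rightarrow> bool" where
  "ccw_on_circle c r z1 z2 z3 z4 \<longleftrightarrow>
     (\<exists>\<theta>1 \<theta>2 \<theta>3 \<theta>4.
        \<theta>1 < \<theta>2 \<and> \<theta>2 < \<theta>3 \<and> \<theta>3 < \<theta>4 \<and> \<theta>4 < \<theta>1 + 2 * pi \<and>
        z1 = c + of_real r * cis \<theta>1 \<and> z2 = c + of_real r * cis \<theta>2 \<and>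
        z3 = c + of_real r * cis \<theta>3 \<and> z4 = c + of_real r * cis \<theta>4)"


section \<open>The Polyak moves\<close>

text \<open>
  A strand in a disc with only one self-crossing necessarily is a single curl: the loop at
  the crossing is embedded and the two tails lie outside it.
\<close>

definition single_curl :: "diagram \<Rightarrow> strand \<Rightarrow> real \<times> real \<Rightarrow> bool" where
  "single_curl D S p \<longleftrightarrow> fst p < snd p \<and> {q \<in> meetings D S S. fst q < snd q} = {p}"

definition Omega1_forward :: "complex \<Rightarrow> diagram \<Rightarrow> diagram \<Rightarrow> bool" where
  "Omega1_forward \<epsilon> D D' \<longleftrightarrow>
     (\<exists>c r S p. local_change D D' c r [S] \<and>
        simple_strand D S \<and>
        single_curl D' S p \<and> strand_sign D' S S p = 1 \<and>
        total_winding D' = total_winding D + \<epsilon>)"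

text \<open>
  \<open>S\<close> is the left strand and \<open>T\<close> the right one: the two strands being disjoint in a disc,
  they run in the same direction with \<open>S\<close> on the left iff the end points follow each other
  counterclockwise on the circle as start of \<open>S\<close>, start of \<open>T\<close>, end of \<open>T\<close>, end of \<open>S\<close>.
  Two simple strands in a disc which cross exactly twice bound a bigon.
\<close>

definition Omega2a_forward :: "diagram \<Rightarrow> diagram \<Rightarrow> bool" where
  "Omega2a_forward D D' \<longleftrightarrow>
     (\<exists>c r S T p q. local_change D D' c r [S, T] \<and>
        ccw_on_circle c r (start_point D S) (start_point D T) (end_point D T) (end_point D S) \<and>
        simple_strand D S \<and> simple_strand D T \<and> meetings D S T = {} \<and>
        simple_strand D' S \<and> simple_strand D' T \<and> p \<noteq> q \<and> meetings D' S T = {p, q} \<and>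
        strand_over D' S T p \<and> strand_over D' S T q \<and>
        strand_sign D' S T p = - strand_sign D' S T q)"

text \<open>
  \<open>T\<close>, \<open>M\<close>, \<open>B\<close> are the top, middle and bottom strands.  Walking along the sides of the triangle in
  the order bottom, middle, top, one traverses the bottom side from the top-bottom to the
  middle-bottom crossing, the middle side from there to the top-middle crossing, and the top
  side back to the top-bottom crossing; \<open>n\<close> counts on how many sides this is the direction of
  increasing parameter.
\<close>

definition Omega3a_triangle :: "diagram \<Rightarrow> strand \<Rightarrow> strand \<Rightarrow> strand \<Rightarrow> int \<Rightarrow> bool" where
  "Omega3a_triangle D T M B q \<longleftrightarrow>
     simple_strand D T \<and> simple_strand D M \<and> simple_strand D B \<and>
     (\<exists>tm mb tb n.
        meetings D T M = {tm} \<and> meetings D M B = {mb} \<and> meetings D T B = {tb} \<and>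
        strand_over D T M tm \<and> strand_over D M B mb \<and> strand_over D T B tb \<and>
        strand_sign D T M tm = 1 \<and> strand_sign D M B mb = 1 \<and> strand_sign D T B tb = - 1 \<and>
        n = (of_bool (snd tb < snd mb) + of_bool (fst mb < snd tm) + of_bool (fst tm < fst tb) :: nat) \<and>
        q = (- 1) ^ n)"

text \<open>
  Three simple strands with given end points on a circle that pairwise cross once can be
  arranged in the disc in only two ways, exchanged by passing a strand across the crossing of the
  other two; this reverses all three sides of the triangle and hence changes the sign \<open>q\<close>.
\<close>

definition Omega3a_forward :: "diagram \<Rightarrow> diagram \<Rightarrow> bool" where
  "Omega3a_forward D D' \<longleftrightarrow>
     (\<exists>c r T M B. local_change D D' c r [T, M, B] \<and>
        Omega3a_triangle D T M B (- 1) \<and> Omega3a_triangle D' T M B 1)"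

datatype move_type = Omega1a | Omega1b | Omega2a | Omega3a

datatype directed_move = Forward move_type | Backward move_type

fun forward_move :: "move_type \<Rightarrow> diagram \<Rightarrow> diagram \<Rightarrow> bool" where
  "forward_move Omega1a = Omega1_forward (- 1)"
| "forward_move Omega1b = Omega1_forward 1"
| "forward_move Omega2a = Omega2a_forward"
| "forward_move Omega3a = Omega3a_forward"

fun performs :: "directed_move \<Rightarrow> diagram \<Rightarrow> diagram \<Rightarrow> bool" where
  "performs (Forward m) = forward_move m"
| "performs (Backward m) = (forward_move m)\<inverse>\<inverse>"

text \<open>Diagrams are considered up to planar isotopy, which is therefore always allowed.\<close>

definition generating :: "link \<Rightarrow> directed_move set \<Rightarrow> bool" where
  "generating L A \<longleftrightarrow>
     (\<forall>D1 D2. diagram_of L D1 \<and> diagram_of L D2 \<longrightarrow>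
        (\<lambda>D D'. planar_isotopic D D' \<or> (\<exists>m\<in>A. performs m D D'))\<^sup>*\<^sup>* D1 D2)"

end

theory Submission
  imports Defs
begin

text \<open>
  Two numbers of a diagram carry the proof: its writhe \<open>w\<close> and its total winding number \<open>r\<close>.
  Planar isotopies and the moves of the second and third kind change neither of them, while
  forward \<open>\<Omega>1a\<close> changes \<open>(w, r)\<close> by \<open>(1, -1)\<close> and forward \<open>\<Omega>1b\<close> by \<open>(1, 1)\<close>.  Hence \<open>w - r\<close> can be
  raised only by forward and lowered only by backward \<open>\<Omega>1a\<close>, and the same holds for \<open>w + r\<close> and
  \<open>\<Omega>1b\<close> (\<open>balance_monotone\<close>).  If \<open>L\<close> has two diagrams with the same writhe and different
  winding numbers, then both sums differ, and going from one diagram to the other and back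
  takes all four moves.

  \<^emph>\<open>Invariance.\<close>  A local change keeps the crossings outside the disc, so the writhe changes by the
  signs of the crossings between the strands in the disc (\<open>local_change_double_writhe\<close>).
  For the winding number one needs that an embedded arc across a disc turns by an angle which
  depends only on its end points and end velocities.  This is Hopf's argument for the theorem of
  turning tangents: the tangent can be deformed, through chords, to the chords issuing from the first
  end point followed by those arriving at the last one, and by convexity of the disc each of these two
  families stays in a half-plane (\<open>turning_simple_strand\<close>).  Under a planar isotopy the winding
  number is constant by homotopy, and crossing signs persist because the derivative of the
  final map preserves orientation (\<open>planar_isotopic_invariants\<close>).

  \<^emph>\<open>Two diagrams.\<close>  Looking at a link from behind keeps the writhe and reverses the winding number
  (\<open>view_from_behind\<close>), so one diagram with \<open>r \<noteq> 0\<close> suffices.  For this purpose it is enough to find,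
  in the isotopy class of \<open>L\<close>, a link whose projection is an immersion with \<open>r \<noteq> 0\<close>, since a
  small perturbation makes the projection a diagram and does not alter \<open>r\<close>
  (\<open>generic_perturbation\<close>).  Start with any immersed projection, call its imaginary part the height,
  and arrange that the link has a single highest point, at which the maximum is nondegenerate
  (\<open>summit_exists\<close>).  Turning the top of the link by half a turn about a vertical axis in the plane of
  projection replaces the cap of the curve by one which is run through the other way: the tangent, which went from upwards to downwards through one horizontal
  direction, now passes through the opposite one, and \<open>r\<close> changes by \<open>\<plusminus>1\<close>
  (\<open>twisted_summit\<close>).  So \<open>r\<close> is nonzero before or after the twist.

  \<^emph>\<open>Genericity.\<close>  Links are only assumed to be continuously differentiable; averaging over short
  intervals gives an isotopic link that is smooth enough for measure arguments (\<open>smoothing\<close>).  The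
  perturbations are the shears \<open>(z, d) \<mapsto> (z + p d + q d\<^sup>2, d)\<close>, which are isotopic to the identity.
  For fixed \<open>q\<close> almost every \<open>p\<close> gives an immersion, by a count of dimensions, with transverse double
  points, by Sard's theorem; and for almost every \<open>(q, p)\<close> there are no triple points, because the three points
  of a triple point have three different depths \<open>d\<close> and so determine \<open>p\<close> and \<open>q\<close> by interpolation, whence
  the bad pairs form the image of a three-dimensional set in a four-dimensional space.
\<close>


section \<open>Secants and turning\<close>

text \<open>
  On an arc, the secants vanish nowhere exactly if the arc is injective with nonvanishing derivative.
  Extended to the diagonal by the derivative, the secants of a continuously differentiable curve are a
  continuous function, so that embeddedness becomes accessible to compactness and homotopy arguments.
\<close>

definition secant :: "(real \<Rightarrow> 'a::real_normed_vector) \<Rightarrow> real \<times> real \<Rightarrow> 'a" where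
  "secant g = (\<lambda>(s, t). if s = t then vector_derivative g (at s) else (g t - g s) /\<^sub>R (t - s))"

lemma secant_diagonal [simp]: "secant g (s, s) = vector_derivative g (at s)"
  by (simp add: secant_def)

lemma secant_off_diagonal: "s \<noteq> t \<Longrightarrow> secant g (s, t) = (g t - g s) /\<^sub>R (t - s)"
  by (simp add: secant_def)

lemma secant_eq_0_iff: "s \<noteq> t \<Longrightarrow> secant g (s, t) = 0 \<longleftrightarrow> g s = g t"
  by (auto simp: secant_off_diagonal)

text \<open>
  The mean of the derivative along the chord: in this form the diagonal is no longer special, and
  continuity follows from that of integrals depending on a parameter.
\<close>

lemma secant_eq_integral:
  fixes g :: "real \<Rightarrow> 'a::banach"
  assumes g: "\<And>s. (g has_vector_derivative V s) (at s)" and V: "continuous_on UNIV V"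
  shows "secant g (s, t) = integral {0..1} (\<lambda>u. V (s + u * (t - s)))"
proof (cases "s = t")
  case True
  then show ?thesis using g by (simp add: vector_derivative_at)
next
  case False
  have "((\<lambda>u. (t - s) *\<^sub>R V (s + u * (t - s))) has_integral g (s + 1 * (t - s)) - g (s + 0 * (t - s))) {0..1}"
  proof (rule fundamental_theorem_of_calculus)
    fix u :: real
    have "((g \<circ> (\<lambda>u. s + u * (t - s))) has_vector_derivative (t - s) *\<^sub>R V (s + u * (t - s))) (at u)"
      by (rule vector_diff_chain_at) (auto intro!: derivative_eq_intros g simp: has_real_derivative_iff_has_vector_derivative[symmetric])
    then show "((\<lambda>u. g (s + u * (t - s))) has_vector_derivative (t - s) *\<^sub>R V (s + u * (t - s))) (at u within {0..1})"
      by (simp add: o_def has_vector_derivative_at_within)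
  qed simp
  then have "((\<lambda>u. (1 / (t - s)) *\<^sub>R ((t - s) *\<^sub>R V (s + u * (t - s)))) has_integral (1 / (t - s)) *\<^sub>R (g t - g s)) {0..1}"
    by (intro has_integral_cmul) simp
  with False show ?thesis
    by (simp add: secant_off_diagonal integral_unique inverse_eq_divide)
qed

lemma continuous_on_slice:
  assumes "continuous_on (T \<times> S) (\<lambda>(\<tau>, s). V \<tau> s)" "\<tau> \<in> T"
  shows "continuous_on S (V \<tau>)"
proof -
  have "continuous_on S ((\<lambda>(\<tau>, s). V \<tau> s) \<circ> (\<lambda>s. (\<tau>, s)))"
    using assms(2)
    by (intro continuous_on_compose continuous_on_subset[OF assms(1)] continuous_on_Pair continuous_on_const continuous_on_id) auto
  then show ?thesis by (simp add: o_def)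
qed

lemma continuous_on_secant_family:
  fixes H :: "'p::topological_space \<Rightarrow> real \<Rightarrow> 'a::banach"
  assumes H: "\<And>\<tau> s. \<tau> \<in> T \<Longrightarrow> (H \<tau> has_vector_derivative V \<tau> s) (at s)"
    and V: "continuous_on (T \<times> UNIV) (\<lambda>(\<tau>, s). V \<tau> s)"
  shows "continuous_on (T \<times> UNIV) (\<lambda>(\<tau>, p). secant (H \<tau>) p)"
proof -
  have "continuous_on (T \<times> UNIV) (\<lambda>x. integral (cbox 0 1)
      (\<lambda>u. V (fst x) (fst (snd x) + u * (snd (snd x) - fst (snd x)))))"
  proof (rule integral_continuous_on_param)
    have "continuous_on ((T \<times> UNIV) \<times> cbox 0 1) ((\<lambda>(\<tau>, s). V \<tau> s) \<circ>
        (\<lambda>(x :: 'p \<times> real \<times> real, u). (fst x, fst (snd x) + u * (snd (snd x) - fst (snd x)))))"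
      apply (rule continuous_on_compose)
      subgoal unfolding case_prod_unfold by (intro continuous_intros)
      subgoal by (rule continuous_on_subset[OF V]) auto
      done
    then show "continuous_on ((T \<times> UNIV) \<times> cbox (0::real) 1)
       (\<lambda>(x, u). V (fst x) (fst (snd x) + u * (snd (snd x) - fst (snd x))))"
      by (simp add: o_def case_prod_unfold)
  qed
  moreover have "secant (H \<tau>) p = integral {0..1} (\<lambda>u. V \<tau> (fst p + u * (snd p - fst p)))" if "\<tau> \<in> T" for \<tau> p
  proof -
    have "continuous_on UNIV (V \<tau>)"
      using V that by (rule continuous_on_slice)
    then show ?thesis
      using secant_eq_integral[OF H[OF that], of "fst p" "snd p"] by simp
  qed
  ultimately show ?thesis
    by (auto simp: case_prod_unfold elim!: continuous_on_eq)
qed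

lemma continuous_on_secant:
  fixes g :: "real \<Rightarrow> 'a::banach"
  assumes "g C1_differentiable_on UNIV"
  shows "continuous_on UNIV (secant g)"
proof -
  obtain V where V: "\<And>s. (g has_vector_derivative V s) (at s)" "continuous_on UNIV V"
    using assms by (auto simp: C1_differentiable_on_def)
  have "continuous_on (UNIV :: (real \<times> real) set) ((\<lambda>(\<tau>, p). secant ((\<lambda>_::real. g) \<tau>) p) \<circ> (\<lambda>p. (0, p)))"
    apply (rule continuous_on_compose)
    subgoal by (intro continuous_intros)
    subgoal
      apply (rule continuous_on_subset[OF continuous_on_secant_family[where T = "UNIV" and V = "\<lambda>_. V"]])
        apply (rule V)
      using continuous_on_compose2[OF V(2) continuous_on_snd[OF continuous_on_id]]
       apply (auto simp: case_prod_unfold)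
      done
    done
  then show ?thesis by (simp add: o_def)
qed

text \<open>
  The increment of a continuous logarithm: its imaginary part is the angle through which \<open>f\<close> turns
  between \<open>a\<close> and \<open>b\<close>.  In contrast to the winding number it is additive over adjacent intervals and
  is meaningful for arcs which do not close up.
\<close>

definition turning :: "(real \<Rightarrow> complex) \<Rightarrow> real \<Rightarrow> real \<Rightarrow> complex" where
  "turning f a b = (SOME c. \<exists>q. continuous_on {a..b} q \<and> (\<forall>x\<in>{a..b}. f x = exp (q x)) \<and> c = q b - q a)"

text \<open>
  The difference of two logarithms is continuous with values in the discrete set of multiples
  of \<open>2\<pi>\<i>\<close>.
\<close>

lemma logarithms_differ_by_constant:
  fixes q r :: "real \<Rightarrow> complex"
  assumes "continuous_on {a..b} q" "continuous_on {a..b} r" "\<And>x. x \<in> {a..b} \<Longrightarrow> exp (q x) = exp (r x)" "a \<le> b"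
  shows "q b - q a = r b - r a"
proof -
  have "(\<lambda>x. q x - r x) constant_on {a..b}"
  proof (rule continuous_discrete_range_constant)
    show "continuous_on {a..b} (\<lambda>x. q x - r x)"
      using assms by (intro continuous_intros)
    show "\<exists>e>0. \<forall>y. y \<in> {a..b} \<and> q y - r y \<noteq> q x - r x \<longrightarrow> e \<le> norm (q y - r y - (q x - r x))"
      if "x \<in> {a..b}" for x
    proof (intro exI[of _ "2*pi"] conjI allI impI)
      fix y assume y: "y \<in> {a..b} \<and> q y - r y \<noteq> q x - r x"
      have "exp (q x) = exp (r x)" "exp (q y) = exp (r y)"
        using assms(3) y that by auto
      then obtain m n :: int where "q x = r x + (of_int (2 * m) * pi) * \<i>" "q y = r y + (of_int (2 * n) * pi) * \<i>"
        unfolding exp_eq by blast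
      then have eq: "q y - r y - (q x - r x) = of_real (2 * pi * of_int (n - m)) * \<i>" and "n \<noteq> m"
        using y by (auto simp: algebra_simps)
      then have "norm (q y - r y - (q x - r x)) = 2 * pi * \<bar>of_int (n - m)\<bar>"
        by (simp add: norm_mult abs_mult del: of_int_diff of_real_mult)
      moreover have "\<bar>of_int (n - m)\<bar> \<ge> (1::real)"
        using \<open>n \<noteq> m\<close> by linarith
      ultimately show "2 * pi \<le> norm (q y - r y - (q x - r x))"
        by simp
    qed simp
  qed simp
  then obtain c where "\<And>x. x \<in> {a..b} \<Longrightarrow> q x - r x = c"
    by (auto simp: constant_on_def)
  from this[of a] this[of b] assms(4) show ?thesis
    by (simp add: algebra_simps)
qed

lemma turning_eqI:
  assumes "continuous_on {a..b} q" "\<And>x. x \<in> {a..b} \<Longrightarrow> f x = exp (q x)" "a \<le> b"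
  shows "turning f a b = q b - q a"
proof -
  have "\<exists>r. continuous_on {a..b} r \<and> (\<forall>x\<in>{a..b}. f x = exp (r x)) \<and> turning f a b = r b - r a"
    unfolding turning_def by (rule someI_ex) (use assms in blast)
  then show ?thesis
    using assms logarithms_differ_by_constant by metis
qed

lemma continuous_logarithm_on_interval:
  fixes f :: "real \<Rightarrow> complex"
  assumes "continuous_on {a..b} f" "\<And>x. x \<in> {a..b} \<Longrightarrow> f x \<noteq> 0"
  obtains q where "continuous_on {a..b} q" "\<And>x. x \<in> {a..b} \<Longrightarrow> f x = exp (q x)"
  using continuous_logarithm_on_contractible[OF assms(1) _ assms(2)]
  by (metis convex_imp_contractible convex_real_interval(5))

lemma turning_combine:
  assumes "continuous_on {a..c} f" "\<And>x. x \<in> {a..c} \<Longrightarrow> f x \<noteq> 0" "a \<le> b" "b \<le> c"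
  shows "turning f a c = turning f a b + turning f b c"
proof -
  obtain q where q: "continuous_on {a..c} q" "\<And>x. x \<in> {a..c} \<Longrightarrow> f x = exp (q x)"
    using continuous_logarithm_on_interval assms by metis
  have "turning f a c = q c - q a" "turning f a b = q b - q a" "turning f b c = q c - q b"
    by (rule turning_eqI; use q assms in \<open>auto elim: continuous_on_subset\<close>)+
  then show ?thesis by simp
qed

lemma turning_cong:
  assumes "\<And>x. x \<in> {a..b} \<Longrightarrow> f x = g x"
  shows "turning f a b = turning g a b"
  unfolding turning_def using assms by (auto intro!: arg_cong[where f = Eps] cong: conj_cong)

lemma turning_shift:
  assumes "continuous_on {a + c..b + c} f" "\<And>x. x \<in> {a + c..b + c} \<Longrightarrow> f x \<noteq> 0" "a \<le> b"
  shows "turning (\<lambda>x. f (x + c)) a b = turning f (a + c) (b + c)"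
proof -
  obtain q where q: "continuous_on {a + c..b + c} q" "\<And>x. x \<in> {a + c..b + c} \<Longrightarrow> f x = exp (q x)"
    using continuous_logarithm_on_interval assms by metis
  have "turning f (a + c) (b + c) = q (b + c) - q (a + c)"
    by (rule turning_eqI) (use q assms in auto)
  moreover have "turning (\<lambda>x. f (x + c)) a b = q (b + c) - q (a + c)"
    by (rule turning_eqI) (use q assms in \<open>auto intro!: continuous_on_compose2[OF q(1)] continuous_intros\<close>)
  ultimately show ?thesis by simp
qed

lemma turning_winding_number:
  assumes "continuous_on {0..1} f" "\<And>x. x \<in> {0..1} \<Longrightarrow> f x \<noteq> 0"
  shows "turning f 0 1 = 2 * of_real pi * \<i> * winding_number f 0"
proof -
  have "path f" "0 \<notin> path_image f"
    using assms by (auto simp: path_def path_image_def)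
  then obtain q where q: "path q" "pathfinish q - pathstart q = 2 * of_real pi * \<i> * winding_number f 0"
      "\<And>t. t \<in> {0..1} \<Longrightarrow> f t = 0 + exp(q t)"
    using winding_number_as_continuous_log by metis
  have "turning f 0 1 = q 1 - q 0"
    by (rule turning_eqI) (use q in \<open>auto simp: path_def\<close>)
  then show ?thesis
    using q(2) by (simp add: pathfinish_def pathstart_def)
qed

lemma turning_period:
  assumes f: "continuous_on UNIV f" "\<And>x. f x \<noteq> 0" and per: "\<And>x. f (x + 1) = f x"
  shows "turning f c (c + 1) = 2 * of_real pi * \<i> * winding_number f 0"
proof -
  have cont: "continuous_on A f" for A
    using f(1) continuous_on_subset by blast
  have sh: "turning f (a + 1) (b + 1) = turning f a b" if "a \<le> b" for a b
    using turning_shift[where f = f and c = 1, OF cont f(2) that] per by simp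
  have comb: "turning f a c = turning f a b + turning f b c" if "a \<le> b" "b \<le> c" for a b c
    using turning_combine[OF cont f(2) that] .
  have "turning f c (c + 1) = turning f 0 1"
  proof (cases "c \<ge> 0")
    case True
    have "turning f 0 1 + turning f 1 (c + 1) = turning f 0 c + turning f c (c + 1)"
      using True comb[of 0 1 "c+1"] comb[of 0 c "c+1"] by simp
    with sh[of 0 c] True show ?thesis by simp
  next
    case False
    have "turning f c 0 + turning f 0 1 = turning f c (c + 1) + turning f (c + 1) 1"
      using False comb[of c 0 1] comb[of c "c+1" 1] by simp
    with sh[of c 0] False show ?thesis by simp
  qed
  then show ?thesis
    using turning_winding_number[OF cont f(2)] by simp
qed

text \<open>
  A curve which avoids the ray opposite to \<open>n\<close> has the principal logarithm, rotated by \<open>n\<close>, as a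
  continuous logarithm, so that only the end values matter.
\<close>

lemma turning_slit_plane:
  assumes "continuous_on {a..b} f" "\<And>x. x \<in> {a..b} \<Longrightarrow> f x / n \<notin> \<real>\<^sub>\<le>\<^sub>0" "n \<noteq> 0" "a \<le> b"
  shows "turning f a b = Ln (f b / n) - Ln (f a / n)"
proof -
  have "turning f a b = (Ln (f b / n) + Ln n) - (Ln (f a / n) + Ln n)"
  proof (rule turning_eqI)
    show "continuous_on {a..b} (\<lambda>x. Ln (f x / n) + Ln n)"
      using assms by (intro continuous_intros) auto
    fix x assume "x \<in> {a..b}"
    then have "f x \<noteq> 0"
      using assms(2)[of x] by auto
    then show "f x = exp (Ln (f x / n) + Ln n)"
      using assms(3) by (simp add: exp_add)
  qed fact
  then show ?thesis by simp
qed

lemma winding_number_family: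
  assumes "continuous_on ({0..1} \<times> UNIV) (\<lambda>(\<tau>, s). H \<tau> s)"
    and "\<And>\<tau> s. \<tau> \<in> {0..1} \<Longrightarrow> H \<tau> s \<noteq> (0::complex)"
    and "\<And>\<tau> s. \<tau> \<in> {0..1} \<Longrightarrow> H \<tau> (s + 1) = H \<tau> (s::real)"
  shows "winding_number (H (1::real)) 0 = winding_number (H 0) 0"
proof -
  have "homotopic_loops (-{0}) (H 0) (H 1)"
    unfolding homotopic_loops
    apply (rule exI[of _ "\<lambda>(\<tau>, s). H \<tau> s"])
    using assms(2) assms(3)[of _ 0] continuous_on_subset[OF assms(1), of "{0..1} \<times> {0..1}"]
    by (auto simp: pathfinish_def pathstart_def)
  then show ?thesis
    using winding_number_homotopic_loops by metis
qed


section \<open>Closed curves\<close>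

lemma curve_has_vector_derivative:
  assumes "regular_closed_curves X" "i < components X"
  shows "(curve X i has_vector_derivative velocity X i s) (at s)"
  using assms unfolding regular_closed_curves_def
  by (metis C1_differentiable_on_eq UNIV_I vector_derivative_works)

lemma continuous_on_velocity:
  assumes "regular_closed_curves X" "i < components X"
  shows "continuous_on A (velocity X i)"
  using assms unfolding regular_closed_curves_def C1_differentiable_on_eq
  using continuous_on_subset by blast

lemma continuous_on_curve:
  assumes "regular_closed_curves X" "i < components X"
  shows "continuous_on A (curve X i)"
  by (meson assms continuous_at_imp_continuous_on curve_has_vector_derivative has_vector_derivative_continuous)

lemma periodic_int:
  fixes f :: "real \<Rightarrow> 'b"
  assumes "\<And>s. f (s + 1) = f s"
  shows "f (s + of_int n) = f s"
proof (induction n rule: int_induct[where k = 0])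
  case (step1 i)
  with assms[of "s + of_int i"] show ?case by (simp add: add.assoc)
next
  case (step2 i)
  with assms[of "s + of_int (i - 1)"] show ?case by (simp add: add.assoc)
qed simp

lemma periodic_Ints:
  fixes f :: "real \<Rightarrow> 'b"
  assumes "\<And>s. f (s + 1) = f s" "s - t \<in> \<int>"
  shows "f s = f t"
proof -
  obtain n where "s - t = of_int n"
    using assms(2) Ints_cases by blast
  then have "s = t + of_int n" by simp
  then show ?thesis using periodic_int[of f, OF assms(1)] by simp
qed

lemma has_vector_derivative_shift:
  assumes "(f has_vector_derivative v) (at (s + c))"
  shows "((\<lambda>s. f (s + c)) has_vector_derivative v) (at s)"
proof -
  have "((\<lambda>s. s + c) has_real_derivative 1) (at s)"
    by (auto intro!: derivative_eq_intros)
  then have "((f \<circ> (\<lambda>s. s + c)) has_vector_derivative 1 *\<^sub>R v) (at s)"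
    using assms by (intro vector_diff_chain_at) (auto simp: has_real_derivative_iff_has_vector_derivative)
  then show ?thesis
    by (simp add: o_def)
qed

lemma vector_derivative_periodic:
  fixes f :: "real \<Rightarrow> 'a::real_normed_vector"
  assumes "\<And>s. f (s + 1) = f s" "(f has_vector_derivative v) (at (s + 1))"
  shows "(f has_vector_derivative v) (at s)"
  using has_vector_derivative_shift[OF assms(2)] assms(1) by simp

lemma velocity_periodic:
  assumes "regular_closed_curves X" "i < components X"
  shows "velocity X i (s + 1) = velocity X i s"
proof -
  have "\<And>s. curve X i (s + 1) = curve X i s"
    using assms by (simp add: regular_closed_curves_def)
  from vector_derivative_periodic[of "curve X i", OF this curve_has_vector_derivative[OF assms, of "s + 1"]]
  show ?thesis by (metis vector_derivative_at)
qed

lemma curve_Ints: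
  assumes "regular_closed_curves X" "i < components X" "s - t \<in> \<int>"
  shows "curve X i s = curve X i t"
  using assms periodic_Ints[of "curve X i" s t] by (simp add: regular_closed_curves_def)

lemma velocity_Ints:
  assumes "regular_closed_curves X" "i < components X" "s - t \<in> \<int>"
  shows "velocity X i s = velocity X i t"
  using assms periodic_Ints[of "velocity X i" s t] velocity_periodic by blast

lemma is_diagram_regular: "is_diagram D \<Longrightarrow> regular_closed_curves D"
  by (simp add: is_diagram_def)

lemma velocity_nonzero: "regular_closed_curves X \<Longrightarrow> i < components X \<Longrightarrow> velocity X i s \<noteq> 0"
  by (simp add: regular_closed_curves_def)

lemma same_parameter_sym: "same_parameter i s j t \<longleftrightarrow> same_parameter j t i s"
  unfolding same_parameter_def by (metis Ints_minus minus_diff_eq)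

lemma double_point_sym: "double_point X i s j t \<longleftrightarrow> double_point X j t i s"
  unfolding double_point_def by (metis same_parameter_sym)

lemma same_parameter_trans:
  "same_parameter i s j t \<Longrightarrow> same_parameter j t k u \<Longrightarrow> same_parameter i s k u"
  unfolding same_parameter_def by (metis Ints_add diff_add_cancel add_diff_eq)

lemma double_point_shift:
  assumes "regular_closed_curves D" "double_point D i s j t" "same_parameter i s' i s" "same_parameter j t' j t"
  shows "double_point D i s' j t'"
proof -
  have "\<not> same_parameter i s' j t'"
    using assms same_parameter_sym same_parameter_trans unfolding double_point_def by blast
  moreover have "curve D i s' = curve D i s" "curve D j t' = curve D j t"
    using assms curve_Ints[OF assms(1), of i s' s] curve_Ints[OF assms(1), of j t' t]
    by (auto simp: double_point_def same_parameter_def)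
  ultimately show ?thesis
    using assms by (simp add: double_point_def)
qed


section \<open>The writhe\<close>

lemma over_shift_left:
  assumes D: "is_diagram D" and d: "double_point D i s j t" and "s' - s \<in> \<int>"
  shows "over D i s' j t = over D i s j t"
proof -
  obtain n where n: "s' - s = of_int n"
    using assms(3) Ints_cases by blast
  have dd: "double_point D i (s + of_int m) j t" for m :: int
    by (rule double_point_shift[OF is_diagram_regular[OF D] d]) (auto simp: same_parameter_def)
  have "over D i (s + of_int n) j t = over D i s j t"
  proof (induction n rule: int_induct[where k = 0])
    case (step1 m)
    with dd[of m] D show ?case
      unfolding is_diagram_def by (metis add.assoc of_int_1 of_int_add)
  next
    case (step2 m)
    have "over D i (s + of_int (m - 1) + 1) j t = over D i (s + of_int (m - 1)) j t"
      using dd[of "m - 1"] D unfolding is_diagram_def by metis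
    with step2 show ?case by (simp add: add.assoc)
  qed simp
  with n show ?thesis by (metis add.commute diff_add_cancel)
qed

lemma over_swap: "is_diagram D \<Longrightarrow> double_point D i s j t \<Longrightarrow> over D j t i s \<longleftrightarrow> \<not> over D i s j t"
  unfolding is_diagram_def by metis

text \<open>
  The definition of a diagram asks for periodicity of \<open>over\<close> in the first parameter; antisymmetry carries
  it over to the second.
\<close>

lemma over_shift:
  assumes D: "is_diagram D" and d: "double_point D i s j t" and "s' - s \<in> \<int>" "t' - t \<in> \<int>"
  shows "over D i s' j t' = over D i s j t"
proof -
  have d': "double_point D i s' j t"
    by (rule double_point_shift[OF is_diagram_regular[OF D] d]) (use assms in \<open>auto simp: same_parameter_def\<close>)
  have "over D i s' j t' = (\<not> over D j t' i s')"
    using over_swap[OF D double_point_shift[OF is_diagram_regular[OF D] d, of s' t']] assms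
    by (simp add: same_parameter_def)
  also have "over D j t' i s' = over D j t i s'"
    using over_shift_left[OF D, of j t i s' t'] d' assms double_point_sym by blast
  also have "(\<not> over D j t i s') = over D i s' j t"
    using over_swap[OF D d'] by simp
  also have "\<dots> = over D i s j t"
    using over_shift_left[OF D d] assms by blast
  finally show ?thesis .
qed

lemma crossing_sign_shift:
  assumes D: "is_diagram D" and d: "double_point D i s j t" and "s' - s \<in> \<int>" "t' - t \<in> \<int>"
  shows "crossing_sign D i s' j t' = crossing_sign D i s j t"
  using over_shift[OF assms] velocity_Ints[OF is_diagram_regular[OF D], of i s' s]
    velocity_Ints[OF is_diagram_regular[OF D], of j t' t] assms
  by (simp add: crossing_sign_def double_point_def)

lemma crossing_sign_swap:
  assumes "is_diagram D" "double_point D i s j t"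
  shows "crossing_sign D j t i s = crossing_sign D i s j t"
  using over_swap[OF assms] by (simp add: crossing_sign_def)

definition ordered_crossings :: "diagram \<Rightarrow> (nat \<times> real \<times> nat \<times> real) set" where
  "ordered_crossings D = {(i, s, j, t). s \<in> {0..<1} \<and> t \<in> {0..<1} \<and> double_point D i s j t}"

text \<open>
  Each crossing occurs here in both orders of its branches, so the sum is twice the writhe.
  Counting ordered pairs spares the choice of one of the two orders.
\<close>

definition double_writhe :: "diagram \<Rightarrow> real" where
  "double_writhe D = (\<Sum>(i, s, j, t)\<in>ordered_crossings D. crossing_sign D i s j t)"

lemma continuous_on_cross [continuous_intros]:
  "continuous_on A f \<Longrightarrow> continuous_on A g \<Longrightarrow> continuous_on A (\<lambda>x. cross (f x) (g x))"
  unfolding cross_def by (intro continuous_intros)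

lemma cross_nonzero_independent:
  assumes "cross u v \<noteq> 0" "a *\<^sub>R u = b *\<^sub>R v"
  shows "a = 0 \<and> b = 0"
proof -
  have "a * cross u v = cross (a *\<^sub>R u) v" "b * cross u v = cross u (b *\<^sub>R v)"
    by (simp_all add: cross_def algebra_simps)
  moreover have "cross (b *\<^sub>R v) v = 0" "cross u (a *\<^sub>R u) = 0"
    by (simp_all add: cross_def)
  moreover have "v \<noteq> 0"
    using assms(1) by (auto simp: cross_def)
  ultimately show ?thesis
    using assms by auto
qed

text \<open>
  Near a pair of parameters with different images continuity excludes double points, near the
  diagonal the nonvanishing velocity does, and near a double point transversality does: the chords of the
  two branches are then linearly independent.
\<close>

lemma double_points_isolated:
  assumes D: "is_diagram D" and ij: "i < components D" "j < components D"
  shows "\<exists>U. open U \<and> (s0, t0) \<in> U \<and> (\<forall>(s, t)\<in>U. double_point D i s j t \<longrightarrow> (s, t) = (s0, t0))"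
proof -
  have reg: "regular_closed_curves D"
    using D by (rule is_diagram_regular)
  have sec: "continuous_on UNIV (secant (curve D k))" if "k < components D" for k
    using that reg by (intro continuous_on_secant) (auto simp: regular_closed_curves_def)
  consider "curve D i s0 \<noteq> curve D j t0" | "same_parameter i s0 j t0" | "double_point D i s0 j t0"
    using ij by (auto simp: double_point_def)
  then show ?thesis
  proof cases
    case 1
    have "continuous_on UNIV (\<lambda>x. curve D i (fst x) - curve D j (snd x))"
      by (intro continuous_intros continuous_on_compose2[OF continuous_on_curve[OF reg ij(1), of UNIV]]
            continuous_on_compose2[OF continuous_on_curve[OF reg ij(2), of UNIV]]) auto
    then have "open ((\<lambda>x. curve D i (fst x) - curve D j (snd x)) -` (- {0}))"
      by (intro open_vimage) auto
    then show ?thesis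
      using 1 by (intro exI conjI) (auto simp: double_point_def)
  next
    case 2
    then have [simp]: "j = i" and n: "s0 - t0 \<in> \<int>"
      by (auto simp: same_parameter_def)
    define n where "n = s0 - t0"
    have "continuous_on UNIV (\<lambda>x. secant (curve D i) (fst x, snd x + n))"
      by (rule continuous_on_compose2[OF sec[OF ij(1)]]) (auto intro!: continuous_intros)
    then have "open ((\<lambda>x. secant (curve D i) (fst x, snd x + n)) -` (- {0}))"
      by (intro open_vimage) auto
    moreover have "\<not> double_point D i s i t" if "secant (curve D i) (s, t + n) \<noteq> 0" for s t
    proof
      assume d: "double_point D i s i t"
      then have "s \<noteq> t + n"
        using n by (auto simp: double_point_def same_parameter_def n_def)
      then have "curve D i s \<noteq> curve D i (t + n)"
        using that secant_eq_0_iff by blast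
      then show False
        using d curve_Ints[OF reg ij(1), of "t + n" t] n by (simp add: double_point_def n_def)
    qed
    moreover have "secant (curve D i) (s0, t0 + n) \<noteq> 0"
      using velocity_nonzero[OF reg ij(1)] by (simp add: n_def)
    ultimately show ?thesis
      by (intro exI[of _ "(\<lambda>x. secant (curve D i) (fst x, snd x + n)) -` (- {0})"]) auto
  next
    case 3
    let ?f = "\<lambda>x. cross (secant (curve D i) (s0, fst x)) (secant (curve D j) (t0, snd x))"
    have "continuous_on UNIV ?f"
      by (intro continuous_intros continuous_on_compose2[OF sec[OF ij(1)]] continuous_on_compose2[OF sec[OF ij(2)]])
         auto
    then have "open (?f -` (- {0}))"
      by (intro open_vimage) auto
    moreover have "?f (s0, t0) \<noteq> 0"
      using 3 D unfolding is_diagram_def by simp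
    moreover have "(s, t) = (s0, t0)" if "?f (s, t) \<noteq> 0" "double_point D i s j t" for s t
    proof -
      have sc: "(y - x) *\<^sub>R secant (curve D k) (x, y) = curve D k y - curve D k x" for x y k
        by (cases "x = y") (auto simp: secant_off_diagonal)
      have "(s - s0) *\<^sub>R secant (curve D i) (s0, s) = (t - t0) *\<^sub>R secant (curve D j) (t0, t)"
        using 3 that(2) by (simp add: sc double_point_def)
      then have "s - s0 = 0 \<and> t - t0 = 0"
        by (rule cross_nonzero_independent[rotated]) (use that(1) in simp)
      then show ?thesis by simp
    qed
    ultimately show ?thesis
      by (intro exI[of _ "?f -` (- {0})"]) blast
  qed
qed

text \<open>
  Finiteness is essential, since a sum over an infinite set is \<open>0\<close> by convention and
  could not be split.
\<close>

lemma finite_ordered_crossings: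
  assumes D: "is_diagram D"
  shows "finite (ordered_crossings D)"
proof -
  define C where "C i j = {(s, t). s \<in> {0..<1} \<and> t \<in> {0..<1} \<and> double_point D i s j t}" for i j
  have "finite (C i j)" if ij: "i < components D" "j < components D" for i j
  proof (rule ccontr)
    assume "infinite (C i j)"
    moreover have "C i j \<subseteq> cbox (0, 0) (1, 1)"
      by (auto simp: C_def)
    ultimately obtain x where x: "x islimpt C i j"
      using compact_cbox[of "(0, 0)" "(1, 1) :: real \<times> real"] unfolding compact_eq_Bolzano_Weierstrass by blast
    obtain U where "open U" "x \<in> U" "\<forall>(s, t)\<in>U. double_point D i s j t \<longrightarrow> (s, t) = x"
      using double_points_isolated[OF D ij, of "fst x" "snd x"] by auto
    with x show False
      unfolding islimpt_def C_def by blast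
  qed
  moreover have "ordered_crossings D \<subseteq> (\<Union>i<components D. \<Union>j<components D. (\<lambda>(s, t). (i, s, j, t)) ` C i j)"
    by (force simp: ordered_crossings_def C_def double_point_def)
  ultimately show ?thesis
    by (elim finite_subset) (auto intro!: finite_imageI)
qed

text \<open>
  Parameters of a closed curve matter modulo \<open>1\<close>; a crossing given by arbitrary parameters is
  represented in \<open>ordered_crossings\<close> by their fractional parts.
\<close>

definition reduce :: "nat \<times> real \<times> nat \<times> real \<Rightarrow> nat \<times> real \<times> nat \<times> real" where
  "reduce = (\<lambda>(i, s, j, t). (i, frac s, j, frac t))"

lemma frac_diff_Ints [simp]: "frac s - s \<in> \<int>" "s - frac s \<in> \<int>"
  by (simp_all add: frac_def)

lemma same_parameter_frac [simp]: "same_parameter i (frac s) i s"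
  by (simp add: same_parameter_def)

lemma double_point_frac [simp]:
  assumes "regular_closed_curves D"
  shows "double_point D i (frac s) j (frac t) \<longleftrightarrow> double_point D i s j t"
  using double_point_shift[OF assms] same_parameter_frac same_parameter_sym by metis

lemma frac_eq_iff: "frac s = frac t \<longleftrightarrow> s - t \<in> \<int>"
proof
  assume "frac s = frac t"
  then have "s - t = of_int (\<lfloor>s\<rfloor> - \<lfloor>t\<rfloor>)" by (simp add: frac_def)
  then show "s - t \<in> \<int>" by simp
next
  assume "s - t \<in> \<int>"
  then obtain n where "s - t = of_int n" by (rule Ints_cases)
  then have "s = t + of_int n" by simp
  then show "frac s = frac t" by (simp add: frac_def)
qed

lemma sum_crossing_sign_reduce:
  assumes D: "is_diagram D" and X: "inj_on reduce X" and d: "\<And>i s j t. (i, s, j, t) \<in> X \<Longrightarrow> double_point D i s j t"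
  shows "(\<Sum>(i, s, j, t)\<in>reduce ` X. crossing_sign D i s j t) = (\<Sum>(i, s, j, t)\<in>X. crossing_sign D i s j t)"
proof -
  have "(\<Sum>(i, s, j, t)\<in>reduce ` X. crossing_sign D i s j t) =
        (\<Sum>x\<in>X. case reduce x of (i, s, j, t) \<Rightarrow> crossing_sign D i s j t)"
    by (subst sum.reindex[OF X]) simp
  also have "\<dots> = (\<Sum>(i, s, j, t)\<in>X. crossing_sign D i s j t)"
    by (rule sum.cong) (auto simp: reduce_def intro!: crossing_sign_shift[OF D d])
  finally show ?thesis .
qed


section \<open>Strands in a disc\<close>

lemma on_strand_iff: "on_strand (j, a, b) i s \<longleftrightarrow> i = j \<and> (\<exists>u\<in>{a..b}. s - u \<in> \<int>)"
  by (auto simp: on_strand_def same_parameter_def)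

lemma inside_strand_iff: "inside_strand (j, a, b) i s \<longleftrightarrow> i = j \<and> (\<exists>u\<in>{a<..<b}. s - u \<in> \<int>)"
  by (auto simp: inside_strand_def same_parameter_def)

lemma inside_strand_imp_on_strand: "inside_strand S i s \<Longrightarrow> on_strand S i s"
  by (cases S) (auto simp: on_strand_iff inside_strand_iff)

text \<open>
  The parameters on a strand form the sum of the closed set of integers and a compact interval.
\<close>

lemma closed_on_strand: "closed {s. on_strand S i s}"
proof -
  obtain j a b where S: "S = (j, a, b)" by (cases S)
  have "closed (\<Union>x\<in>(\<int> :: real set). \<Union>u\<in>{a..b}. {x + u})"
    by (rule closed_compact_sums) auto
  moreover have "{s. \<exists>u\<in>{a..b}. s - u \<in> \<int>} = (\<Union>x\<in>(\<int> :: real set). \<Union>u\<in>{a..b}. {x + u})"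
  proof (intro equalityI subsetI)
    fix s assume "s \<in> {s. \<exists>u\<in>{a..b}. s - u \<in> \<int>}"
    then obtain u where "u \<in> {a..b}" "s - u \<in> \<int>" by blast
    then show "s \<in> (\<Union>x\<in>(\<int> :: real set). \<Union>u\<in>{a..b}. {x + u})"
      by (intro UN_I[of "s - u"] UN_I[of u]) auto
  next
    fix s assume "s \<in> (\<Union>x\<in>(\<int> :: real set). \<Union>u\<in>{a..b}. {x + u})"
    then obtain x u where "x \<in> \<int>" "u \<in> {a..b}" "s = x + u" by blast
    then show "s \<in> {s. \<exists>u\<in>{a..b}. s - u \<in> \<int>}"
      by (auto intro!: bexI[of _ u])
  qed
  ultimately show ?thesis
    by (cases "i = j") (auto simp: S on_strand_iff)
qed

lemma open_inside_strand: "open {s. inside_strand S i s}"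
proof -
  obtain j a b where S: "S = (j, a, b)" by (cases S)
  have "{s. \<exists>u\<in>{a<..<b}. s - u \<in> \<int>} = (\<Union>n::int. {a + of_int n<..<b + of_int n})"
  proof (intro equalityI subsetI)
    fix s assume "s \<in> {s. \<exists>u\<in>{a<..<b}. s - u \<in> \<int>}"
    then obtain u n where "u \<in> {a<..<b}" "s - u = of_int n"
      by (auto elim: Ints_cases)
    then show "s \<in> (\<Union>n::int. {a + of_int n<..<b + of_int n})"
      by (auto intro!: exI[of _ n])
  next
    fix s assume "s \<in> (\<Union>n::int. {a + of_int n<..<b + of_int n})"
    then obtain n :: int where "s \<in> {a + of_int n<..<b + of_int n}" by auto
    then show "s \<in> {s. \<exists>u\<in>{a<..<b}. s - u \<in> \<int>}"
      by (auto intro!: bexI[of _ "s - of_int n"])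
  qed
  then have "open {s. \<exists>u\<in>{a<..<b}. s - u \<in> \<int>}"
    by auto
  then show ?thesis
    by (cases "i = j") (auto simp: S inside_strand_iff)
qed

lemma inside_strand_Ints: "inside_strand S i s \<Longrightarrow> t - s \<in> \<int> \<Longrightarrow> inside_strand S i t"
  by (cases S) (force simp: inside_strand_iff dest: Ints_add)

lemma Ints_small_eq_0: "x \<in> \<int> \<Longrightarrow> \<bar>x\<bar> < 1 \<Longrightarrow> x = (0::real)"
  by (rule Ints_nonzero_abs_less1)

lemma disc_meets_in_strand:
  assumes "disc_meets_in D c r Ss" "(i, a, b) \<in> set Ss"
  shows "i < components D" "a < b" "b < a + 1" "curve D i a \<in> sphere c r" "curve D i b \<in> sphere c r"
    "(curve D i a - c) \<bullet> velocity D i a < 0" "(curve D i b - c) \<bullet> velocity D i b > 0"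
    "\<not> double_point D i a j t" "\<not> double_point D i b j t"
    "s \<in> {a<..<b} \<Longrightarrow> curve D i s \<in> ball c r"
proof -
  have "\<forall>(i, a, b)\<in>set Ss.
        i < components D \<and> a < b \<and> b < a + 1 \<and>
        curve D i a \<in> sphere c r \<and> curve D i b \<in> sphere c r \<and>
        (curve D i a - c) \<bullet> velocity D i a < 0 \<and> (curve D i b - c) \<bullet> velocity D i b > 0 \<and>
        (\<nexists>j t. double_point D i a j t \<or> double_point D i b j t) \<and>
        (\<forall>s\<in>{a<..<b}. curve D i s \<in> ball c r)"
    using assms(1) unfolding disc_meets_in_def by (elim conjE)
  from bspec[OF this assms(2)]
  show "i < components D" "a < b" "b < a + 1" "curve D i a \<in> sphere c r" "curve D i b \<in> sphere c r"
    "(curve D i a - c) \<bullet> velocity D i a < 0" "(curve D i b - c) \<bullet> velocity D i b > 0"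
    "\<not> double_point D i a j t" "\<not> double_point D i b j t"
    "s \<in> {a<..<b} \<Longrightarrow> curve D i s \<in> ball c r"
    by (simp_all del: mem_sphere mem_ball)
qed

lemma strands_disjoint:
  assumes "disc_meets_in D c r Ss" "S \<in> set Ss" "T \<in> set Ss" "on_strand S i s" "on_strand T i s"
  shows "S = T"
  using assms unfolding disc_meets_in_def in_set_conv_nth by metis

lemma inside_strand_imp_ball:
  assumes "is_diagram D" "disc_meets_in D c r Ss" "S \<in> set Ss" "inside_strand S i s"
  shows "i < components D" "curve D i s \<in> ball c r"
proof -
  obtain a b where S: "S = (i, a, b)" using assms(4) by (cases S) (auto simp: inside_strand_iff)
  then obtain u where u: "u \<in> {a<..<b}" "s - u \<in> \<int>"
    using assms(4) by (auto simp: inside_strand_iff)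
  show "i < components D"
    using disc_meets_in_strand[OF assms(2)] assms(3) S by blast
  then have "curve D i s = curve D i u"
    using curve_Ints[OF is_diagram_regular[OF assms(1)]] u by blast
  then show "curve D i s \<in> ball c r"
    using disc_meets_in_strand(10)[OF assms(2)] assms(3) S u by metis
qed

lemma ball_imp_inside_strand:
  assumes "is_diagram D" "disc_meets_in D c r Ss" "i < components D" "curve D i s \<in> ball c r"
  shows "\<exists>S\<in>set Ss. inside_strand S i s"
proof -
  have "curve D i s \<in> cball c r"
    using assms(4) by auto
  then obtain S where S: "S \<in> set Ss" "on_strand S i s"
    using assms unfolding disc_meets_in_def by blast
  obtain a b where Sab: "S = (i, a, b)" using S(2) by (cases S) (auto simp: on_strand_iff)
  then obtain u where u: "u \<in> {a..b}" "s - u \<in> \<int>"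
    using S by (auto simp: on_strand_iff)
  have "curve D i s = curve D i u"
    using curve_Ints[OF is_diagram_regular[OF assms(1)]] u assms by blast
  then have "u \<noteq> a" "u \<noteq> b"
    using disc_meets_in_strand(4,5)[OF assms(2), of i a b] S(1) Sab assms(4) by auto
  with u S Sab show ?thesis
    by (intro bexI[of _ S]) (auto simp: inside_strand_iff intro!: bexI[of _ u])
qed

definition crossings_between :: "diagram \<Rightarrow> strand \<Rightarrow> strand \<Rightarrow> (real \<times> real) set" where
  "crossings_between D S T = {p \<in> meetings D S T. S = T \<longrightarrow> fst p \<noteq> snd p}"

definition sign_sum :: "diagram \<Rightarrow> strand \<Rightarrow> strand \<Rightarrow> real" where
  "sign_sum D S T = (\<Sum>p\<in>crossings_between D S T. strand_sign D S T p)"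

text \<open>
  The closed intervals in \<open>meetings\<close> add nothing to the open ones, since end points of strands are not
  crossings; and different strands have no parameter in common modulo \<open>1\<close>.
\<close>

lemma crossings_between_iff:
  assumes D: "is_diagram D" "disc_meets_in D c r Ss" and S: "(i, a, b) \<in> set Ss" and T: "(j, a', b') \<in> set Ss"
  shows "(s, t) \<in> crossings_between D (i, a, b) (j, a', b') \<longleftrightarrow>
     s \<in> {a<..<b} \<and> t \<in> {a'<..<b'} \<and> double_point D i s j t"
proof
  assume st: "(s, t) \<in> crossings_between D (i, a, b) (j, a', b')"
  then have st': "s \<in> {a..b}" "t \<in> {a'..b'}" "curve D i s = curve D j t"
    by (auto simp: crossings_between_def meetings_def)
  have "\<not> same_parameter i s j t"
  proof
    assume same: "same_parameter i s j t"
    then have "on_strand (i, a, b) i s"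
      using st' by (auto simp: on_strand_iff intro!: bexI[of _ s])
    moreover have "on_strand (j, a', b') i s"
      using st' same by (auto simp: on_strand_iff same_parameter_def intro!: bexI[of _ t])
    ultimately have eq: "(i, a, b) = (j, a', b')"
      using strands_disjoint[OF D(2) S T] by blast
    then have "s \<noteq> t"
      using st by (auto simp: crossings_between_def)
    moreover have "\<bar>s - t\<bar> < 1"
      using st' eq disc_meets_in_strand(2,3)[OF D(2) S] by auto
    ultimately show False
      using same Ints_small_eq_0[of "s - t"] by (auto simp: same_parameter_def)
  qed
  then have d: "double_point D i s j t"
    using st' disc_meets_in_strand(1)[OF D(2) S] disc_meets_in_strand(1)[OF D(2) T] by (simp add: double_point_def)
  have "s \<noteq> a" "s \<noteq> b" "t \<noteq> a'" "t \<noteq> b'"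
    using d disc_meets_in_strand(8,9)[OF D(2) S] disc_meets_in_strand(8,9)[OF D(2) T] double_point_sym by metis+
  with st' d show "s \<in> {a<..<b} \<and> t \<in> {a'<..<b'} \<and> double_point D i s j t"
    by auto
next
  assume "s \<in> {a<..<b} \<and> t \<in> {a'<..<b'} \<and> double_point D i s j t"
  then show "(s, t) \<in> crossings_between D (i, a, b) (j, a', b')"
    by (auto simp: crossings_between_def meetings_def double_point_def same_parameter_def)
qed

definition crossings_inside :: "diagram \<Rightarrow> strand \<Rightarrow> strand \<Rightarrow> (nat \<times> real \<times> nat \<times> real) set" where
  "crossings_inside D S T =
     {(i, s, j, t). (i, s, j, t) \<in> ordered_crossings D \<and> inside_strand S i s \<and> inside_strand T j t}"

text \<open>
  A strand is shorter than a period, so passing to fractional parts is injective on its parameters.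
\<close>

lemma sign_sum_eq:
  assumes D: "is_diagram D" "disc_meets_in D c r Ss" and S: "S \<in> set Ss" and T: "T \<in> set Ss"
  shows "sign_sum D S T = (\<Sum>(i, s, j, t)\<in>crossings_inside D S T. crossing_sign D i s j t)"
proof -
  obtain i a b j a' b' where [simp]: "S = (i, a, b)" "T = (j, a', b')" by (metis prod_cases3)
  note iff = crossings_between_iff[OF D S[simplified] T[simplified]]
  define X where "X = (\<lambda>(s, t). (i, s, j, t)) ` crossings_between D S T"
  have reg: "regular_closed_curves D" using D by (intro is_diagram_regular)
  have inj: "inj_on reduce X"
  proof (rule inj_onI)
    fix x y assume "x \<in> X" "y \<in> X" and eq: "reduce x = reduce y"
    then obtain s t s' t' where x: "x = (i, s, j, t)" "y = (i, s', j, t')"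
      and m: "(s, t) \<in> crossings_between D S T" "(s', t') \<in> crossings_between D S T"
      by (auto simp: X_def)
    have "s - s' \<in> \<int>" "t - t' \<in> \<int>"
      using eq by (auto simp: x reduce_def frac_eq_iff)
    moreover have "\<bar>s - s'\<bar> < 1" "\<bar>t - t'\<bar> < 1"
      using m disc_meets_in_strand(2,3)[OF D(2)] S T by (auto simp: iff abs_less_iff) (smt (verit))+
    ultimately show "x = y"
      using Ints_small_eq_0[of "s - s'"] Ints_small_eq_0[of "t - t'"] by (simp add: x)
  qed
  have "reduce ` X = crossings_inside D S T"
  proof (intro equalityI subsetI)
    fix x assume "x \<in> reduce ` X"
    then obtain s t where x: "x = (i, frac s, j, frac t)" and m: "(s, t) \<in> crossings_between D S T"
      by (auto simp: X_def reduce_def)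
    have "inside_strand S i (frac s)"
      using m by (auto simp: iff inside_strand_iff intro!: bexI[of _ s])
    moreover have "inside_strand T j (frac t)"
      using m by (auto simp: iff inside_strand_iff intro!: bexI[of _ t])
    ultimately show "x \<in> crossings_inside D S T"
      using m by (auto simp: x iff crossings_inside_def ordered_crossings_def reg frac_lt_1)
  next
    fix x assume x: "x \<in> crossings_inside D S T"
    then obtain s t where [simp]: "x = (i, s, j, t)" and st: "s \<in> {0..<1}" "t \<in> {0..<1}" "double_point D i s j t"
      by (auto simp: crossings_inside_def ordered_crossings_def inside_strand_iff)
    obtain u v where uv: "u \<in> {a<..<b}" "s - u \<in> \<int>" "v \<in> {a'<..<b'}" "t - v \<in> \<int>"
      using x by (auto simp: crossings_inside_def inside_strand_iff)
    then have "double_point D i u j v"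
      by (intro double_point_shift[OF reg st(3)]) (auto simp: same_parameter_sym same_parameter_def Ints_diff minus_in_Ints_iff[symmetric, of "u - s"] minus_in_Ints_iff[symmetric, of "v - t"])
    then have "(u, v) \<in> crossings_between D S T"
      using uv by (simp add: iff)
    moreover have "frac u = s" "frac v = t"
      using uv st frac_eq_iff[of s u] frac_eq_iff[of t v] by (auto simp: frac_eq)
    ultimately show "x \<in> reduce ` X"
      by (auto simp: X_def reduce_def image_iff intro!: bexI[of _ "(u, v)"])
  qed
  then have "(\<Sum>(i, s, j, t)\<in>crossings_inside D S T. crossing_sign D i s j t) = (\<Sum>(i, s, j, t)\<in>X. crossing_sign D i s j t)"
    using sum_crossing_sign_reduce[OF D(1) inj] by (force simp: X_def iff)
  also have "\<dots> = (\<Sum>(s, t)\<in>crossings_between D S T. crossing_sign D i s j t)"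
    unfolding X_def by (subst sum.reindex) (auto simp: inj_on_def intro!: sum.cong)
  finally show ?thesis
    by (simp add: sign_sum_def strand_sign_def case_prod_unfold)
qed

text \<open>
  Being inside a strand is the same as lying in the open disc, a property of the point and not of the
  branch through it.
\<close>

lemma double_point_inside_iff:
  assumes "is_diagram D" "disc_meets_in D c r Ss" "double_point D i s j t"
  shows "(\<exists>S\<in>set Ss. inside_strand S i s) \<longleftrightarrow> (\<exists>S\<in>set Ss. inside_strand S j t)"
  using inside_strand_imp_ball[OF assms(1,2)] ball_imp_inside_strand[OF assms(1,2)] assms(3)
  unfolding double_point_def by metis

definition crossings_outside :: "diagram \<Rightarrow> strand list \<Rightarrow> (nat \<times> real \<times> nat \<times> real) set" where
  "crossings_outside D Ss =
     {(i, s, j, t). (i, s, j, t) \<in> ordered_crossings D \<and> (\<forall>S\<in>set Ss. \<not> inside_strand S i s \<and> \<not> inside_strand S j t)}"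

lemma double_writhe_split:
  assumes D: "is_diagram D" "disc_meets_in D c r Ss"
  shows "double_writhe D = (\<Sum>(i, s, j, t)\<in>crossings_outside D Ss. crossing_sign D i s j t) +
     (\<Sum>S\<in>set Ss. \<Sum>T\<in>set Ss. sign_sum D S T)"
proof -
  let ?g = "\<lambda>(i, s, j, t). crossing_sign D i s j t"
  let ?In = "\<Union>(S, T)\<in>set Ss \<times> set Ss. crossings_inside D S T"
  have fin: "finite (ordered_crossings D)"
    using D(1) by (rule finite_ordered_crossings)
  have fin_in: "finite (crossings_inside D S T)" for S T
    by (rule finite_subset[OF _ fin]) (auto simp: crossings_inside_def)
  have "ordered_crossings D = crossings_outside D Ss \<union> ?In"
  proof (intro equalityI subsetI)
    fix x assume x: "x \<in> ordered_crossings D"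
    obtain i s j t where [simp]: "x = (i, s, j, t)" by (metis prod_cases4)
    have "double_point D i s j t"
      using x by (simp add: ordered_crossings_def)
    from double_point_inside_iff[OF D this] x show "x \<in> crossings_outside D Ss \<union> ?In"
      by (auto simp: crossings_outside_def crossings_inside_def)
  qed (auto simp: crossings_outside_def crossings_inside_def)
  then have "double_writhe D = sum ?g (crossings_outside D Ss \<union> ?In)"
    by (simp add: double_writhe_def)
  also have "\<dots> = sum ?g (crossings_outside D Ss) + sum ?g ?In"
    by (rule sum.union_disjoint)
       (auto intro!: fin_in finite_subset[OF _ fin] simp: crossings_outside_def crossings_inside_def)
  also have "sum ?g ?In = (\<Sum>x\<in>set Ss \<times> set Ss. sum ?g (case x of (S, T) \<Rightarrow> crossings_inside D S T))"
  proof (rule sum.UNION_disjoint)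
    show "\<forall>x\<in>set Ss \<times> set Ss. \<forall>y\<in>set Ss \<times> set Ss. x \<noteq> y \<longrightarrow>
       (case x of (S, T) \<Rightarrow> crossings_inside D S T) \<inter> (case y of (S, T) \<Rightarrow> crossings_inside D S T) = {}"
    proof (clarify, rule ccontr)
      fix S T S' T'
      assume mem: "S \<in> set Ss" "T \<in> set Ss" "S' \<in> set Ss" "T' \<in> set Ss"
        and ne: "\<not> (S = S' \<and> T = T')" "crossings_inside D S T \<inter> crossings_inside D S' T' \<noteq> {}"
      then obtain i s j t where "inside_strand S i s" "inside_strand S' i s" "inside_strand T j t" "inside_strand T' j t"
        unfolding crossings_inside_def by blast
      with mem have "S = S'" "T = T'"
        by (auto intro: strands_disjoint[OF D(2)] dest!: inside_strand_imp_on_strand)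
      with ne show False by blast
    qed
  qed (auto simp: fin_in)
  also have "\<dots> = (\<Sum>S\<in>set Ss. \<Sum>T\<in>set Ss. sign_sum D S T)"
    by (simp add: sum.cartesian_product sign_sum_eq[OF D] case_prod_unfold)
  finally show ?thesis .
qed

lemma sign_sum_swap:
  assumes D: "is_diagram D" "disc_meets_in D c r Ss" and S: "S \<in> set Ss" and T: "T \<in> set Ss"
  shows "sign_sum D T S = sign_sum D S T"
proof -
  obtain i a b j a' b' where [simp]: "S = (i, a, b)" "T = (j, a', b')" by (metis prod_cases3)
  note iff = crossings_between_iff[OF D S[simplified] T[simplified]]
  have "crossings_between D T S = prod.swap ` crossings_between D S T"
    by (force simp: crossings_between_def meetings_def image_iff)
  then have "sign_sum D T S = (\<Sum>p\<in>crossings_between D S T. strand_sign D T S (prod.swap p))"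
    unfolding sign_sum_def by (simp add: sum.reindex inj_on_subset[OF inj_swap])
  also have "\<dots> = sign_sum D S T"
    unfolding sign_sum_def
    by (rule sum.cong) (use iff in \<open>auto simp: strand_sign_def crossing_sign_swap[OF D(1)]\<close>)
  finally show ?thesis .
qed

lemma sign_sum_simple_strand: "simple_strand D S \<Longrightarrow> sign_sum D S S = 0"
proof -
  assume "simple_strand D S"
  then have "crossings_between D S S = {}"
    by (cases S) (auto simp: simple_strand_def crossings_between_def meetings_def inj_on_def)
  then show ?thesis by (simp add: sign_sum_def)
qed

text \<open>
  At an end point of a strand the two curves are known to agree on one side only, but both
  velocities are continuous and the end point is a limit of parameters off all strands.
\<close>

lemma velocity_outside_eq:
  assumes D: "is_diagram D" "is_diagram D'" "components D' = components D" "disc_meets_in D c r Ss"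
    and out: "\<And>s. \<forall>S\<in>set Ss. \<not> inside_strand S i s \<Longrightarrow> curve D' i s = curve D i s"
    and i: "i < components D" and s: "\<forall>S\<in>set Ss. \<not> inside_strand S i s"
  shows "velocity D' i s = velocity D i s"
proof -
  define W where "W = {x. \<forall>S\<in>set Ss. \<not> on_strand S i x}"
  have "open W"
  proof -
    have "W = (\<Inter>S\<in>set Ss. - {s. on_strand S i s})"
      by (auto simp: W_def)
    moreover have "open (\<Inter>S\<in>set Ss. - {s. on_strand S i s})"
      using closed_on_strand by (intro open_INT) (auto simp: open_Compl)
    ultimately show ?thesis by simp
  qed
  have eq: "velocity D' i x - velocity D i x = 0" if "x \<in> W" for x
  proof -
    have "(curve D i has_vector_derivative velocity D i x) (at x)"
      using curve_has_vector_derivative[OF is_diagram_regular[OF D(1)] i] .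
    then have "(curve D' i has_vector_derivative velocity D i x) (at x)"
    proof (rule has_vector_derivative_transform_within_open[OF _ \<open>open W\<close> that])
      fix y assume "y \<in> W"
      then show "curve D i y = curve D' i y"
        using out[of y] inside_strand_imp_on_strand by (force simp: W_def)
    qed
    then show ?thesis by (simp add: vector_derivative_at)
  qed
  have "s \<in> closure W"
  proof (cases "s \<in> W")
    case False
    then obtain S where S: "S \<in> set Ss" "on_strand S i s"
      by (auto simp: W_def)
    from S(2) obtain a b where Sab: "S = (i, a, b)" by (cases S) (auto simp: on_strand_iff)
    obtain u where u: "u \<in> {a..b}" "s - u \<in> \<int>" using S Sab by (auto simp: on_strand_iff)
    have ab: "a < b" "b < a + 1"
      using disc_meets_in_strand(2,3)[OF D(4)] S Sab by auto
    have "u = a \<or> u = b"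
      using s S(1) Sab u by (force simp: inside_strand_iff)
    define U where "U = (\<Inter>T\<in>set Ss - {S}. - {s. on_strand T i s})"
    have "open U"
      unfolding U_def using closed_on_strand by (intro open_INT) (auto simp: open_Compl)
    moreover have "s \<in> U"
      using strands_disjoint[OF D(4) S(1) _ S(2)] by (auto simp: U_def)
    ultimately obtain e where e: "e > 0" "ball s e \<subseteq> U"
      using open_contains_ball by blast
    \<comment> \<open>Just outside the strand one is on no strand at all.\<close>
    have "\<exists>x\<in>W. dist x s < d" if "d > 0" for d
    proof -
      define h where "h = min (min d e) (a + 1 - b) / 2"
      have h: "h > 0" "h < d" "h < e" "h < a + 1 - b"
        using that e ab by (auto simp: h_def min_def)
      define x where "x = (if u = b then s + h else s - h)"
      have "\<not> on_strand S i x"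
      proof
        assume "on_strand S i x"
        then obtain v where v: "v \<in> {a..b}" "x - v \<in> \<int>" using Sab by (auto simp: on_strand_iff)
        have "x - v - (s - u) \<in> \<int>"
          by (rule Ints_diff[OF v(2) u(2)])
        then have "(if u = b then b + h else a - h) - v \<in> \<int>"
          using \<open>u = a \<or> u = b\<close> by (auto simp: x_def algebra_simps split: if_splits)
        moreover have "\<bar>(if u = b then b + h else a - h) - v\<bar> < 1"
          using h v by auto
        ultimately have "(if u = b then b + h else a - h) - v = 0"
          by (rule Ints_small_eq_0)
        then show False
          using h v by (auto split: if_splits)
      qed
      moreover have "x \<in> ball s e"
        using h by (auto simp: x_def dist_real_def)
      ultimately have "x \<in> W"
        using e(2) by (auto simp: W_def U_def)
      then show ?thesis
        using h by (intro bexI[of _ x]) (auto simp: x_def dist_real_def)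
    qed
    then show ?thesis
      by (simp add: closure_approachable)
  qed (use closure_subset in auto)
  have "velocity D' i s - velocity D i s = 0"
    by (rule continuous_constant_on_closure[where S = W, OF _ eq \<open>s \<in> closure W\<close>])
       (use D i in \<open>auto intro!: continuous_intros continuous_on_velocity is_diagram_regular\<close>)
  then show ?thesis by simp
qed

text \<open>
  By \<open>double_point_inside_iff\<close> a crossing has both of its branches inside the disc or both
  outside, and those outside are the same, with the same signs, in the two diagrams.
\<close>

lemma local_change_double_writhe:
  assumes L: "local_change D D' c r Ss"
  shows "double_writhe D' + (\<Sum>S\<in>set Ss. \<Sum>T\<in>set Ss. sign_sum D S T) =
         double_writhe D + (\<Sum>S\<in>set Ss. \<Sum>T\<in>set Ss. sign_sum D' S T)"
proof -
  have D: "is_diagram D" "is_diagram D'" "components D' = components D"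
      "disc_meets_in D c r Ss" "disc_meets_in D' c r Ss"
    and out: "\<And>i s. i < components D \<Longrightarrow> \<forall>S\<in>set Ss. \<not> inside_strand S i s \<Longrightarrow> curve D' i s = curve D i s"
    and ov: "\<And>i s j t. \<forall>S\<in>set Ss. \<not> inside_strand S i s \<and> \<not> inside_strand S j t \<Longrightarrow> double_point D i s j t
        \<Longrightarrow> over D' i s j t = over D i s j t"
    using L unfolding local_change_def by blast+
  have vel: "velocity D' i s = velocity D i s"
    if "i < components D" "\<forall>S\<in>set Ss. \<not> inside_strand S i s" for i s
    using velocity_outside_eq[OF D(1-4) out[OF that(1)] that] by blast
  have dp: "double_point D' i s j t \<longleftrightarrow> double_point D i s j t"
    if "\<forall>S\<in>set Ss. \<not> inside_strand S i s \<and> \<not> inside_strand S j t" for i s j t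
    using that out D(3) by (auto simp: double_point_def)
  have "crossings_outside D' Ss = crossings_outside D Ss"
    using dp by (auto simp: crossings_outside_def ordered_crossings_def)
  moreover have "crossing_sign D' i s j t = crossing_sign D i s j t" if "(i, s, j, t) \<in> crossings_outside D Ss" for i s j t
  proof -
    from that have o: "\<forall>S\<in>set Ss. \<not> inside_strand S i s \<and> \<not> inside_strand S j t" and d: "double_point D i s j t"
      by (auto simp: crossings_outside_def ordered_crossings_def)
    then have "i < components D" "j < components D"
      by (auto simp: double_point_def)
    with o d show ?thesis
      using ov[OF o d] by (simp add: crossing_sign_def vel)
  qed
  ultimately have "(\<Sum>(i, s, j, t)\<in>crossings_outside D' Ss. crossing_sign D' i s j t) =
      (\<Sum>(i, s, j, t)\<in>crossings_outside D Ss. crossing_sign D i s j t)"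
    by (intro sum.cong) auto
  then show ?thesis
    using double_writhe_split[OF D(1,4)] double_writhe_split[OF D(2,5)] by simp
qed

lemma local_change_imp:
  assumes "local_change D D' c r Ss"
  shows "is_diagram D" "is_diagram D'" "components D' = components D"
      "disc_meets_in D c r Ss" "disc_meets_in D' c r Ss"
  using assms unfolding local_change_def by blast+

lemma strands_distinct:
  assumes "disc_meets_in D c r Ss"
  shows "distinct Ss"
proof -
  have "Ss ! k \<noteq> Ss ! l" if kl: "k < length Ss" "l < length Ss" "k \<noteq> l" for k l
  proof
    assume eq: "Ss ! k = Ss ! l"
    obtain i a b where S: "Ss ! k = (i, a, b)" by (metis prod_cases3)
    with kl have "(i, a, b) \<in> set Ss" by (metis nth_mem)
    then have "on_strand (Ss ! k) i a"
      using disc_meets_in_strand(2)[OF assms] by (force simp: S on_strand_iff)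
    with eq kl assms show False
      unfolding disc_meets_in_def by metis
  qed
  then show ?thesis by (simp add: distinct_conv_nth)
qed


section \<open>Turning of a simple strand\<close>

text \<open>
  Strict convexity of the disc: from a boundary point all other points of the disc are seen on the inner
  side of the tangent line.
\<close>

lemma inner_inward_pos:
  fixes c x y :: complex
  assumes "y \<in> sphere c r" "x \<in> cball c r" "x \<noteq> y"
  shows "(x - y) \<bullet> (c - y) > 0"
proof -
  have y: "(c - y) \<bullet> (c - y) = r\<^sup>2" and x: "(x - c) \<bullet> (x - c) \<le> r\<^sup>2"
    using assms by (auto simp: dist_norm dot_square_norm norm_minus_commute power2_eq_square intro!: mult_mono)
  have "0 < (x - y) \<bullet> (x - y)"
    using assms(3) by simp
  also have "(x - y) \<bullet> (x - y) = (x - c) \<bullet> (x - c) - (c - y) \<bullet> (c - y) + 2 * ((x - y) \<bullet> (c - y))"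
    by (simp add: algebra_simps inner_commute)
  finally show ?thesis using x y by linarith
qed

lemma divide_notin_nonpos_Reals:
  fixes z n :: complex
  assumes "z \<bullet> n > 0"
  shows "z / n \<notin> \<real>\<^sub>\<le>\<^sub>0"
proof -
  have "n \<noteq> 0" using assms by auto
  have "Re (z / n) = (z \<bullet> n) / (norm n)\<^sup>2"
    by (simp add: Re_divide inner_complex_def cmod_power2)
  with assms \<open>n \<noteq> 0\<close> have "Re (z / n) > 0" by simp
  then show ?thesis by (auto simp: complex_nonpos_Reals_iff)
qed

text \<open>
  The angle turned by an embedded arc across the disc from \<open>x\<close> to \<open>y\<close>, with end velocities \<open>u\<close> and
  \<open>v\<close>: first from \<open>u\<close> to the chord \<open>w\<close>, through directions pointing into the disc at \<open>x\<close>, then from \<open>w\<close> to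
  \<open>v\<close>, through directions pointing out of the disc at \<open>y\<close>.
\<close>

definition chord_turning :: "complex \<Rightarrow> real \<Rightarrow> real \<Rightarrow> complex \<Rightarrow> complex \<Rightarrow> complex \<Rightarrow> complex \<Rightarrow> complex" where
  "chord_turning c a b x y u v =
     (let w = (y - x) /\<^sub>R (b - a)
      in (Ln (w / (c - x)) - Ln (u / (c - x))) + (Ln (v / (y - c)) - Ln (w / (y - c))))"

text \<open>
  Hopf's argument.  The secants do not vanish on the triangle of parameters \<open>s \<le> t\<close>,
  hence have a logarithm there, and the increment of this logarithm along the diagonal, which is the
  turning of the velocity, equals the increment along the two legs.
\<close>

lemma turning_simple_strand:
  assumes \<gamma>: "\<gamma> C1_differentiable_on UNIV" and nz: "\<And>s. vector_derivative \<gamma> (at s) \<noteq> 0"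
    and ab: "a < b" and inj: "inj_on \<gamma> {a..b}"
    and ends: "\<gamma> a \<in> sphere c r" "\<gamma> b \<in> sphere c r" and ball: "\<And>s. s \<in> {a<..<b} \<Longrightarrow> \<gamma> s \<in> ball c r"
    and dir: "(\<gamma> a - c) \<bullet> vector_derivative \<gamma> (at a) < 0" "(\<gamma> b - c) \<bullet> vector_derivative \<gamma> (at b) > 0"
  shows "turning (\<lambda>s. vector_derivative \<gamma> (at s)) a b =
     chord_turning c a b (\<gamma> a) (\<gamma> b) (vector_derivative \<gamma> (at a)) (vector_derivative \<gamma> (at b))"
proof -
  define V where "V = (\<lambda>s. vector_derivative \<gamma> (at s))"
  define Tr where "Tr = {p \<in> {a..b} \<times> {a..b}. fst p \<le> snd p}"
  have sec: "continuous_on A (secant \<gamma>)" for A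
    using continuous_on_secant[OF \<gamma>] continuous_on_subset by blast
  have cball: "\<gamma> s \<in> cball c r" if "s \<in> {a..b}" for s
    using ends ball[of s] that by (cases "s = a \<or> s = b") auto
  have Tr_nz: "secant \<gamma> p \<noteq> 0" if "p \<in> Tr" for p
  proof (cases "fst p = snd p")
    case True
    then show ?thesis using nz by (metis prod.collapse secant_diagonal)
  next
    case False
    have "\<gamma> (fst p) \<noteq> \<gamma> (snd p)"
      using inj_onD[OF inj, of "fst p" "snd p"] False that by (auto simp: Tr_def)
    then show ?thesis using secant_eq_0_iff[OF False, of \<gamma>] by simp
  qed
  have "convex Tr"
  proof -
    have "Tr = ({a..b} \<times> {a..b}) \<inter> {p. (-1, 1) \<bullet> p \<ge> 0}"
      by (auto simp: Tr_def)
    then show ?thesis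
      by (simp only: convex_Int convex_Times convex_real_interval convex_halfspace_ge)
  qed
  then obtain q where q: "continuous_on Tr q" "\<And>p. p \<in> Tr \<Longrightarrow> secant \<gamma> p = exp (q p)"
    using continuous_logarithm_on_contractible[OF sec convex_imp_contractible Tr_nz] by metis
  have 1: "turning V a b = q (b, b) - q (a, a)"
    by (rule turning_eqI)
       (use ab q in \<open>auto simp: V_def Tr_def intro!: continuous_on_compose2[OF q(1)] continuous_intros simp flip: q(2)\<close>)
  have 2: "turning (\<lambda>t. secant \<gamma> (a, t)) a b = q (a, b) - q (a, a)"
    by (rule turning_eqI)
       (use ab q in \<open>auto simp: Tr_def intro!: continuous_on_compose2[OF q(1)] continuous_intros\<close>)
  have 3: "turning (\<lambda>s. secant \<gamma> (s, b)) a b = q (b, b) - q (a, b)"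
    by (rule turning_eqI)
       (use ab q in \<open>auto simp: Tr_def intro!: continuous_on_compose2[OF q(1)] continuous_intros\<close>)
  have nza: "c - \<gamma> a \<noteq> 0" and nzb: "\<gamma> b - c \<noteq> 0"
    using dir by auto
  have cs: "continuous_on {a..b} (\<lambda>t. secant \<gamma> (a, t))" "continuous_on {a..b} (\<lambda>s. secant \<gamma> (s, b))"
    by (rule continuous_on_compose2[OF sec[of UNIV]]; auto intro!: continuous_intros)+
  \<comment> \<open>The chords from the initial point and those to the final point stay in a half-plane.\<close>
  have "secant \<gamma> (a, t) \<bullet> (c - \<gamma> a) > 0" if t: "t \<in> {a..b}" for t
  proof (cases "t = a")
    case True
    then show ?thesis using dir(1) by (simp add: inner_commute algebra_simps)
  next
    case False
    then have "\<gamma> t \<noteq> \<gamma> a"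
      using inj_onD[OF inj, of a t] t ab by auto
    then show ?thesis
      using inner_inward_pos[OF ends(1) cball[OF t]] False t by (simp add: secant_off_diagonal)
  qed
  then have 4: "turning (\<lambda>t. secant \<gamma> (a, t)) a b = Ln (secant \<gamma> (a, b) / (c - \<gamma> a)) - Ln (V a / (c - \<gamma> a))"
    using turning_slit_plane[OF cs(1) _ nza] ab divide_notin_nonpos_Reals by (simp add: V_def)
  have "secant \<gamma> (s, b) \<bullet> (\<gamma> b - c) > 0" if s: "s \<in> {a..b}" for s
  proof (cases "s = b")
    case True
    then show ?thesis using dir(2) by (simp add: inner_commute)
  next
    case False
    then have "\<gamma> s \<noteq> \<gamma> b"
      using inj_onD[OF inj, of b s] s ab by auto
    then have "(\<gamma> s - \<gamma> b) \<bullet> (c - \<gamma> b) > 0"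
      by (rule inner_inward_pos[OF ends(2) cball[OF s]])
    then have "(\<gamma> b - \<gamma> s) \<bullet> (\<gamma> b - c) > 0"
      by (simp add: algebra_simps)
    then show ?thesis
      using False s by (simp add: secant_off_diagonal)
  qed
  then have 5: "turning (\<lambda>s. secant \<gamma> (s, b)) a b = Ln (V b / (\<gamma> b - c)) - Ln (secant \<gamma> (a, b) / (\<gamma> b - c))"
    using turning_slit_plane[OF cs(2) _ nzb] ab divide_notin_nonpos_Reals by (simp add: V_def)
  have "secant \<gamma> (a, b) = (\<gamma> b - \<gamma> a) /\<^sub>R (b - a)"
    using ab by (simp add: secant_off_diagonal)
  then have "turning V a b = chord_turning c a b (\<gamma> a) (\<gamma> b) (V a) (V b)"
    using 1 2 3 4 5 by (simp add: chord_turning_def Let_def)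
  then show ?thesis by (simp add: V_def)
qed


section \<open>Replacing strands\<close>

text \<open>
  The winding number can be computed on the period which starts with the strand; there the curves
  differ only on the strand itself.
\<close>

lemma winding_number_replace_strand:
  assumes f: "continuous_on UNIV f" "\<And>x. f x \<noteq> 0" "\<And>x. f (x + 1) = f x"
    and g: "continuous_on UNIV g" "\<And>x. g x \<noteq> 0" "\<And>x. g (x + 1) = g x"
    and ab: "a < b" "b < a + 1"
    and eq: "\<And>x. \<not> inside_strand (i, a, b) i x \<Longrightarrow> g x = f x"
    and tu: "turning g a b = turning f a b"
  shows "winding_number g 0 = winding_number f 0"
proof -
  have cont: "continuous_on A f" "continuous_on A g" for A
    using f(1) g(1) continuous_on_subset by blast+
  have "turning g b (a + 1) = turning f b (a + 1)"
  proof (rule turning_cong, rule eq, rule notI)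
    fix x assume x: "x \<in> {b..a + 1}" "inside_strand (i, a, b) i x"
    then obtain u where "u \<in> {a<..<b}" "x - u \<in> \<int>" by (auto simp: inside_strand_iff)
    with x ab Ints_small_eq_0[of "x - u"] show False by auto
  qed
  then have "turning g a (a + 1) = turning f a (a + 1)"
    using turning_combine[of a "a + 1" f b] turning_combine[of a "a + 1" g b] cont f(2) g(2) ab tu by simp
  then show ?thesis
    using turning_period[OF f, of a] turning_period[OF g, of a] by simp
qed

text \<open>
  The strands are exchanged one at a time.  Each intermediate function is continuous because the two
  given ones agree at the end points of the strands.
\<close>

lemma winding_number_replace_strands:
  assumes "finite F"
    and "continuous_on UNIV f" "\<And>x. f x \<noteq> (0::complex)" "\<And>x. f (x + 1) = f x"
    and g: "continuous_on UNIV g" "\<And>x. g x \<noteq> 0" "\<And>x. g (x + 1) = g x"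
    and F: "\<And>j a b. (j, a, b) \<in> F \<Longrightarrow> j = i \<and> a < b \<and> b < a + 1"
    and dj: "\<And>S T x. S \<in> F \<Longrightarrow> T \<in> F \<Longrightarrow> on_strand S i x \<Longrightarrow> on_strand T i x \<Longrightarrow> S = T"
    and "\<And>x. \<forall>S\<in>F. \<not> inside_strand S i x \<Longrightarrow> g x = f x"
    and "\<And>j a b. (j, a, b) \<in> F \<Longrightarrow> turning g a b = turning f a b"
  shows "winding_number g 0 = winding_number f 0"
  using assms(1-4,8-11)
proof (induction F arbitrary: f rule: finite_induct)
  case empty
  then have "g = f" by auto
  then show ?case by simp
next
  case (insert S F)
  note f = insert.prems(1-3) and eq = insert.prems(6) and tu = insert.prems(7)
  have Sm: "S \<in> insert S F" by simp
  obtain j a b where S': "S = (j, a, b)" by (cases S)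
  then have S: "S = (i, a, b)" and ab: "a < b" "b < a + 1"
    using insert.prems(4) by auto
  define h where "h x = (if inside_strand S i x then g x else f x)" for x
  have h_on: "h x = g x" if "on_strand S i x" for x
  proof (cases "inside_strand S i x")
    case False
    then have "\<forall>T\<in>insert S F. \<not> inside_strand T i x"
      using insert.prems(5)[OF Sm _ that] inside_strand_imp_on_strand by blast
    then show ?thesis using eq by (simp add: h_def)
  qed (simp add: h_def)
  have "continuous_on ({x. on_strand S i x} \<union> - {x. inside_strand S i x}) h"
    unfolding h_def
  proof (rule continuous_on_cases)
    show "\<forall>x. x \<in> {x. on_strand S i x} \<and> \<not> inside_strand S i x \<or> x \<in> - {x. inside_strand S i x} \<and> inside_strand S i x \<longrightarrow> g x = f x"
    proof (intro allI impI)
      fix x assume "x \<in> {x. on_strand S i x} \<and> \<not> inside_strand S i x \<or> x \<in> - {x. inside_strand S i x} \<and> inside_strand S i x"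
      then have "on_strand S i x" "\<not> inside_strand S i x" by auto
      with h_on[of x] show "g x = f x" by (simp add: h_def)
    qed
    show "continuous_on {x. on_strand S i x} g" "continuous_on (- {x. inside_strand S i x}) f"
      using f(1) g(1) continuous_on_subset by blast+
  qed (use closed_on_strand open_inside_strand in \<open>auto simp: closed_Compl\<close>)
  moreover have "{x. on_strand S i x} \<union> - {x. inside_strand S i x} = UNIV"
    using inside_strand_imp_on_strand[of S i] by auto
  ultimately have h1: "continuous_on UNIV h" by simp
  have h2: "h x \<noteq> 0" for x
    using f g by (simp add: h_def)
  have "inside_strand S i (x + 1) = inside_strand S i x" for x
    using inside_strand_Ints[of S i x "x + 1"] inside_strand_Ints[of S i "x + 1" x] by auto
  then have h3: "h (x + 1) = h x" for x
    using f g by (simp add: h_def)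
  have "winding_number g 0 = winding_number h 0"
  proof (rule insert.IH[OF h1 h2 h3])
    show "j = i \<and> a < b \<and> b < a + 1" if "(j, a, b) \<in> F" for j a b
      using insert.prems(4) that by blast
    show "S = T" if "S \<in> F" "T \<in> F" "on_strand S i x" "on_strand T i x" for S T x
      using insert.prems(5) that by blast
    show "g x = h x" if "\<forall>S\<in>F. \<not> inside_strand S i x" for x
      using that eq[of x] by (auto simp: h_def)
    show "turning g a' b' = turning h a' b'" if T: "(j', a', b') \<in> F" for j' a' b'
    proof -
      have "h x = f x" if "x \<in> {a'..b'}" for x
      proof -
        have "on_strand (j', a', b') i x"
          using that insert.prems(4)[of j' a' b'] T by (auto simp: on_strand_iff intro!: bexI[of _ x])
        then have "\<not> inside_strand S i x"
          using insert.prems(5)[of "(j', a', b')" S x] T insert.hyps(2) inside_strand_imp_on_strand[of S i x] by auto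
        then show ?thesis by (simp add: h_def)
      qed
      then have "turning h a' b' = turning f a' b'"
        by (rule turning_cong)
      then show ?thesis
        using tu[of j' a' b'] T by simp
    qed
  qed
  also have "\<dots> = winding_number f 0"
  proof (rule winding_number_replace_strand[OF f h1 h2 h3 ab])
    show "h x = f x" if "\<not> inside_strand (i, a, b) i x" for x
      using that by (simp add: h_def S)
    have "turning h a b = turning g a b"
      by (rule turning_cong, rule h_on) (auto simp: S on_strand_iff intro!: bexI)
    also have "\<dots> = turning f a b"
      using tu[of i a b] S by simp
    finally show "turning h a b = turning f a b" .
  qed
  finally show ?case .
qed

lemma local_change_total_winding:
  assumes L: "local_change D D' c r Ss"
    and simple: "\<And>S. S \<in> set Ss \<Longrightarrow> simple_strand D S \<and> simple_strand D' S"
  shows "total_winding D' = total_winding D"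
proof -
  note D = local_change_imp[OF L]
  have out: "\<And>i s. i < components D \<Longrightarrow> \<forall>S\<in>set Ss. \<not> inside_strand S i s \<Longrightarrow> curve D' i s = curve D i s"
    using L unfolding local_change_def by blast
  have vel: "velocity D' i s = velocity D i s"
    if "i < components D" "\<forall>S\<in>set Ss. \<not> inside_strand S i s" for i s
    using velocity_outside_eq[OF D(1-4) out[OF that(1)] that] by blast
  have reg: "regular_closed_curves D" "regular_closed_curves D'"
    using D is_diagram_regular by blast+
  have "winding_number (velocity D' i) 0 = winding_number (velocity D i) 0" if i: "i < components D" for i
  proof (rule winding_number_replace_strands[where F = "{S \<in> set Ss. fst S = i}" and i = i])
    have i': "i < components D'" using i D by simp
    show "continuous_on UNIV (velocity D i)" "continuous_on UNIV (velocity D' i)"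
      using continuous_on_velocity reg i i' by blast+
    show "velocity D i x \<noteq> 0" "velocity D' i x \<noteq> 0" for x
      using velocity_nonzero reg i i' by blast+
    show "velocity D i (x + 1) = velocity D i x" "velocity D' i (x + 1) = velocity D' i x" for x
      using velocity_periodic reg i i' by blast+
    show "S = T" if "S \<in> {S \<in> set Ss. fst S = i}" "T \<in> {S \<in> set Ss. fst S = i}" "on_strand S i x" "on_strand T i x" for S T x
      using strands_disjoint[OF D(4)] that by blast
    show "velocity D' i x = velocity D i x" if "\<forall>S\<in>{S \<in> set Ss. fst S = i}. \<not> inside_strand S i x" for x
    proof (rule vel[OF i], intro ballI notI)
      fix S assume S: "S \<in> set Ss" "inside_strand S i x"
      have "fst S = i"
        using S(2) by (cases S) (simp add: inside_strand_iff)
      with S that show False by blast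
    qed
    fix j a b assume "(j, a, b) \<in> {S \<in> set Ss. fst S = i}"
    then have S: "(i, a, b) \<in> set Ss" and [simp]: "j = i" by auto
    note m = disc_meets_in_strand[OF D(4) S] and m' = disc_meets_in_strand[OF D(5) S]
    show "j = i \<and> a < b \<and> b < a + 1"
      using m by simp
    have ends: "\<forall>T\<in>set Ss. \<not> inside_strand T i x" if x: "x = a \<or> x = b" for x
    proof (intro ballI notI)
      fix T assume T: "T \<in> set Ss" "inside_strand T i x"
      then have "curve D i x \<in> ball c r"
        using inside_strand_imp_ball[OF D(1,4)] by blast
      with x m(4,5) show False by auto
    qed
    have v: "turning (velocity D i) a b = chord_turning c a b (curve D i a) (curve D i b) (velocity D i a) (velocity D i b)"
      by (rule turning_simple_strand[OF _ velocity_nonzero[OF reg(1) i] m(2) _ m(4,5,10) m(6,7)])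
         (use reg i simple[OF S] in \<open>auto simp: regular_closed_curves_def simple_strand_def\<close>)
    have v': "turning (velocity D' i) a b = chord_turning c a b (curve D' i a) (curve D' i b) (velocity D' i a) (velocity D' i b)"
      by (rule turning_simple_strand[OF _ velocity_nonzero[OF reg(2) i'] m(2) _ m'(4,5,10) m'(6,7)])
         (use reg i' simple[OF S] in \<open>auto simp: regular_closed_curves_def simple_strand_def\<close>)
    show "turning (velocity D' i) a b = turning (velocity D i) a b"
      using v v' ends out[OF i] vel[OF i] by simp
  qed simp
  then show ?thesis
    using D by (simp add: total_winding_def)
qed


section \<open>The effect of the moves\<close>

text \<open>
  The crossing of the curl is counted in both orders, which gives twice its sign.
\<close>

lemma Omega1_invariants:
  assumes "Omega1_forward \<epsilon> D D'"
  shows "double_writhe D' = double_writhe D + 2" "total_winding D' = total_winding D + \<epsilon>"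
proof -
  obtain c r S p where L: "local_change D D' c r [S]" and simple: "simple_strand D S"
    and curl: "single_curl D' S p" and sg: "strand_sign D' S S p = 1" and w: "total_winding D' = total_winding D + \<epsilon>"
    using assms unfolding Omega1_forward_def by blast
  note D = local_change_imp[OF L]
  obtain i a b where S: "S = (i, a, b)" by (cases S)
  note iff = crossings_between_iff[OF D(2,5), of i a b i a b]
  have p: "fst p < snd p" "{q \<in> meetings D' S S. fst q < snd q} = {p}"
    using curl by (auto simp: single_curl_def)
  have "crossings_between D' S S = {p, prod.swap p}"
  proof -
    have "crossings_between D' S S = {q \<in> meetings D' S S. fst q < snd q} \<union> prod.swap ` {q \<in> meetings D' S S. fst q < snd q}"
      by (force simp: crossings_between_def meetings_def S image_iff)
    then show ?thesis unfolding p(2) by (simp add: insert_commute)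
  qed
  moreover have "p \<noteq> prod.swap p"
    using p(1) by (cases p) auto
  moreover have "strand_sign D' S S (prod.swap p) = strand_sign D' S S p"
  proof -
    have "p \<in> crossings_between D' S S"
      using p by (auto simp: crossings_between_def)
    then have "double_point D' i (fst p) i (snd p)"
      using iff[of "fst p" "snd p"] by (auto simp: S)
    then show ?thesis
      using crossing_sign_swap[OF D(2)] by (simp add: strand_sign_def S)
  qed
  ultimately have "sign_sum D' S S = 2"
    using sg by (simp add: sign_sum_def)
  then show "double_writhe D' = double_writhe D + 2"
    using local_change_double_writhe[OF L] sign_sum_simple_strand[OF simple] by simp
  show "total_winding D' = total_winding D + \<epsilon>" by fact
qed

lemma sign_sum_distinct:
  assumes "S \<noteq> T"
  shows "sign_sum D S T = (\<Sum>p\<in>meetings D S T. strand_sign D S T p)"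
  using assms by (simp add: sign_sum_def crossings_between_def)

lemma Omega2a_invariants:
  assumes "Omega2a_forward D D'"
  shows "double_writhe D' = double_writhe D" "total_winding D' = total_winding D"
proof -
  obtain c r S T p q where L: "local_change D D' c r [S, T]"
    and simple: "simple_strand D S" "simple_strand D T" "simple_strand D' S" "simple_strand D' T"
    and m: "meetings D S T = {}" "p \<noteq> q" "meetings D' S T = {p, q}"
      "strand_sign D' S T p = - strand_sign D' S T q"
    using assms unfolding Omega2a_forward_def by blast
  note D = local_change_imp[OF L]
  have ne: "S \<noteq> T"
    using strands_distinct[OF D(4)] by simp
  have "sign_sum D S T = 0" "sign_sum D' S T = 0"
    using m by (simp_all add: sign_sum_distinct[OF ne])
  moreover have "sign_sum D T S = sign_sum D S T" "sign_sum D' T S = sign_sum D' S T"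
    using sign_sum_swap[OF D(1,4)] sign_sum_swap[OF D(2,5)] by simp_all
  ultimately show "double_writhe D' = double_writhe D"
    using local_change_double_writhe[OF L] ne simple by (simp add: sign_sum_simple_strand)
  show "total_winding D' = total_winding D"
    by (rule local_change_total_winding[OF L]) (use simple in auto)
qed

lemma Omega3a_invariants:
  assumes "Omega3a_forward D D'"
  shows "double_writhe D' = double_writhe D" "total_winding D' = total_winding D"
proof -
  obtain c r T M B where L: "local_change D D' c r [T, M, B]"
    and tri: "Omega3a_triangle D T M B (- 1)" "Omega3a_triangle D' T M B 1"
    using assms unfolding Omega3a_forward_def by blast
  note D = local_change_imp[OF L]
  have ne: "T \<noteq> M" "T \<noteq> B" "M \<noteq> B"
    using strands_distinct[OF D(4)] by auto
  have sums: "sign_sum X T M = 1 \<and> sign_sum X M B = 1 \<and> sign_sum X T B = - 1 \<and>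
      sign_sum X T T = 0 \<and> sign_sum X M M = 0 \<and> sign_sum X B B = 0"
    if tri: "Omega3a_triangle X T M B x" for X x
  proof -
    obtain tm mb tb where m: "meetings X T M = {tm}" "meetings X M B = {mb}" "meetings X T B = {tb}"
      "strand_sign X T M tm = 1" "strand_sign X M B mb = 1" "strand_sign X T B tb = - 1"
      using tri unfolding Omega3a_triangle_def by blast
    have "simple_strand X T" "simple_strand X M" "simple_strand X B"
      using tri unfolding Omega3a_triangle_def by blast+
    with m ne show ?thesis
      by (simp add: sign_sum_distinct sign_sum_simple_strand)
  qed
  note s = sums[OF tri(1)] and s' = sums[OF tri(2)]
  have swap: "sign_sum D M T = sign_sum D T M" "sign_sum D B T = sign_sum D T B" "sign_sum D B M = sign_sum D M B"
    using sign_sum_swap[OF D(1,4)] by simp_all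
  have swap': "sign_sum D' M T = sign_sum D' T M" "sign_sum D' B T = sign_sum D' T B" "sign_sum D' B M = sign_sum D' M B"
    using sign_sum_swap[OF D(2,5)] by simp_all
  show "double_writhe D' = double_writhe D"
    using local_change_double_writhe[OF L] ne s s' by (simp add: swap swap')
  show "total_winding D' = total_winding D"
    by (rule local_change_total_winding[OF L]) (use tri in \<open>auto simp: Omega3a_triangle_def\<close>)
qed


section \<open>Planar isotopies\<close>

lemma has_vector_derivative_comp_has_derivative:
  assumes "(g has_vector_derivative v) (at s)" "(\<Phi> has_derivative \<Phi>') (at (g s))"
  shows "((\<lambda>s. \<Phi> (g s)) has_vector_derivative \<Phi>' v) (at s)"
proof -
  have "((\<lambda>s. \<Phi> (g s)) has_derivative (\<lambda>h. \<Phi>' (h *\<^sub>R v))) (at s)"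
    using assms unfolding has_vector_derivative_def by (rule has_derivative_compose)
  moreover have "\<Phi>' (h *\<^sub>R v) = h *\<^sub>R \<Phi>' v" for h
    using assms(2) has_derivative_linear linear_scale by blast
  ultimately show ?thesis
    by (simp add: has_vector_derivative_def)
qed

text \<open>
  A linear map is determined by its values on the basis, so continuity for each fixed vector implies joint
  continuity in the parameter and the vector.
\<close>

lemma continuous_on_linear_family:
  fixes \<Phi>' :: "'p::topological_space \<Rightarrow> 'a::euclidean_space \<Rightarrow> 'b::real_normed_vector"
  assumes "\<And>p. p \<in> A \<Longrightarrow> linear (\<Phi>' p)" "\<And>v. continuous_on A (\<lambda>p. \<Phi>' p v)"
    and f: "continuous_on B f" "f ` B \<subseteq> A" and v: "continuous_on B v"
  shows "continuous_on B (\<lambda>x. \<Phi>' (f x) (v x))"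
proof -
  have "continuous_on B (\<lambda>x. \<Sum>b\<in>Basis. (v x \<bullet> b) *\<^sub>R \<Phi>' (f x) b)"
    by (intro continuous_intros v continuous_on_compose2[OF assms(2) f])
  moreover have "\<Phi>' (f x) (v x) = (\<Sum>b\<in>Basis. (v x \<bullet> b) *\<^sub>R \<Phi>' (f x) b)" if "x \<in> B" for x
  proof -
    have "linear (\<Phi>' (f x))" using assms(1) f(2) that by blast
    then have "\<Phi>' (f x) (\<Sum>b\<in>Basis. (v x \<bullet> b) *\<^sub>R b) = (\<Sum>b\<in>Basis. (v x \<bullet> b) *\<^sub>R \<Phi>' (f x) b)"
      by (simp add: linear_sum linear_scale)
    then show ?thesis by (simp add: euclidean_representation)
  qed
  ultimately show ?thesis
    by (simp cong: continuous_on_cong)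
qed

lemma cross_linear:
  assumes "linear A"
  shows "cross (A u) (A v) = cross (A 1) (A \<i>) * cross u v"
proof -
  have "A z = Re z *\<^sub>R A 1 + Im z *\<^sub>R A \<i>" for z
  proof -
    have "z = Re z *\<^sub>R 1 + Im z *\<^sub>R \<i>" by (simp add: complex_eq_iff)
    then have "A z = A (Re z *\<^sub>R 1 + Im z *\<^sub>R \<i>)" by simp
    then show ?thesis using assms by (simp add: linear_add linear_scale)
  qed
  from this[of u] this[of v] show ?thesis
    by (simp add: cross_def algebra_simps)
qed

lemma cross_inj_nonzero:
  assumes "linear A" "inj A"
  shows "cross (A 1) (A \<i>) \<noteq> 0"
proof
  assume 0: "cross (A 1) (A \<i>) = 0"
  have nz: "A 1 \<noteq> 0" "A \<i> \<noteq> 0"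
    using assms linear_injective_0 by fastforce+
  define z where "z = Complex (A \<i> \<bullet> A 1) (- (A 1 \<bullet> A 1))"
  have "A z = (A \<i> \<bullet> A 1) *\<^sub>R A 1 + (- (A 1 \<bullet> A 1)) *\<^sub>R A \<i>"
  proof -
    have "z = (A \<i> \<bullet> A 1) *\<^sub>R 1 + (- (A 1 \<bullet> A 1)) *\<^sub>R \<i>" by (simp add: z_def complex_eq_iff)
    then have "A z = A ((A \<i> \<bullet> A 1) *\<^sub>R 1 + (- (A 1 \<bullet> A 1)) *\<^sub>R \<i>)" by simp
    then show ?thesis using assms by (simp only: linear_add linear_scale)
  qed
  also have "\<dots> = 0"
  proof (rule complex_eqI)
    have eq: "Re (A 1) * Im (A \<i>) = Im (A 1) * Re (A \<i>)" using 0 by (simp add: cross_def)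
    show "Re ((A \<i> \<bullet> A 1) *\<^sub>R A 1 + (- (A 1 \<bullet> A 1)) *\<^sub>R A \<i>) = Re 0"
      using eq by (simp add: inner_complex_def algebra_simps)
    show "Im ((A \<i> \<bullet> A 1) *\<^sub>R A 1 + (- (A 1 \<bullet> A 1)) *\<^sub>R A \<i>) = Im 0"
      using eq by (simp add: inner_complex_def algebra_simps)
  qed
  finally have "z = 0"
    using assms linear_injective_0 by blast
  then show False
    using nz(1) by (simp add: z_def complex_eq_iff)
qed

text \<open>
  The determinant of the derivative is \<open>1\<close> at time \<open>0\<close> and never vanishes.
\<close>

lemma plane_isotopy_orientation:
  assumes "plane_isotopy \<Phi>"
    and d: "\<And>\<tau> z. \<tau> \<in> {0..1} \<Longrightarrow> (\<Phi> \<tau> has_derivative \<Phi>' \<tau> z) (at z) \<and> inj (\<Phi>' \<tau> z)"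
    and c: "\<And>v. continuous_on ({0..1} \<times> UNIV) (\<lambda>(\<tau>, z). \<Phi>' \<tau> z v)"
  shows "cross (\<Phi>' 1 z 1) (\<Phi>' 1 z \<i>) > 0"
proof -
  let ?d = "\<lambda>\<tau>. cross (\<Phi>' \<tau> z 1) (\<Phi>' \<tau> z \<i>)"
  have slice: "continuous_on {0..1} (\<lambda>\<tau>. \<Phi>' \<tau> z v)" for v
  proof -
    have "continuous_on {0..1} ((\<lambda>(\<tau>, z). \<Phi>' \<tau> z v) \<circ> (\<lambda>\<tau>. (\<tau>, z)))"
      by (intro continuous_on_compose continuous_intros continuous_on_subset[OF c[of v]]) auto
    then show ?thesis by (simp add: o_def)
  qed
  have cont: "continuous_on {0..1} ?d"
    by (intro continuous_intros slice)
  have nz: "?d \<tau> \<noteq> 0" if "\<tau> \<in> {0..1}" for \<tau>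
    using cross_inj_nonzero d[OF that] has_derivative_linear by blast
  have "(id has_derivative \<Phi>' 0 z) (at z)"
    using assms(1) d[of 0 z] by (simp add: plane_isotopy_def)
  then have "\<Phi>' 0 z = id"
    using has_derivative_id has_derivative_unique by blast
  then have 0: "?d 0 = 1" by (simp add: cross_def)
  show ?thesis
  proof (rule ccontr)
    assume "\<not> ?thesis"
    then have "\<exists>x\<ge>0. x \<le> 1 \<and> ?d x = 0"
      using IVT2'[of ?d 1 0 0] 0 cont by auto
    with nz show False by auto
  qed
qed

lemma reparametrisation_facts:
  assumes "reparametrisation \<sigma>"
  shows "(\<sigma> has_real_derivative vector_derivative \<sigma> (at s)) (at s)" "vector_derivative \<sigma> (at s) > 0"
    "continuous_on UNIV \<sigma>" "continuous_on UNIV (\<lambda>s. vector_derivative \<sigma> (at s))"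
    "strict_mono \<sigma>" "\<sigma> (s + of_int n) = \<sigma> s + of_int n" "surj \<sigma>"
    "vector_derivative \<sigma> (at (s + 1)) = vector_derivative \<sigma> (at s)"
proof -
  have C1: "\<sigma> C1_differentiable_on UNIV" and pos: "\<And>s. vector_derivative \<sigma> (at s) > 0" and per: "\<And>s. \<sigma> (s + 1) = \<sigma> s + 1"
    using assms by (auto simp: reparametrisation_def)
  show der: "(\<sigma> has_real_derivative vector_derivative \<sigma> (at s)) (at s)" for s
    using C1 unfolding C1_differentiable_on_eq
    by (simp add: vector_derivative_works has_real_derivative_iff_has_vector_derivative)
  show "vector_derivative \<sigma> (at s) > 0" by (rule pos)
  show cont: "continuous_on UNIV \<sigma>"
    by (meson DERIV_continuous continuous_at_imp_continuous_on der)
  show "continuous_on UNIV (\<lambda>s. vector_derivative \<sigma> (at s))"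
    using C1 by (simp add: C1_differentiable_on_eq)
  show "strict_mono \<sigma>"
    by (rule strict_monoI) (use DERIV_pos_imp_increasing der pos in blast)
  have p: "\<sigma> (s + of_int n) - (s + of_int n) = \<sigma> s - s" for s n
    by (rule periodic_int[of "\<lambda>s. \<sigma> s - s"]) (simp add: per)
  then show shift: "\<sigma> (s + of_int n) = \<sigma> s + of_int n" for s n
    by (metis add_diff_cancel_right' add_diff_eq diff_add_eq diff_eq_eq)
  show "surj \<sigma>"
  proof (unfold surj_def, rule allI)
    fix y
    define n where "n = \<lfloor>y - \<sigma> 0\<rfloor>"
    have "\<sigma> (of_int n) \<le> y" "y \<le> \<sigma> (of_int n + 1)"
      using shift[of 0 n] per[of "of_int n"] by (simp_all add: n_def) linarith+
    then have "\<exists>x\<ge>of_int n. x \<le> of_int n + 1 \<and> \<sigma> x = y"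
      by (intro IVT') (auto intro: continuous_on_subset[OF cont])
    then show "\<exists>x. y = \<sigma> x" by blast
  qed
  have "((\<lambda>s. \<sigma> s - s) has_vector_derivative vector_derivative \<sigma> (at (s + 1)) - 1) (at (s + 1))"
    using der[of "s + 1"] by (auto intro!: derivative_eq_intros simp flip: has_real_derivative_iff_has_vector_derivative)
  from vector_derivative_periodic[OF _ this]
  have "((\<lambda>s. \<sigma> s - s) has_vector_derivative vector_derivative \<sigma> (at (s + 1)) - 1) (at s)"
    by (simp add: per)
  moreover have "((\<lambda>s. \<sigma> s - s) has_vector_derivative vector_derivative \<sigma> (at s) - 1) (at s)"
    using der[of "s"] by (auto intro!: derivative_eq_intros simp flip: has_real_derivative_iff_has_vector_derivative)
  ultimately show "vector_derivative \<sigma> (at (s + 1)) = vector_derivative \<sigma> (at s)"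
    using vector_derivative_unique_at by fastforce
qed

lemma reparametrisation_Ints_iff:
  assumes "reparametrisation \<sigma>"
  shows "\<sigma> s - \<sigma> t \<in> \<int> \<longleftrightarrow> s - t \<in> \<int>"
proof
  assume "s - t \<in> \<int>"
  then obtain n where "s = t + of_int n" by (metis Ints_cases add.commute diff_add_cancel)
  then show "\<sigma> s - \<sigma> t \<in> \<int>"
    using reparametrisation_facts(6)[OF assms] by simp
next
  assume "\<sigma> s - \<sigma> t \<in> \<int>"
  then obtain n where "\<sigma> s = \<sigma> t + of_int n" by (metis Ints_cases add.commute diff_add_cancel)
  then have "\<sigma> s = \<sigma> (t + of_int n)"
    using reparametrisation_facts(6)[OF assms] by simp
  then have "s = t + of_int n"
    using strict_mono_eq[OF reparametrisation_facts(5)[OF assms]] by blast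
  then show "s - t \<in> \<int>" by simp
qed

lemma reparametrisation_homotopy:
  assumes g: "continuous_on UNIV f" "\<And>x. f (x + 1) = f x" and \<sigma>: "reparametrisation \<sigma>" and "\<tau> \<in> {0..1}"
  shows "f ((1 - \<tau>) * (s + 1) + \<tau> * \<sigma> (s + 1)) = f ((1 - \<tau>) * s + \<tau> * \<sigma> s)"
proof -
  have "(1 - \<tau>) * (s + 1) + \<tau> * \<sigma> (s + 1) = ((1 - \<tau>) * s + \<tau> * \<sigma> s) + 1"
    using reparametrisation_facts(6)[OF \<sigma>, of s 1] by (simp add: algebra_simps)
  then show ?thesis using g(2) by metis
qed

text \<open>
  Crossings correspond under the reparametrisations.  The winding number of a component is constant
  along the family obtained by following the isotopy of the plane while deforming the
  reparametrisation linearly from the identity.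
\<close>

lemma planar_isotopic_invariants:
  assumes "planar_isotopic D D'"
  shows "double_writhe D' = double_writhe D" "total_winding D' = total_winding D"
proof -
  obtain \<Phi> \<pi> \<sigma> where D: "is_diagram D" "is_diagram D'" "components D' = components D"
    and \<Phi>: "plane_isotopy \<Phi>" and \<pi>: "bij_betw \<pi> {..<components D} {..<components D}"
    and \<sigma>: "\<And>i. i < components D \<Longrightarrow> reparametrisation (\<sigma> i)"
    and curve: "\<And>i s. i < components D \<Longrightarrow> curve D' i s = \<Phi> 1 (curve D (\<pi> i) (\<sigma> i s))"
    and ov: "\<And>i s j t. double_point D' i s j t \<Longrightarrow> over D' i s j t = over D (\<pi> i) (\<sigma> i s) (\<pi> j) (\<sigma> j t)"
    using assms unfolding planar_isotopic_def by metis
  obtain \<Phi>' where \<Phi>': "\<And>\<tau> z. \<tau> \<in> {0..1} \<Longrightarrow> (\<Phi> \<tau> has_derivative \<Phi>' \<tau> z) (at z) \<and> inj (\<Phi>' \<tau> z)"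
    and c: "\<And>v. continuous_on ({0..1} \<times> UNIV) (\<lambda>(\<tau>, z). \<Phi>' \<tau> z v)"
    using \<Phi> unfolding plane_isotopy_def by metis
  have reg: "regular_closed_curves D" using D by (intro is_diagram_regular)
  have pi: "\<pi> i < components D" if "i < components D" for i
    using \<pi> that by (auto simp: bij_betw_def)
  have pi_inj: "\<pi> i = \<pi> j \<longleftrightarrow> i = j" if "i < components D" "j < components D" for i j
    using \<pi> that by (auto simp: bij_betw_def inj_on_def)
  have lin: "linear (\<Phi>' \<tau> z)" if "\<tau> \<in> {0..1}" for \<tau> z
    using \<Phi>'[OF that] has_derivative_linear by blast
  have vel: "velocity D' i s = vector_derivative (\<sigma> i) (at s) *\<^sub>R \<Phi>' 1 (curve D (\<pi> i) (\<sigma> i s)) (velocity D (\<pi> i) (\<sigma> i s))"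
    if i: "i < components D" for i s
  proof -
    note \<sigma>f = reparametrisation_facts[OF \<sigma>[OF i]]
    have "(\<sigma> i has_vector_derivative vector_derivative (\<sigma> i) (at s)) (at s)"
      using \<sigma>f(1) by (simp add: has_real_derivative_iff_has_vector_derivative)
    from vector_diff_chain_at[OF this curve_has_vector_derivative[OF reg pi[OF i]]]
    have "((\<lambda>s. curve D (\<pi> i) (\<sigma> i s)) has_vector_derivative
        vector_derivative (\<sigma> i) (at s) *\<^sub>R velocity D (\<pi> i) (\<sigma> i s)) (at s)"
      by (simp add: o_def)
    from has_vector_derivative_comp_has_derivative[OF this, of "\<Phi> 1"] \<Phi>'[of 1]
    have "((\<lambda>s. \<Phi> 1 (curve D (\<pi> i) (\<sigma> i s))) has_vector_derivative
        \<Phi>' 1 (curve D (\<pi> i) (\<sigma> i s)) (vector_derivative (\<sigma> i) (at s) *\<^sub>R velocity D (\<pi> i) (\<sigma> i s))) (at s)"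
      by auto
    then have "velocity D' i s =
        \<Phi>' 1 (curve D (\<pi> i) (\<sigma> i s)) (vector_derivative (\<sigma> i) (at s) *\<^sub>R velocity D (\<pi> i) (\<sigma> i s))"
      using ext[of "curve D' i" "\<lambda>s. \<Phi> 1 (curve D (\<pi> i) (\<sigma> i s))", OF curve[OF i]]
      by (simp add: vector_derivative_at)
    then show ?thesis
      using lin[of 1] by (simp add: linear_scale)
  qed
  have "inj (\<Phi> 1)"
    using \<Phi> by (auto simp: plane_isotopy_def bij_def)
  then have dp: "double_point D' i s j t \<longleftrightarrow>
      i < components D \<and> j < components D \<and> double_point D (\<pi> i) (\<sigma> i s) (\<pi> j) (\<sigma> j t)" for i s j t
    using pi pi_inj[of i j] reparametrisation_Ints_iff[OF \<sigma>] D(3)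
    by (auto simp: double_point_def same_parameter_def curve inj_eq)
  have sgn: "crossing_sign D' i s j t = crossing_sign D (\<pi> i) (\<sigma> i s) (\<pi> j) (\<sigma> j t)"
    if d: "double_point D' i s j t" for i s j t
  proof -
    let ?z = "curve D (\<pi> i) (\<sigma> i s)"
    have ij: "i < components D" "j < components D" and z: "curve D (\<pi> j) (\<sigma> j t) = ?z"
      using d dp by (auto simp: double_point_def)
    have pos: "cross (\<Phi>' 1 ?z 1) (\<Phi>' 1 ?z \<i>) > 0"
      using plane_isotopy_orientation[OF \<Phi> \<Phi>' c] .
    have scale: "cross (x *\<^sub>R u) (y *\<^sub>R v) = (x * y) * cross u v" for x y u v
      by (simp add: cross_def algebra_simps)
    have x: "sgn (cross (x *\<^sub>R \<Phi>' 1 ?z u) (y *\<^sub>R \<Phi>' 1 ?z v)) = sgn (cross u v)" if "x > 0" "y > 0" for x y u v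
      unfolding scale cross_linear[OF lin[of 1 ?z, simplified], of u v]
      using pos that by (simp add: sgn_mult)
    show ?thesis
      unfolding crossing_sign_def ov[OF d] vel[OF ij(1)] vel[OF ij(2)] z
      using reparametrisation_facts(2)[OF \<sigma>[OF ij(1)]] reparametrisation_facts(2)[OF \<sigma>[OF ij(2)]]
      by (simp add: x)
  qed
  define F where "F = (\<lambda>(i, s, j, t). (\<pi> i, \<sigma> i s, \<pi> j, \<sigma> j t))"
  have F_inj: "inj_on F (ordered_crossings D')"
  proof (rule inj_onI)
    fix x y assume "x \<in> ordered_crossings D'" "y \<in> ordered_crossings D'" "F x = F y"
    then show "x = y"
      using pi_inj strict_mono_eq[OF reparametrisation_facts(5)[OF \<sigma>]] D(3)
      by (auto simp: F_def ordered_crossings_def double_point_def)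
  qed
  have r_inj: "inj_on reduce (F ` ordered_crossings D')"
  proof (rule inj_onI)
    fix u v assume "u \<in> F ` ordered_crossings D'" "v \<in> F ` ordered_crossings D'" "reduce u = reduce v"
    then obtain i s j t i' s' j' t' where uv: "u = F (i, s, j, t)" "v = F (i', s', j', t')"
      and x: "(i, s, j, t) \<in> ordered_crossings D'" "(i', s', j', t') \<in> ordered_crossings D'"
      "reduce (F (i, s, j, t)) = reduce (F (i', s', j', t'))"
      by auto
    then have c: "i < components D" "j < components D" "i' < components D" "j' < components D"
      using D(3) by (auto simp: ordered_crossings_def double_point_def)
    then have [simp]: "i' = i" "j' = j"
      using x pi_inj by (auto simp: F_def reduce_def)
    have "s - s' \<in> \<int>" "t - t' \<in> \<int>"
      using x c reparametrisation_Ints_iff[OF \<sigma>] by (auto simp: F_def reduce_def frac_eq_iff)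
    moreover have "\<bar>s - s'\<bar> < 1" "\<bar>t - t'\<bar> < 1"
      using x by (auto simp: ordered_crossings_def)
    ultimately show "u = v"
      unfolding uv using Ints_small_eq_0[of "s - s'"] Ints_small_eq_0[of "t - t'"] by simp
  qed
  have img: "reduce ` F ` ordered_crossings D' = ordered_crossings D"
  proof (intro equalityI subsetI)
    fix x assume "x \<in> reduce ` F ` ordered_crossings D'"
    then show "x \<in> ordered_crossings D"
      using dp reg by (auto simp: F_def reduce_def ordered_crossings_def frac_lt_1)
  next
    fix x assume "x \<in> ordered_crossings D"
    then obtain i s j t where x: "x = (i, s, j, t)" and st: "s \<in> {0..<1}" "t \<in> {0..<1}" and d: "double_point D i s j t"
      by (auto simp: ordered_crossings_def)
    then have "i \<in> \<pi> ` {..<components D}" "j \<in> \<pi> ` {..<components D}"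
      using \<pi> by (auto simp: double_point_def bij_betw_def)
    then obtain i' j' where ij: "i' < components D" "j' < components D" "\<pi> i' = i" "\<pi> j' = j"
      by blast
    obtain s' t' where s't': "\<sigma> i' s' = s" "\<sigma> j' t' = t"
      using reparametrisation_facts(7)[OF \<sigma>[OF ij(1)]] reparametrisation_facts(7)[OF \<sigma>[OF ij(2)]] by (metis surjD)
    have "double_point D' i' s' j' t'"
      using d ij s't' dp by simp
    then have mem: "(i', frac s', j', frac t') \<in> ordered_crossings D'"
      using D by (auto simp: ordered_crossings_def frac_lt_1 is_diagram_regular)
    moreover have "reduce (F (i', frac s', j', frac t')) = x"
    proof -
      have "frac (\<sigma> i' (frac s')) = frac s" "frac (\<sigma> j' (frac t')) = frac t"
        using reparametrisation_Ints_iff[OF \<sigma>[OF ij(1)], of "frac s'" s']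
          reparametrisation_Ints_iff[OF \<sigma>[OF ij(2)], of "frac t'" t'] s't' by (simp_all add: frac_eq_iff)
      then show ?thesis
        using st ij by (simp add: x F_def reduce_def frac_eq)
    qed
    ultimately show "x \<in> reduce ` F ` ordered_crossings D'"
      by (metis imageI)
  qed
  have "double_writhe D = (\<Sum>(i, s, j, t)\<in>reduce ` F ` ordered_crossings D'. crossing_sign D i s j t)"
    by (simp add: double_writhe_def img)
  also have "\<dots> = (\<Sum>(i, s, j, t)\<in>F ` ordered_crossings D'. crossing_sign D i s j t)"
    by (rule sum_crossing_sign_reduce[OF D(1) r_inj]) (use dp in \<open>auto simp: F_def ordered_crossings_def\<close>)
  also have "\<dots> = double_writhe D'"
    unfolding double_writhe_def
    by (subst sum.reindex[OF F_inj]) (auto simp: F_def ordered_crossings_def sgn intro!: sum.cong)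
  finally show "double_writhe D' = double_writhe D" by simp

  have "winding_number (velocity D' i) 0 = winding_number (velocity D (\<pi> i)) 0" if i: "i < components D" for i
  proof -
    note \<sigma>f = reparametrisation_facts[OF \<sigma>[OF i]]
    define \<rho> where "\<rho> \<tau> s = (1 - \<tau>) * s + \<tau> * \<sigma> i s" for \<tau> s
    define H where "H \<tau> s = ((1 - \<tau>) + \<tau> * vector_derivative (\<sigma> i) (at s)) *\<^sub>R
      \<Phi>' \<tau> (curve D (\<pi> i) (\<rho> \<tau> s)) (velocity D (\<pi> i) (\<rho> \<tau> s))" for \<tau> s
    have cu: "continuous_on UNIV (curve D (\<pi> i))" "continuous_on UNIV (velocity D (\<pi> i))"
      using continuous_on_curve continuous_on_velocity reg pi[OF i] by blast+
    have \<rho>: "continuous_on ({0..1} \<times> UNIV) (\<lambda>x. \<rho> (fst x) (snd x))"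
      unfolding \<rho>_def by (intro continuous_intros continuous_on_compose2[OF \<sigma>f(3)]) auto
    have "continuous_on ({0..1} \<times> UNIV) (\<lambda>x. \<Phi>' (fst x)
        (curve D (\<pi> i) (\<rho> (fst x) (snd x))) (velocity D (\<pi> i) (\<rho> (fst x) (snd x))))"
      apply (rule continuous_on_linear_family[where \<Phi>' = "\<lambda>p. \<Phi>' (fst p) (snd p)" and A = "{0..1} \<times> UNIV"
          and f = "\<lambda>x. (fst x, curve D (\<pi> i) (\<rho> (fst x) (snd x)))"
          and v = "\<lambda>x. velocity D (\<pi> i) (\<rho> (fst x) (snd x))" and B = "{0..1} \<times> UNIV", unfolded fst_conv snd_conv])
      subgoal using lin by auto
      subgoal for v using c[of v] by (simp add: case_prod_unfold)
      subgoal by (intro continuous_intros continuous_on_compose2[OF cu(1) \<rho>]) auto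
      subgoal by auto
      subgoal by (intro continuous_on_compose2[OF cu(2) \<rho>]) auto
      done
    then have "continuous_on ({0..1} \<times> UNIV) (\<lambda>(\<tau>, s). H \<tau> s)"
      unfolding H_def case_prod_unfold
      by (intro continuous_intros continuous_on_compose2[OF \<sigma>f(4)]) auto
    moreover have "H \<tau> s \<noteq> 0" if t: "\<tau> \<in> {0..1}" for \<tau> s
    proof -
      have "(1 - \<tau>) + \<tau> * vector_derivative (\<sigma> i) (at s) > 0"
        using t \<sigma>f(2)[of s] by (cases "\<tau> = 0") (auto intro: add_nonneg_pos)
      moreover have "\<Phi>' \<tau> z v \<noteq> 0" if "v \<noteq> 0" for z v
        using \<Phi>'[OF t, of z] lin[OF t, of z] that linear_injective_0 by blast
      ultimately show ?thesis
        using velocity_nonzero[OF reg pi[OF i]] by (simp add: H_def)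
    qed
    moreover have "H \<tau> (s + 1) = H \<tau> s" if t: "\<tau> \<in> {0..1}" for \<tau> s
    proof -
      have "curve D (\<pi> i) (\<rho> \<tau> (s + 1)) = curve D (\<pi> i) (\<rho> \<tau> s)"
        unfolding \<rho>_def using reg pi[OF i]
        by (intro reparametrisation_homotopy cu \<sigma> i t) (auto simp: regular_closed_curves_def)
      moreover have "velocity D (\<pi> i) (\<rho> \<tau> (s + 1)) = velocity D (\<pi> i) (\<rho> \<tau> s)"
        unfolding \<rho>_def using reg pi[OF i]
        by (intro reparametrisation_homotopy cu \<sigma> i t velocity_periodic)
      ultimately show ?thesis
        using \<sigma>f(8) by (simp add: H_def)
    qed
    ultimately have "winding_number (H 1) 0 = winding_number (H 0) 0"
      by (rule winding_number_family)
    moreover have "H 1 = velocity D' i"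
      by (rule ext) (simp add: H_def \<rho>_def vel[OF i])
    moreover have "H 0 = velocity D (\<pi> i)"
    proof
      fix s
      have "(id has_derivative \<Phi>' 0 z) (at z)" for z
        using \<Phi> \<Phi>'[of 0 z] by (simp add: plane_isotopy_def)
      then have "\<Phi>' 0 z = id" for z
        using has_derivative_id has_derivative_unique by blast
      then show "H 0 s = velocity D (\<pi> i) s"
        by (simp add: H_def \<rho>_def)
    qed
    ultimately show ?thesis by simp
  qed
  then have "total_winding D' = (\<Sum>i<components D. winding_number (velocity D (\<pi> i)) 0)"
    by (simp add: total_winding_def D(3))
  also have "\<dots> = total_winding D"
    unfolding total_winding_def by (rule sum.reindex_bij_betw[OF \<pi>])
  finally show "total_winding D' = total_winding D" .
qed


section \<open>Quantities monotone along moves\<close>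

text \<open>
  Twice \<open>w + e r\<close>, the number which only one of the two moves of the first kind affects:
  \<open>\<Omega>1a\<close> for \<open>e = -1\<close> and \<open>\<Omega>1b\<close> for \<open>e = 1\<close>.
\<close>

definition balance :: "real \<Rightarrow> diagram \<Rightarrow> real" where
  "balance e D = double_writhe D + 2 * e * Re (total_winding D)"

lemma balance_forward_move:
  assumes "forward_move y D D'" and "x = Omega1a \<and> e = - 1 \<or> x = Omega1b \<and> e = 1"
  shows "balance e D' = balance e D + (if y = x then 4 else 0)"
  using assms Omega1_invariants[of "-1" D D'] Omega1_invariants[of 1 D D']
    Omega2a_invariants[of D D'] Omega3a_invariants[of D D']
  by (cases y) (auto simp: balance_def)

lemma balance_performs:
  assumes "performs m D D'" and "x = Omega1a \<and> e = - 1 \<or> x = Omega1b \<and> e = 1"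
  shows "balance e D' = balance e D + (if m = Forward x then 4 else if m = Backward x then - 4 else 0)"
  using assms balance_forward_move[of _ D D' x e] balance_forward_move[of _ D' D x e]
  by (cases m) auto

lemma balance_monotone:
  assumes "(\<lambda>D D'. planar_isotopic D D' \<or> (\<exists>m\<in>A. performs m D D'))\<^sup>*\<^sup>* D D'"
    and x: "x = Omega1a \<and> e = - 1 \<or> x = Omega1b \<and> e = 1"
  shows "Forward x \<notin> A \<Longrightarrow> balance e D' \<le> balance e D"
    and "Backward x \<notin> A \<Longrightarrow> balance e D' \<ge> balance e D"
proof -
  have "(Forward x \<notin> A \<longrightarrow> balance e D' \<le> balance e D) \<and> (Backward x \<notin> A \<longrightarrow> balance e D' \<ge> balance e D)"
    using assms(1)
  proof (induction rule: rtranclp_induct)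
    case (step D1 D2)
    have "(Forward x \<notin> A \<longrightarrow> balance e D2 \<le> balance e D1) \<and> (Backward x \<notin> A \<longrightarrow> balance e D2 \<ge> balance e D1)"
      using step.hyps(2)
    proof
      assume "planar_isotopic D1 D2"
      then show ?thesis
        by (simp add: balance_def planar_isotopic_invariants)
    next
      assume "\<exists>m\<in>A. performs m D1 D2"
      then obtain m where "m \<in> A" "performs m D1 D2" by blast
      with balance_performs[OF this(2) x] show ?thesis
        by (cases "m = Forward x"; cases "m = Backward x") auto
    qed
    with step.IH show ?case by auto
  qed simp
  then show "Forward x \<notin> A \<Longrightarrow> balance e D' \<le> balance e D"
    and "Backward x \<notin> A \<Longrightarrow> balance e D' \<ge> balance e D" by blast+
qed


section \<open>Ambient isotopies\<close>

definition map_curves :: "('a \<Rightarrow> 'b) \<Rightarrow> 'a curves \<Rightarrow> 'b curves" where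
  "map_curves f K = \<lparr>components = components K, curve = (\<lambda>i s. f (curve K i s))\<rparr>"

lemma map_curves_simps [simp]:
  "components (map_curves f K) = components K" "curve (map_curves f K) i s = f (curve K i s)"
  by (simp_all add: map_curves_def)

definition ambient_isotopy ::
    "(real \<Rightarrow> 'a::euclidean_space \<Rightarrow> 'a) \<Rightarrow> (real \<Rightarrow> 'a \<Rightarrow> 'a \<Rightarrow> 'a) \<Rightarrow> bool" where
  "ambient_isotopy \<Phi> \<Phi>' \<longleftrightarrow>
     \<Phi> 0 = id \<and>
     (\<forall>\<tau>\<in>{0..1}. inj (\<Phi> \<tau>) \<and> (\<forall>x. (\<Phi> \<tau> has_derivative \<Phi>' \<tau> x) (at x) \<and> inj (\<Phi>' \<tau> x))) \<and>
     continuous_on ({0..1} \<times> UNIV) (\<lambda>(\<tau>, x). \<Phi> \<tau> x) \<and>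
     (\<forall>v. continuous_on ({0..1} \<times> UNIV) (\<lambda>(\<tau>, x). \<Phi>' \<tau> x v))"

text \<open>
  A differentiable left inverse yields injectivity of a map and, by the chain rule, of its derivatives.
\<close>

lemma ambient_isotopyI:
  assumes "\<And>x. \<Phi> 0 x = x"
    and \<Psi>: "\<And>\<tau> x. \<tau> \<in> {0..1} \<Longrightarrow> \<Psi> \<tau> (\<Phi> \<tau> x) = x"
      "\<And>\<tau> x. \<tau> \<in> {0..1} \<Longrightarrow> \<Psi> \<tau> differentiable (at x)"
    and \<Phi>': "\<And>\<tau> x. \<tau> \<in> {0..1} \<Longrightarrow> (\<Phi> \<tau> has_derivative \<Phi>' \<tau> x) (at x)"
    and "continuous_on ({0..1} \<times> UNIV) (\<lambda>(\<tau>, x). \<Phi> \<tau> x)"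
      "\<And>v. continuous_on ({0..1} \<times> UNIV) (\<lambda>(\<tau>, x). \<Phi>' \<tau> x v)"
  shows "ambient_isotopy \<Phi> \<Phi>'"
proof -
  have "inj (\<Phi>' \<tau> x)" if t: "\<tau> \<in> {0..1}" for \<tau> x
  proof -
    obtain \<Psi>' where "(\<Psi> \<tau> has_derivative \<Psi>') (at (\<Phi> \<tau> x))"
      using \<Psi>(2)[OF t] by (auto simp: differentiable_def)
    from has_derivative_compose[OF \<Phi>'[OF t] this]
    have "((\<lambda>x. x) has_derivative (\<lambda>v. \<Psi>' (\<Phi>' \<tau> x v))) (at x)"
      using \<Psi>(1)[OF t] by simp
    then have "(\<lambda>v. \<Psi>' (\<Phi>' \<tau> x v)) = (\<lambda>v. v)"
      using has_derivative_ident has_derivative_unique by blast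
    then show ?thesis by (metis injI)
  qed
  moreover have "inj (\<Phi> \<tau>)" if "\<tau> \<in> {0..1}" for \<tau>
    using \<Psi>(1)[OF that] by (metis injI)
  moreover have "\<Phi> 0 = id"
    using assms(1) by auto
  ultimately show ?thesis
    using assms unfolding ambient_isotopy_def by blast
qed

lemma continuous_on_ambient:
  assumes "ambient_isotopy \<Phi> \<Phi>'" and f: "continuous_on B f" "continuous_on B u" "continuous_on B v"
    and "\<And>x. x \<in> B \<Longrightarrow> f x \<in> {0..1}"
  shows "continuous_on B (\<lambda>x. \<Phi> (f x) (u x))" "continuous_on B (\<lambda>x. \<Phi>' (f x) (u x) (v x))"
proof -
  have c: "continuous_on ({0..1} \<times> UNIV) (\<lambda>(\<tau>, x). \<Phi> \<tau> x)"
      "\<And>v. continuous_on ({0..1} \<times> UNIV) (\<lambda>(\<tau>, x). \<Phi>' \<tau> x v)"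
    and lin: "\<And>\<tau> x. \<tau> \<in> {0..1} \<Longrightarrow> linear (\<Phi>' \<tau> x)"
    using assms(1) has_derivative_linear unfolding ambient_isotopy_def by blast+
  have fu: "continuous_on B (\<lambda>x. (f x, u x))" "(\<lambda>x. (f x, u x)) ` B \<subseteq> {0..1} \<times> UNIV"
    using assms by (auto intro!: continuous_intros)
  from continuous_on_compose2[OF c(1) fu] show "continuous_on B (\<lambda>x. \<Phi> (f x) (u x))"
    by simp
  have "continuous_on B (\<lambda>x. (case (f x, u x) of (\<tau>, x) \<Rightarrow> \<Phi>' \<tau> x) (v x))"
  proof (rule continuous_on_linear_family[OF _ _ fu f(3)])
    show "linear (case p of (\<tau>, x) \<Rightarrow> \<Phi>' \<tau> x)" if "p \<in> {0..1} \<times> UNIV" for p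
      using lin that by (cases p) auto
    show "continuous_on ({0..1} \<times> UNIV) (\<lambda>p. (case p of (\<tau>, x) \<Rightarrow> \<Phi>' \<tau> x) v)" for v
      using c(2)[of v] by (simp add: case_prod_unfold)
  qed
  then show "continuous_on B (\<lambda>x. \<Phi>' (f x) (u x) (v x))"
    by simp
qed

lemma ambient_velocity:
  assumes "ambient_isotopy \<Phi> \<Phi>'" "\<tau> \<in> {0..1}" "regular_closed_curves K" "i < components K"
  shows "(curve (map_curves (\<Phi> \<tau>) K) i has_vector_derivative \<Phi>' \<tau> (curve K i s) (velocity K i s)) (at s)"
    "velocity (map_curves (\<Phi> \<tau>) K) i s = \<Phi>' \<tau> (curve K i s) (velocity K i s)"
proof -
  have "(\<Phi> \<tau> has_derivative \<Phi>' \<tau> (curve K i s)) (at (curve K i s))"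
    using assms unfolding ambient_isotopy_def by blast
  from has_vector_derivative_comp_has_derivative[OF curve_has_vector_derivative[OF assms(3,4)] this]
  show *: "(curve (map_curves (\<Phi> \<tau>) K) i has_vector_derivative \<Phi>' \<tau> (curve K i s) (velocity K i s)) (at s)"
    by (simp add: map_curves_def)
  then show "velocity (map_curves (\<Phi> \<tau>) K) i s = \<Phi>' \<tau> (curve K i s) (velocity K i s)"
    by (rule vector_derivative_at)
qed

lemma ambient_is_link:
  assumes \<Phi>: "ambient_isotopy \<Phi> \<Phi>'" "\<tau> \<in> {0..1}" and K: "is_link K"
  shows "is_link (map_curves (\<Phi> \<tau>) K)"
proof -
  have reg: "regular_closed_curves K"
    using K by (simp add: is_link_def)
  have inj: "inj (\<Phi> \<tau>)" and inj': "\<And>x. linear (\<Phi>' \<tau> x) \<and> inj (\<Phi>' \<tau> x)"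
    using \<Phi> has_derivative_linear unfolding ambient_isotopy_def by blast+
  have "curve (map_curves (\<Phi> \<tau>) K) i C1_differentiable_on UNIV" if i: "i < components K" for i
    unfolding C1_differentiable_on_def
  proof (intro exI conjI ballI)
    show "(curve (map_curves (\<Phi> \<tau>) K) i has_vector_derivative \<Phi>' \<tau> (curve K i s) (velocity K i s)) (at s)" for s
      using ambient_velocity[OF \<Phi> reg i] by blast
    show "continuous_on UNIV (\<lambda>s. \<Phi>' \<tau> (curve K i s) (velocity K i s))"
      by (rule continuous_on_ambient(2)[OF \<Phi>(1)])
         (use \<Phi>(2) continuous_on_curve[OF reg i] continuous_on_velocity[OF reg i] in auto)
  qed
  moreover have "velocity (map_curves (\<Phi> \<tau>) K) i s \<noteq> 0" if i: "i < components K" for i s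
    using ambient_velocity(2)[OF \<Phi> reg i, of s] velocity_nonzero[OF reg i, of s]
      inj'[of "curve K i s"] linear_injective_0 by metis
  ultimately have "regular_closed_curves (map_curves (\<Phi> \<tau>) K)"
    using reg unfolding regular_closed_curves_def by simp
  moreover have "\<not> double_point (map_curves (\<Phi> \<tau>) K) i s j t" for i s j t
    using K inj by (auto simp: is_link_def double_point_def inj_eq)
  ultimately show ?thesis
    by (simp add: is_link_def)
qed

text \<open>
  Applying the ambient isotopy simultaneously with a given isotopy from \<open>L\<close> to \<open>K\<close> avoids
  concatenating the two.
\<close>

lemma link_isotopic_ambient:
  assumes \<Phi>: "ambient_isotopy \<Phi> \<Phi>'" and "link_isotopic L K"
  shows "link_isotopic L (map_curves (\<Phi> 1) K)"
proof -
  obtain H :: "real \<Rightarrow> link" and \<pi> where c: "components K = components L"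
    and H: "\<forall>\<tau>\<in>{0..1}. is_link (H \<tau>) \<and> components (H \<tau>) = components L"
      "\<forall>i<components L. continuous_on ({0..1} \<times> UNIV) (\<lambda>(\<tau>, s). curve (H \<tau>) i s) \<and>
         continuous_on ({0..1} \<times> UNIV) (\<lambda>(\<tau>, s). velocity (H \<tau>) i s)"
    and \<pi>: "bij_betw \<pi> {..<components L} {..<components L}"
      "\<forall>i<components L. curve (H 0) i = curve L i \<and> curve (H 1) i = curve K (\<pi> i)"
    using assms(2) unfolding link_isotopic_def by (elim conjE exE) (rule that; assumption)
  define G where "G \<tau> = map_curves (\<Phi> \<tau>) (H \<tau>)" for \<tau>
  have vel: "velocity (G \<tau>) i s = \<Phi>' \<tau> (curve (H \<tau>) i s) (velocity (H \<tau>) i s)"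
    if "\<tau> \<in> {0..1}" "i < components L" for \<tau> i s
    unfolding G_def by (rule ambient_velocity(2)[OF \<Phi>]) (use H that in \<open>auto simp: is_link_def\<close>)
  show ?thesis
    unfolding link_isotopic_def
  proof (intro conjI exI[of _ G] exI[of _ \<pi>] ballI allI impI)
    fix \<tau> :: real assume t: "\<tau> \<in> {0..1}"
    show "is_link (G \<tau>)"
      unfolding G_def by (rule ambient_is_link[OF \<Phi> t]) (use H t in blast)
    show "components (G \<tau>) = components L"
      using H t by (simp add: G_def)
  next
    fix i assume i: "i < components L"
    have Hc: "continuous_on ({0..1} \<times> UNIV) (\<lambda>x. curve (H (fst x)) i (snd x))"
         "continuous_on ({0..1} \<times> UNIV) (\<lambda>x. velocity (H (fst x)) i (snd x))"
      using H(2) i by (simp_all add: case_prod_unfold)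
    show "continuous_on ({0..1} \<times> UNIV) (\<lambda>(\<tau>, s). curve (G \<tau>) i s)"
      using continuous_on_ambient(1)[OF \<Phi> continuous_on_fst[OF continuous_on_id] Hc]
      by (auto simp: G_def case_prod_unfold)
    have "continuous_on ({0..1} \<times> UNIV) (\<lambda>x. \<Phi>' (fst x) (curve (H (fst x)) i (snd x)) (velocity (H (fst x)) i (snd x)))"
      using continuous_on_ambient(2)[OF \<Phi> continuous_on_fst[OF continuous_on_id] Hc] by auto
    then show "continuous_on ({0..1} \<times> UNIV) (\<lambda>(\<tau>, s). velocity (G \<tau>) i s)"
      by (rule continuous_on_eq) (auto simp: vel i)
    have "\<Phi> 0 = id"
      using \<Phi> by (simp add: ambient_isotopy_def)
    then show "curve (G 0) i = curve L i"
      using \<pi>(2) i by (auto simp: G_def map_curves_def)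
    show "curve (G 1) i = curve (map_curves (\<Phi> 1) K) (\<pi> i)"
      using \<pi>(2) i by (auto simp: G_def map_curves_def)
  qed (use c \<pi> in auto)
qed

text \<open>
  The null sets below are images under maps involving the velocity, so the velocity itself has to be
  differentiable.
\<close>

definition smooth_link :: "link \<Rightarrow> bool" where
  "smooth_link K \<longleftrightarrow> is_link K \<and> (\<forall>i<components K. \<forall>s. velocity K i differentiable (at s))"

lemma smooth_link_regular: "smooth_link K \<Longrightarrow> regular_closed_curves K"
  by (simp add: smooth_link_def is_link_def)

lemma smooth_link_ambient:
  assumes \<Phi>: "ambient_isotopy \<Phi> \<Phi>'" and d: "\<And>z. (\<lambda>(x, v). \<Phi>' 1 x v) differentiable (at z)"
    and K: "smooth_link K"
  shows "smooth_link (map_curves (\<Phi> 1) K)"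
  unfolding smooth_link_def
proof (intro conjI allI impI)
  show "is_link (map_curves (\<Phi> 1) K)"
    using K by (intro ambient_is_link[OF \<Phi>]) (auto simp: smooth_link_def)
  fix i s assume "i < components (map_curves (\<Phi> 1) K)"
  then have i: "i < components K" by simp
  have reg: "regular_closed_curves K" using K by (rule smooth_link_regular)
  have "velocity K i differentiable (at s)"
    using K i by (simp add: smooth_link_def)
  then obtain v' where v': "(velocity K i has_derivative v') (at s)"
    unfolding differentiable_def by blast
  obtain c' where "(curve K i has_derivative c') (at s)"
    using curve_has_vector_derivative[OF reg i, of s] unfolding has_vector_derivative_def by blast
  from this v' have "((\<lambda>s. (curve K i s, velocity K i s)) has_derivative (\<lambda>h. (c' h, v' h))) (at s)"
    by (rule has_derivative_Pair)
  moreover obtain P where "((\<lambda>(x, v). \<Phi>' 1 x v) has_derivative P) (at (curve K i s, velocity K i s))"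
    using d unfolding differentiable_def by blast
  ultimately have "((\<lambda>s. (\<lambda>(x, v). \<Phi>' 1 x v) (curve K i s, velocity K i s)) has_derivative (\<lambda>h. P (c' h, v' h))) (at s)"
    by (rule has_derivative_compose)
  moreover have "velocity (map_curves (\<Phi> 1) K) i = (\<lambda>s. \<Phi>' 1 (curve K i s) (velocity K i s))"
    using ambient_velocity(2)[OF \<Phi> _ reg i, of 1] by auto
  ultimately show "velocity (map_curves (\<Phi> 1) K) i differentiable at s"
    by (auto simp: differentiable_def)
qed

lemma differentiable_compose_at:
  assumes "f differentiable (at (g x))" "g differentiable (at x)"
  shows "(\<lambda>x. f (g x)) differentiable (at x)"
  using differentiable_compose[OF assms] .

lemma differentiable_of_real:
  "f differentiable (at x) \<Longrightarrow> (\<lambda>x. of_real (f x) :: complex) differentiable (at x)"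
  unfolding differentiable_def using has_derivative_of_real by blast

lemma differentiable_fst_snd:
  "(\<lambda>x. fst x) differentiable (at x)" "(\<lambda>x. snd x) differentiable (at x)"
  by (auto intro!: bounded_linear_imp_differentiable bounded_linear_fst bounded_linear_snd)

lemma differentiable_bounded_linear:
  assumes "bounded_linear h" "f differentiable (at x)"
  shows "(\<lambda>x. h (f x)) differentiable (at x)"
  using assms(2) bounded_linear.has_derivative[OF assms(1)] unfolding differentiable_def by blast

lemma differentiable_Pair:
  assumes "f differentiable (at x)" "g differentiable (at x)"
  shows "(\<lambda>x. (f x, g x)) differentiable (at x)"
  using assms has_derivative_Pair unfolding differentiable_def by blast

text \<open>
  A displacement that is constant along the lines in its own direction is undone by the opposite
  displacement.
\<close>

lemma shear_ambient:
  assumes g: "\<And>x. (g has_derivative g' x) (at x)" and c: "\<And>v. continuous_on UNIV (\<lambda>x. g' x v)"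
    and inv: "\<And>t x. g (x + t *\<^sub>R g x) = g x"
  shows "ambient_isotopy (\<lambda>\<tau> x. x + \<tau> *\<^sub>R g x) (\<lambda>\<tau> x v. v + \<tau> *\<^sub>R g' x v)"
proof (rule ambient_isotopyI[where \<Psi> = "\<lambda>\<tau> x. x - \<tau> *\<^sub>R g x"])
  have cont: "continuous_on UNIV g"
    by (rule has_derivative_continuous_on[where f' = g']) (simp add: g)
  show "x + \<tau> *\<^sub>R g x - \<tau> *\<^sub>R g (x + \<tau> *\<^sub>R g x) = x" for \<tau> x
    by (simp add: inv)
  show "(\<lambda>x. x - \<tau> *\<^sub>R g x) differentiable at x" for \<tau> x
    unfolding differentiable_def by (rule exI) (rule derivative_eq_intros g refl)+
  show "((\<lambda>x. x + \<tau> *\<^sub>R g x) has_derivative (\<lambda>v. v + \<tau> *\<^sub>R g' x v)) (at x)" for \<tau> x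
    by (rule derivative_eq_intros g refl)+
  show "continuous_on ({0..1} \<times> UNIV) (\<lambda>(\<tau>, x). x + \<tau> *\<^sub>R g x)"
    unfolding case_prod_unfold by (intro continuous_intros continuous_on_compose2[OF cont]) auto
  show "continuous_on ({0..1} \<times> UNIV) (\<lambda>(\<tau>, x). v + \<tau> *\<^sub>R g' x v)" for v
    unfolding case_prod_unfold by (intro continuous_intros continuous_on_compose2[OF c]) auto
qed simp

lemma shear_link:
  fixes g :: "complex \<times> real \<Rightarrow> complex \<times> real" and K
  defines "K' \<equiv> map_curves (\<lambda>x. x + g x) K"
  assumes g: "\<And>x. (g has_derivative g' x) (at x)" "\<And>v. continuous_on UNIV (\<lambda>x. g' x v)"
      "\<And>t x. g (x + t *\<^sub>R g x) = g x"
    and d: "\<And>z. (\<lambda>(x, v). g' x v) differentiable (at z)" and K: "smooth_link K"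
  shows "smooth_link K'" "link_isotopic L K \<Longrightarrow> link_isotopic L K'"
    "i < components K \<Longrightarrow> velocity K' i s = velocity K i s + g' (curve K i s) (velocity K i s)"
proof -
  have \<Phi>: "ambient_isotopy (\<lambda>\<tau> x. x + \<tau> *\<^sub>R g x) (\<lambda>\<tau> x v. v + \<tau> *\<^sub>R g' x v)"
    by (rule shear_ambient) (use g in auto)
  have "(\<lambda>(x, v). v + 1 *\<^sub>R g' x v) differentiable (at z)" for z
    using d[of z] differentiable_fst_snd(2)[of z] by (simp add: case_prod_unfold)
  from smooth_link_ambient[OF \<Phi> this K] show "smooth_link K'"
    by (simp add: K'_def)
  show "link_isotopic L K'" if "link_isotopic L K"
    using link_isotopic_ambient[OF \<Phi> that] by (simp add: K'_def)
  show "velocity K' i s = velocity K i s + g' (curve K i s) (velocity K i s)" if "i < components K"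
    using ambient_velocity(2)[OF \<Phi> _ smooth_link_regular[OF K] that, of 1] by (simp add: K'_def)
qed


section \<open>Smoothing a link\<close>

text \<open>
  The zeros form a compact set, so their times form a closed set, which does not contain \<open>0\<close>.
\<close>

lemma eventually_nonzero_on_compact:
  fixes f :: "real \<times> 'a::topological_space \<Rightarrow> 'b::real_normed_vector"
  assumes "compact C" and f: "continuous_on ({0..1} \<times> C) f" and nz: "\<And>x. x \<in> C \<Longrightarrow> f (0, x) \<noteq> 0"
  shows "\<forall>\<^sub>F \<tau> in at_right 0. \<forall>x\<in>C. f (\<tau>, x) \<noteq> 0"
proof -
  define Z where "Z = {p \<in> {0..1} \<times> C. f p = 0}"
  have "compact ({0..1::real} \<times> C)"
    using assms(1) by (intro compact_Times) auto
  moreover have "closedin (top_of_set ({0..1} \<times> C)) Z"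
    unfolding Z_def by (rule continuous_closedin_preimage_constant[OF f])
  ultimately have "compact Z"
    using closedin_compact by blast
  then have "compact (fst ` Z)"
    by (intro compact_continuous_image continuous_intros)
  then have "open (- (fst ` Z))"
    by (simp add: compact_imp_closed open_Compl)
  moreover have "0 \<in> - (fst ` Z)"
    using nz by (auto simp: Z_def)
  ultimately have "\<forall>\<^sub>F \<tau> in at_right 0. \<tau> \<in> - (fst ` Z)"
    using eventually_nhds eventually_at_filter by (smt (verit) eventually_mono)
  moreover have "\<forall>\<^sub>F \<tau> in at_right (0::real). \<tau> \<in> {0<..<1}"
    by (rule eventually_at_right_real) simp
  ultimately show ?thesis
    by eventually_elim (force simp: Z_def)
qed

lemma antiderivative_exists:
  fixes f :: "real \<Rightarrow> 'a::euclidean_space"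
  assumes "continuous_on UNIV f"
  shows "\<exists>P. \<forall>s. (P has_vector_derivative f s) (at s)"
proof (intro exI allI)
  fix s :: real
  have "((\<lambda>u. LBINT y=ereal 0..ereal u. f y) has_vector_derivative f s) (at s within {- \<bar>s\<bar> - 1..\<bar>s\<bar> + 1})"
    by (rule interval_integral_FTC2) (auto intro: continuous_on_subset[OF assms])
  show "((\<lambda>u. LBINT y=ereal 0..ereal u. f y) has_vector_derivative f s) (at s)"
  proof -
    have "- \<bar>s\<bar> - 1 < s" "s < \<bar>s\<bar> + 1" by linarith+
    then have "at s within {- \<bar>s\<bar> - 1..\<bar>s\<bar> + 1} = at s"
      by (intro at_within_interior) simp
    then show ?thesis
      using \<open>(_ has_vector_derivative f s) (at s within {- \<bar>s\<bar> - 1..\<bar>s\<bar> + 1})\<close> by simp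
  qed
qed

text \<open>
  The curves are replaced by their averages over intervals of length \<open>\<tau>\<close>.  The average is a secant of an
  antiderivative, and its velocity is a secant of the curve, which is differentiable for \<open>\<tau> > 0\<close>; both
  depend continuously on \<open>\<tau>\<close>, also at \<open>\<tau> = 0\<close>, where they are the curve and its velocity.
  For small \<open>\<tau>\<close> the averages still form a link, because this amounts to the nonvanishing of
  finitely many continuous functions on compact sets.
\<close>

lemma smoothing:
  assumes L: "is_link L"
  shows "\<exists>K. link_isotopic L K \<and> smooth_link K"
proof -
  have reg: "regular_closed_curves L"
    using L by (simp add: is_link_def)
  define n where "n = components L"
  define k where "k = curve L"
  have k: "\<And>i s. i < n \<Longrightarrow> (k i has_vector_derivative velocity L i s) (at s)"
      "\<And>i. i < n \<Longrightarrow> continuous_on UNIV (k i)" "\<And>i. i < n \<Longrightarrow> k i C1_differentiable_on UNIV"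
      "\<And>i s. i < n \<Longrightarrow> k i (s + 1) = k i s"
    using reg curve_has_vector_derivative[OF reg] continuous_on_curve[OF reg]
    by (auto simp: n_def k_def regular_closed_curves_def)
  have "\<forall>i. \<exists>P. i < n \<longrightarrow> (\<forall>s. (P has_vector_derivative k i s) (at s))"
    using antiderivative_exists k(2) by blast
  then obtain P where P: "\<And>i s. i < n \<Longrightarrow> (P i has_vector_derivative k i s) (at s)"
    by metis
  have PC1: "P i C1_differentiable_on UNIV" if "i < n" for i
    using P[OF that] k(2)[OF that] by (auto simp: C1_differentiable_on_def)
  have Pper: "P i (s + 1) - P i s = P i 1 - P i 0" if i: "i < n" for i s
  proof -
    have shift: "((\<lambda>s. P i (s + 1)) has_vector_derivative k i (s + 1)) (at s)" for s
      by (rule has_vector_derivative_shift[OF P[OF i]])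
    have "((\<lambda>s. P i (s + 1) - P i s) has_vector_derivative k i (s + 1) - k i s) (at s)" for s
      by (intro has_vector_derivative_diff shift P i)
    then have "((\<lambda>s. P i (s + 1) - P i s) has_vector_derivative 0) (at s)" for s
      using k(4)[OF i] by simp
    then have "((\<lambda>s. P i (s + 1) - P i s) has_derivative (\<lambda>h. 0)) (at s)" for s
      by (simp add: has_vector_derivative_def)
    then obtain c where "\<And>s. P i (s + 1) - P i s = c"
      using has_derivative_zero_constant[of UNIV "\<lambda>s. P i (s + 1) - P i s"] by auto
    from this[of s] this[of 0] show ?thesis by simp
  qed
  define h where "h \<tau> i s = secant (P i) (s, s + \<tau>)" for \<tau> i s
  define V where "V \<tau> i s = secant (k i) (s, s + \<tau>)" for \<tau> i s
  have h0: "h 0 i s = k i s" if "i < n" for i s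
    using P[OF that] by (simp add: h_def vector_derivative_at)
  have h_der: "(h \<tau> i has_vector_derivative V \<tau> i s) (at s)" if i: "i < n" for \<tau> i s
  proof (cases "\<tau> = 0")
    case True
    have "h 0 i = k i" using h0[OF i] by auto
    then show ?thesis
      using k(1)[OF i, of s] by (simp add: True V_def vector_derivative_at[OF k(1)[OF i]])
  next
    case False
    have shift: "((\<lambda>s. P i (s + \<tau>)) has_vector_derivative k i (s + \<tau>)) (at s)" for s
      by (rule has_vector_derivative_shift[OF P[OF i]])
    have "((\<lambda>s. P i (s + \<tau>) - P i s) has_vector_derivative k i (s + \<tau>) - k i s) (at s)"
      by (intro has_vector_derivative_diff shift P i)
    then have "((\<lambda>s. (P i (s + \<tau>) - P i s) /\<^sub>R \<tau>) has_vector_derivative (k i (s + \<tau>) - k i s) /\<^sub>R \<tau>) (at s)"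
      by (intro bounded_linear.has_vector_derivative[OF bounded_linear_scaleR_right])
    then show ?thesis
      using False by (simp add: h_def[abs_def] V_def secant_off_diagonal)
  qed
  have h_per: "h \<tau> i (s + 1) = h \<tau> i s" if i: "i < n" for \<tau> i s
  proof (cases "\<tau> = 0")
    case True
    then show ?thesis using h0[OF i] k(4)[OF i] by simp
  next
    case False
    have "P i (s + 1 + \<tau>) - P i (s + 1) = P i (s + \<tau>) - P i s"
    proof -
      have "P i (s + \<tau> + 1) - P i (s + \<tau>) = P i (s + 1) - P i s"
        using Pper[OF i, of "s + \<tau>"] Pper[OF i, of s] by simp
      then have 1: "P i (s + \<tau> + 1) = P i (s + 1) - P i s + P i (s + \<tau>)"
        by (metis diff_add_cancel)
      have 2: "s + 1 + \<tau> = s + \<tau> + 1" by simp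
      show ?thesis unfolding 2 1 by simp
    qed
    then show ?thesis using False by (simp add: h_def secant_off_diagonal)
  qed
  have h_cont: "continuous_on B (\<lambda>x. h (f x) i (g x))"
    if "i < n" "continuous_on B f" "continuous_on B g" for B i and f g :: "'b::topological_space \<Rightarrow> real"
    unfolding h_def by (rule continuous_on_compose2[OF continuous_on_secant[OF PC1[OF that(1)]]]) (auto intro!: continuous_intros that)
  have V_cont: "continuous_on B (\<lambda>x. V (f x) i (g x))"
    if "i < n" "continuous_on B f" "continuous_on B g" for B i and f g :: "'b::topological_space \<Rightarrow> real"
    unfolding V_def by (rule continuous_on_compose2[OF continuous_on_secant[OF k(3)[OF that(1)]]]) (auto intro!: continuous_intros that)
  define H where "H \<tau> = \<lparr>components = n, curve = h \<tau>\<rparr>" for \<tau>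
  have vel: "velocity (H \<tau>) i s = V \<tau> i s" if "i < n" for \<tau> i s
    using h_der[OF that] by (simp add: H_def vector_derivative_at)
  have dpL: "\<not> double_point L i s j t" for i s j t
    using L by (simp add: is_link_def)
  \<comment> \<open>On one component it suffices to compare parameters at distance at most a half.\<close>
  define C where "C = (\<lambda>(s, d). (s, s + d)) ` ({0..1} \<times> {- (1/2)..1/2::real})"
  have "compact C"
    unfolding C_def case_prod_unfold
    by (intro compact_continuous_image continuous_intros compact_Times compact_Icc)
  have sec0: "secant (h 0 i) (s, t) \<noteq> 0" if i: "i < n" and st: "(s, t) \<in> C" for i s t
  proof (cases "s = t")
    case True
    then show ?thesis
      using vel[OF i, of 0] velocity_nonzero[OF reg, of i s] i by (simp add: H_def V_def k_def n_def)
  next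
    case False
    have "\<bar>s - t\<bar> \<le> 1/2"
      using st by (auto simp: C_def abs_le_iff)
    then have "s - t \<notin> \<int>"
      using False Ints_small_eq_0[of "s - t"] by auto
    then have "k i s \<noteq> k i t"
      using dpL[of i s i t] i by (simp add: double_point_def same_parameter_def k_def n_def)
    then show ?thesis
      using secant_eq_0_iff[OF False, of "h 0 i"] h0[OF i] by simp
  qed
  have "\<forall>\<^sub>F \<tau> in at_right 0. \<forall>p\<in>C. secant (h \<tau> i) p \<noteq> 0" if i: "i < n" for i
  proof -
    have "continuous_on ({0..1} \<times> UNIV) (\<lambda>(\<tau>, p). secant (h \<tau> i) p)"
    proof (rule continuous_on_secant_family)
      show "(h \<tau> i has_vector_derivative V \<tau> i s) (at s)" for \<tau> s by (rule h_der[OF i])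
      show "continuous_on ({0..1} \<times> UNIV) (\<lambda>(\<tau>, s). V \<tau> i s)"
        unfolding case_prod_unfold by (intro V_cont i continuous_intros)
    qed
    then have "continuous_on ({0..1} \<times> C) (\<lambda>(\<tau>, p). secant (h \<tau> i) p)"
      by (rule continuous_on_subset) auto
    from eventually_nonzero_on_compact[OF \<open>compact C\<close> this] show ?thesis
      using sec0[OF i] by (auto simp: case_prod_unfold)
  qed
  then have ev1: "\<forall>\<^sub>F \<tau> in at_right 0. \<forall>i\<in>{..<n}. \<forall>p\<in>C. secant (h \<tau> i) p \<noteq> 0"
    by (intro eventually_ball_finite) auto
  have disj: "\<forall>\<^sub>F \<tau> in at_right 0. \<forall>p\<in>{0..1}\<times>{0..1}. h \<tau> i (fst p) - h \<tau> j (snd p) \<noteq> 0" if ij: "i < n" "j < n" "i \<noteq> j" for i j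
  proof -
    have "continuous_on ({0..1} \<times> ({0..1} \<times> {0..1})) (\<lambda>x. h (fst x) i (fst (snd x)) - h (fst x) j (snd (snd x)))"
      by (intro continuous_intros h_cont ij)
    moreover have "h 0 i s - h 0 j t \<noteq> 0" for s t
      using dpL[of i s j t] ij h0 by (simp add: double_point_def same_parameter_def k_def n_def)
    ultimately show ?thesis
      using eventually_nonzero_on_compact[of "{0..1} \<times> {0..1}" "\<lambda>x. h (fst x) i (fst (snd x)) - h (fst x) j (snd (snd x))"]
      by (simp add: compact_Times)
  qed
  have ev2: "\<forall>\<^sub>F \<tau> in at_right 0. \<forall>x\<in>{(i, j). i < n \<and> j < n \<and> i \<noteq> j}. \<forall>p\<in>{0..1}\<times>{0..1}. h \<tau> (fst x) (fst p) - h \<tau> (snd x) (snd p) \<noteq> 0"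
  proof (rule eventually_ball_finite)
    show "finite {(i, j). i < n \<and> j < n \<and> i \<noteq> j}"
      by (rule finite_subset[of _ "{..<n} \<times> {..<n}"]) auto
    show "\<forall>x\<in>{(i, j). i < n \<and> j < n \<and> i \<noteq> j}. \<forall>\<^sub>F \<tau> in at_right 0.
        \<forall>p\<in>{0..1}\<times>{0..1}. h \<tau> (fst x) (fst p) - h \<tau> (snd x) (snd p) \<noteq> 0"
      using disj by force
  qed
  have link: "is_link (H \<tau>)"
    if 1: "\<forall>i\<in>{..<n}. \<forall>p\<in>C. secant (h \<tau> i) p \<noteq> 0"
      and 2: "\<forall>x\<in>{(i, j). i < n \<and> j < n \<and> i \<noteq> j}. \<forall>p\<in>{0..1}\<times>{0..1}. h \<tau> (fst x) (fst p) - h \<tau> (snd x) (snd p) \<noteq> 0" for \<tau>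
  proof -
    have frac01: "frac s \<in> {0..1}" for s :: real
      using frac_lt_1[of s] by auto
    have hfr: "h \<tau> i (frac s) = h \<tau> i s" if "i < n" for i s
      by (rule periodic_Ints[of "h \<tau> i"]) (use h_per[OF that] in auto)
    have Vnz: "V \<tau> i s \<noteq> 0" if i: "i < n" for i s
    proof -
      have "(frac s, frac s) \<in> C"
        unfolding C_def using frac01[of s] by (intro image_eqI[of _ _ "(frac s, 0)"]) auto
      then have "secant (h \<tau> i) (frac s, frac s) \<noteq> 0"
        using 1 i by blast
      then have "V \<tau> i (frac s) \<noteq> 0"
        using vel[OF i, of \<tau>] by (simp add: H_def)
      moreover have "V \<tau> i (frac s) = V \<tau> i s"
      proof (rule periodic_Ints[of "V \<tau> i"])
        show "V \<tau> i (s + 1) = V \<tau> i s" for s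
          using vector_derivative_periodic[of "h \<tau> i", OF h_per[OF i] h_der[OF i]] h_der[OF i]
            vector_derivative_unique_at by metis
      qed simp
      ultimately show ?thesis by simp
    qed
    have "regular_closed_curves (H \<tau>)"
      unfolding regular_closed_curves_def
    proof (intro conjI allI impI)
      show "components (H \<tau>) \<ge> 1"
        using reg by (simp add: H_def n_def regular_closed_curves_def)
      fix i s assume "i < components (H \<tau>)"
      then have i: "i < n" by (simp add: H_def)
      have "continuous_on UNIV (V \<tau> i)"
        using V_cont[OF i continuous_on_const continuous_on_id, of UNIV \<tau>] by simp
      then show "curve (H \<tau>) i C1_differentiable_on UNIV"
        using h_der[OF i] by (auto simp: C1_differentiable_on_def H_def)
      show "curve (H \<tau>) i (s + 1) = curve (H \<tau>) i s"
        using h_per[OF i] by (simp add: H_def)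
      show "velocity (H \<tau>) i s \<noteq> 0"
        using vel[OF i] Vnz[OF i] by simp
    qed
    moreover have "\<not> double_point (H \<tau>) i s j t" for i s j t
    proof
      assume d: "double_point (H \<tau>) i s j t"
      then have ij: "i < n" "j < n" and eq: "h \<tau> i s = h \<tau> j t" and ns: "\<not> same_parameter i s j t"
        by (auto simp: double_point_def H_def)
      show False
      proof (cases "i = j")
        case False
        with ij have "(i, j) \<in> {(i, j). i < n \<and> j < n \<and> i \<noteq> j}" by simp
        moreover have "(frac s, frac t) \<in> {0..1} \<times> {0..1}" using frac01 by simp
        ultimately have "h \<tau> (fst (i, j)) (fst (frac s, frac t)) - h \<tau> (snd (i, j)) (snd (frac s, frac t)) \<noteq> 0"
          using 2 by blast
        with eq ij show False by (simp add: hfr)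
      next
        case True
        \<comment> \<open>The representative of \<open>t\<close> closest to \<open>frac s\<close>.\<close>
        define d where "d = t - frac s - of_int (round (t - frac s))"
        have d: "\<bar>d\<bar> \<le> 1/2"
          using of_int_round_abs_le[of "t - frac s"] by (simp add: d_def abs_minus_commute)
        have "h \<tau> i (frac s + d) = h \<tau> i t"
          by (rule periodic_Ints[of "h \<tau> i"]) (use h_per[OF ij(1)] in \<open>auto simp: d_def\<close>)
        then have eq': "h \<tau> i (frac s) = h \<tau> i (frac s + d)"
          using eq True ij by (simp add: hfr)
        have "d \<noteq> 0"
        proof
          assume "d = 0"
          then have "t - frac s \<in> \<int>"
            by (metis Ints_of_int d_def eq_iff_diff_eq_0)
          then have "(frac s - s) - (frac s - t) \<in> \<int>"
            by (metis Ints_diff Ints_minus frac_diff_Ints(1) minus_diff_eq)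
          then have "t - s \<in> \<int>" by simp
          then show False
            using ns True by (metis Ints_minus minus_diff_eq same_parameter_def)
        qed
        then have "secant (h \<tau> i) (frac s, frac s + d) = 0"
          using secant_eq_0_iff[of "frac s" "frac s + d" "h \<tau> i"] eq' by simp
        moreover have "(frac s, frac s + d) \<in> C"
          unfolding C_def using d frac01[of s] by (intro image_eqI[of _ _ "(frac s, d)"]) (auto simp: abs_le_iff)
        ultimately show False
          using 1 ij by blast
      qed
    qed
    ultimately show ?thesis by (simp add: is_link_def)
  qed
  have "\<forall>\<^sub>F \<tau> in at_right 0. is_link (H \<tau>)"
    using ev1 ev2 by eventually_elim (rule link)
  then obtain b where b: "b > 0" "\<And>\<tau>. 0 < \<tau> \<Longrightarrow> \<tau> < b \<Longrightarrow> is_link (H \<tau>)"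
    by (auto simp: eventually_at_right_field)
  have "is_link (H 0)"
  proof (rule link)
    show "\<forall>i\<in>{..<n}. \<forall>p\<in>C. secant (h 0 i) p \<noteq> 0"
      using sec0 by force
    show "\<forall>x\<in>{(i, j). i < n \<and> j < n \<and> i \<noteq> j}. \<forall>p\<in>{0..1} \<times> {0..1}. h 0 (fst x) (fst p) - h 0 (snd x) (snd p) \<noteq> 0"
    proof (clarify)
      fix i j s t assume ij: "i < n" "j < n" "i \<noteq> j" and eq: "h 0 (fst (i, j)) (fst (s, t)) - h 0 (snd (i, j)) (snd (s, t)) = 0"
      then show False
        using dpL[of i s j t] h0 by (simp add: double_point_def same_parameter_def k_def n_def)
    qed
  qed
  with b have Hlink: "is_link (H (\<tau> * (b / 2)))" if "\<tau> \<in> {0..1}" for \<tau>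
  proof (cases "\<tau> = 0")
    case False
    have "\<tau> * (b / 2) \<le> 1 * (b / 2)"
      using that b by (intro mult_right_mono) auto
    then show ?thesis using b that False by auto
  qed simp
  have "link_isotopic L (H (b / 2))"
    unfolding link_isotopic_def
  proof (intro conjI exI[of _ "\<lambda>\<tau>. H (\<tau> * (b / 2))"] exI[of _ "\<lambda>i. i"] ballI allI impI)
    fix i assume "i < components L"
    then have i: "i < n" by (simp add: n_def)
    have "continuous_on ({0..1} \<times> UNIV) (\<lambda>x. h (fst x * (b / 2)) i (snd x))"
      by (intro h_cont i continuous_intros)
    then show "continuous_on ({0..1} \<times> UNIV) (\<lambda>(\<tau>, s). curve (H (\<tau> * (b / 2))) i s)"
      by (simp add: H_def case_prod_unfold)
    have "continuous_on ({0..1} \<times> UNIV) (\<lambda>x. V (fst x * (b / 2)) i (snd x))"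
      by (intro V_cont i continuous_intros)
    then show "continuous_on ({0..1} \<times> UNIV) (\<lambda>(\<tau>, s). velocity (H (\<tau> * (b / 2))) i s)"
      by (simp add: vel[OF i] case_prod_unfold)
    show "curve (H (0 * (b / 2))) i = curve L i"
      using h0[OF i] by (auto simp: H_def k_def)
  qed (use Hlink in \<open>auto simp: H_def n_def bij_betw_def\<close>)
  moreover have "smooth_link (H (b / 2))"
    unfolding smooth_link_def
  proof (intro conjI allI impI)
    show "is_link (H (b / 2))"
      using Hlink[of 1] by simp
    fix i s assume "i < components (H (b / 2))"
    then have i: "i < n" by (simp add: H_def)
    have "velocity (H (b / 2)) i = (\<lambda>s. (k i (s + b / 2) - k i s) /\<^sub>R (b / 2))"
      using vel[OF i] b(1) by (intro ext) (simp add: V_def secant_off_diagonal)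
    moreover have "((\<lambda>s. (k i (s + b / 2) - k i s) /\<^sub>R (b / 2)) has_vector_derivative
        (velocity L i (s + b / 2) - velocity L i s) /\<^sub>R (b / 2)) (at s)"
      by (intro bounded_linear.has_vector_derivative[OF bounded_linear_scaleR_right] has_vector_derivative_diff
          has_vector_derivative_shift k(1) i)
    then have "(\<lambda>s. (k i (s + b / 2) - k i s) /\<^sub>R (b / 2)) differentiable (at s)"
      unfolding has_vector_derivative_def differentiable_def by blast
    ultimately show "velocity (H (b / 2)) i differentiable (at s)"
      by simp
  qed
  ultimately show ?thesis by blast
qed


section \<open>Generic projections\<close>

lemma negligible_UNION_finite:
  assumes "finite I" "\<And>i. i \<in> I \<Longrightarrow> negligible (A i)"
  shows "negligible (\<Union>i\<in>I. A i)"
  using assms by (intro negligible_Union) auto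

text \<open>
  A linear map between planes has rank below two exactly if it kills a nonzero vector; coordinates reduce
  the assertion to the one for \<open>real^2\<close>.
\<close>

lemma Sard_plane:
  fixes f :: "real \<times> real \<Rightarrow> complex"
  assumes "\<And>x. x \<in> S \<Longrightarrow> \<exists>f'. (f has_derivative f') (at x) \<and> (\<exists>v. v \<noteq> 0 \<and> f' v = 0)"
  shows "negligible (f ` S)"
proof -
  have "\<forall>x\<in>S. \<exists>f'. (f has_derivative f') (at x) \<and> (\<exists>v. v \<noteq> 0 \<and> f' v = 0)"
    using assms by blast
  then obtain f' where f: "\<And>x. x \<in> S \<Longrightarrow> (f has_derivative f' x) (at x)"
    and crit: "\<And>x. x \<in> S \<Longrightarrow> \<exists>v. v \<noteq> 0 \<and> f' x v = 0"
    unfolding bchoice_iff by blast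
  define \<phi> :: "real^2 \<Rightarrow> real \<times> real" where "\<phi> x = (x $ 1, x $ 2)" for x
  define \<phi>' :: "real \<times> real \<Rightarrow> real^2" where "\<phi>' x = vector [fst x, snd x]" for x
  define \<psi> :: "complex \<Rightarrow> real^2" where "\<psi> z = vector [Re z, Im z]" for z
  define \<psi>' :: "real^2 \<Rightarrow> complex" where "\<psi>' x = Complex (x $ 1) (x $ 2)" for x
  have \<phi>: "linear \<phi>"
    unfolding \<phi>_def by (intro linearI) auto
  have \<psi>: "linear \<psi>"
    unfolding \<psi>_def by (intro linearI) (auto simp: vec_eq_iff forall_2)
  have \<psi>': "linear \<psi>'"
    unfolding \<psi>'_def by (intro linearI) (auto simp: complex_eq_iff)
  have inv: "\<phi> (\<phi>' x) = x" "\<psi>' (\<psi> z) = z" for x z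
    by (auto simp: \<phi>_def \<phi>'_def \<psi>_def \<psi>'_def)
  let ?T = "\<phi> -` S"
  have "negligible ((\<lambda>x. \<psi> (f (\<phi> x))) ` ?T)"
  proof (rule baby_Sard[where f' = "\<lambda>x v. \<psi> (f' (\<phi> x) (\<phi> v))"])
    fix x assume x: "x \<in> ?T"
    have "(\<phi> has_derivative \<phi>) (at x)" "(\<psi> has_derivative \<psi>) (at (f (\<phi> x)))"
      using \<phi> \<psi> linear_imp_has_derivative by blast+
    then have "((\<lambda>x. \<psi> (f (\<phi> x))) has_derivative (\<lambda>v. \<psi> (f' (\<phi> x) (\<phi> v)))) (at x)"
      using f[of "\<phi> x"] x by (auto intro: has_derivative_compose)
    then show "((\<lambda>x. \<psi> (f (\<phi> x))) has_derivative (\<lambda>v. \<psi> (f' (\<phi> x) (\<phi> v)))) (at x within ?T)"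
      by (rule has_derivative_at_withinI)
    let ?A = "matrix (\<lambda>v. \<psi> (f' (\<phi> x) (\<phi> v)))"
    have lin: "linear (\<lambda>v. \<psi> (f' (\<phi> x) (\<phi> v)))"
      using \<open>(_ has_derivative (\<lambda>v. \<psi> (f' (\<phi> x) (\<phi> v)))) (at x)\<close> by (rule has_derivative_linear)
    obtain v where v: "v \<noteq> 0" "f' (\<phi> x) v = 0"
      using crit[of "\<phi> x"] x by auto
    have "\<phi>' v \<noteq> 0"
      using v inv(1)[of v] linear_0[OF \<phi>] by metis
    moreover have "?A *v \<phi>' v = 0"
      using v inv(1)[of v] linear_0[OF \<psi>] by (simp add: fun_cong[OF matrix_vector_mul(2)[OF lin]])
    ultimately have "\<not> inj ((*v) ?A)"
      by (metis injD matrix_vector_mult_0_right)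
    then have "rank ?A \<noteq> CARD(2)"
      using full_rank_injective by blast
    moreover have "rank ?A \<le> CARD(2)"
      using rank_bound[of ?A] by simp
    ultimately show "rank ?A < CARD(2)" by simp
  qed simp
  then have "negligible (\<psi>' ` (\<lambda>x. \<psi> (f (\<phi> x))) ` ?T)"
    by (rule negligible_differentiable_image_negligible[rotated]) (auto intro: linear_imp_differentiable_on \<psi>')
  moreover have "f ` S \<subseteq> \<psi>' ` (\<lambda>x. \<psi> (f (\<phi> x))) ` ?T"
  proof
    fix z assume "z \<in> f ` S"
    then obtain x where "x \<in> S" "z = f x" by blast
    then show "z \<in> \<psi>' ` (\<lambda>x. \<psi> (f (\<phi> x))) ` ?T"
      by (auto simp: image_iff inv intro!: bexI[of _ "\<phi>' x"])
  qed
  ultimately show ?thesis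
    by (rule negligible_subset)
qed

lemma cross_zero_dependent:
  assumes "cross u v = 0"
  shows "\<exists>a b. (a, b) \<noteq> (0, 0) \<and> a *\<^sub>R u = b *\<^sub>R v"
proof (cases "v = 0")
  case True
  then show ?thesis by (intro exI[of _ 0] exI[of _ 1]) simp
next
  case False
  have "(v \<bullet> v) *\<^sub>R u = (u \<bullet> v) *\<^sub>R v"
    using assms by (simp add: complex_eq_iff inner_complex_def cross_def algebra_simps)
  with False show ?thesis
    by (intro exI[of _ "v \<bullet> v"] exI[of _ "u \<bullet> v"]) simp
qed

text \<open>
  The plane of projection is thought of as upright in front of the viewer: \<open>Im (plan K i s)\<close> is called
  the height of a point below, and \<open>depth\<close> is counted towards the viewer.
\<close>

definition plan :: "link \<Rightarrow> nat \<Rightarrow> real \<Rightarrow> complex" where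
  "plan K i s = fst (curve K i s)"

definition depth :: "link \<Rightarrow> nat \<Rightarrow> real \<Rightarrow> real" where
  "depth K i s = snd (curve K i s)"

definition plan_velocity :: "link \<Rightarrow> nat \<Rightarrow> real \<Rightarrow> complex" where
  "plan_velocity K i s = fst (velocity K i s)"

definition depth_velocity :: "link \<Rightarrow> nat \<Rightarrow> real \<Rightarrow> real" where
  "depth_velocity K i s = snd (velocity K i s)"

lemma plan_depth_derivative:
  assumes "regular_closed_curves K" "i < components K"
  shows "(plan K i has_vector_derivative plan_velocity K i s) (at s)"
    "(depth K i has_real_derivative depth_velocity K i s) (at s)"
  using bounded_linear.has_vector_derivative[OF bounded_linear_fst curve_has_vector_derivative[OF assms]]
    bounded_linear.has_vector_derivative[OF bounded_linear_snd curve_has_vector_derivative[OF assms]]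
  by (auto simp: plan_def[abs_def] depth_def[abs_def] plan_velocity_def depth_velocity_def
      has_real_derivative_iff_has_vector_derivative)

lemma plan_depth_differentiable:
  assumes "smooth_link K" "i < components K"
  shows "plan K i differentiable (at s)" "depth K i differentiable (at s)"
    "plan_velocity K i differentiable (at s)" "depth_velocity K i differentiable (at s)"
proof -
  have reg: "regular_closed_curves K" using assms(1) by (rule smooth_link_regular)
  show "plan K i differentiable (at s)"
    using plan_depth_derivative(1)[OF reg assms(2)] by (auto simp: has_vector_derivative_def differentiable_def)
  show "depth K i differentiable (at s)"
    using plan_depth_derivative(2)[OF reg assms(2)] by (auto simp: real_differentiable_def)
  have "velocity K i differentiable (at s)"
    using assms by (simp add: smooth_link_def)
  then obtain v' where v': "(velocity K i has_derivative v') (at s)"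
    unfolding differentiable_def by blast
  show "plan_velocity K i differentiable (at s)" "depth_velocity K i differentiable (at s)"
    unfolding plan_velocity_def[abs_def] depth_velocity_def[abs_def] differentiable_def
    using has_derivative_fst[OF v'] has_derivative_snd[OF v'] by blast+
qed

lemma plan_depth_continuous:
  assumes "regular_closed_curves K" "i < components K"
  shows "continuous_on A (plan K i)" "continuous_on A (depth K i)"
    "continuous_on A (plan_velocity K i)" "continuous_on A (depth_velocity K i)"
  unfolding plan_def[abs_def] depth_def[abs_def] plan_velocity_def[abs_def] depth_velocity_def[abs_def]
  by (intro continuous_intros continuous_on_curve continuous_on_velocity assms)+

lemma plan_depth_periodic:
  assumes "regular_closed_curves K" "i < components K"
  shows "plan K i (s + 1) = plan K i s" "depth K i (s + 1) = depth K i s"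
    "plan_velocity K i (s + 1) = plan_velocity K i s" "depth_velocity K i (s + 1) = depth_velocity K i s"
  using assms velocity_periodic[OF assms]
  by (simp_all add: plan_def depth_def plan_velocity_def depth_velocity_def regular_closed_curves_def)

lemma velocity_components_nonzero:
  assumes "regular_closed_curves K" "i < components K"
  shows "plan_velocity K i s \<noteq> 0 \<or> depth_velocity K i s \<noteq> 0"
  using velocity_nonzero[OF assms, of s] by (auto simp: plan_velocity_def depth_velocity_def prod_eq_iff)

lemma differentiable_on_shift_domain:
  assumes "\<And>x. x \<in> S \<Longrightarrow> f differentiable (at x)"
  shows "f differentiable_on S"
  using assms by (simp add: differentiable_on_def differentiable_at_withinI)

text \<open>
  Each point at which the depth has nonzero derivative determines the one shear which turns its tangent into
  the line of sight, and a differentiable curve in the plane of shears is a null set.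
\<close>

lemma negligible_not_immersed:
  assumes K: "smooth_link K"
  shows "negligible {p. \<exists>i<components K. \<exists>s. plan_velocity K i s + p * of_real (depth_velocity K i s) = 0}"
proof -
  have reg: "regular_closed_curves K" using K by (rule smooth_link_regular)
  define f where "f i s = - plan_velocity K i s / of_real (depth_velocity K i s)" for i s
  have "negligible (f i ` {s. depth_velocity K i s \<noteq> 0})" if i: "i < components K" for i
  proof (rule negligible_differentiable_image_lowdim)
    show "f i differentiable_on {s. depth_velocity K i s \<noteq> 0}"
      unfolding f_def
      by (intro differentiable_on_shift_domain differentiable_divide differentiable_minus differentiable_of_real
          plan_depth_differentiable[OF K i]) auto
  qed simp
  then have "negligible (\<Union>i\<in>{..<components K}. f i ` {s. depth_velocity K i s \<noteq> 0})"
    by (intro negligible_UNION_finite) auto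
  moreover have "{p. \<exists>i<components K. \<exists>s. plan_velocity K i s + p * of_real (depth_velocity K i s) = 0} \<subseteq>
      (\<Union>i\<in>{..<components K}. f i ` {s. depth_velocity K i s \<noteq> 0})"
  proof clarify
    fix p i s assume i: "i < components K" and 0: "plan_velocity K i s + p * of_real (depth_velocity K i s) = 0"
    then have d: "depth_velocity K i s \<noteq> 0"
      using velocity_components_nonzero[OF reg i, of s] by auto
    then have "p = f i s"
      using 0 by (simp add: f_def field_simps eq_neg_iff_add_eq_0)
    with i d show "p \<in> (\<Union>i\<in>{..<components K}. f i ` {s. depth_velocity K i s \<noteq> 0})"
      by blast
  qed
  ultimately show ?thesis
    by (rule negligible_subset)
qed

definition tangency :: "link \<Rightarrow> complex \<Rightarrow> nat \<Rightarrow> real \<Rightarrow> nat \<Rightarrow> real \<Rightarrow> bool" where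
  "tangency K p i s j t \<longleftrightarrow>
     depth K i s \<noteq> depth K j t \<and>
     plan K i s + p * of_real (depth K i s) = plan K j t + p * of_real (depth K j t) \<and>
     cross (plan_velocity K i s + p * of_real (depth_velocity K i s))
           (plan_velocity K j t + p * of_real (depth_velocity K j t)) = 0"

text \<open>
  The shear which makes two points of different depths coincide in the projection is a function of the two
  parameters.  Its critical points are the pairs where the projected branches become
  parallel, and by Sard's theorem the critical values form a null set.
\<close>

lemma negligible_tangency:
  assumes reg: "regular_closed_curves K"
  shows "negligible {p. \<exists>i<components K. \<exists>j<components K. \<exists>s t. tangency K p i s j t}"
proof -
  let ?n = "components K"
  define F where "F i j x = - (plan K i (fst x) - plan K j (snd x)) / of_real (depth K i (fst x) - depth K j (snd x))" for i j x
  define S where "S i j = {x. tangency K (F i j x) i (fst x) j (snd x)}" for i j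
  have neg: "negligible (F i j ` S i j)" if i: "i < ?n" and j: "j < ?n" for i j
  proof (rule Sard_plane)
    fix x assume x: "x \<in> S i j"
    obtain s t where [simp]: "x = (s, t)" by (cases x)
    define p where "p = F i j x"
    define Y where "Y = complex_of_real (depth K i s - depth K j t)"
    define W where "W = plan K i s - plan K j t"
    have Y: "Y \<noteq> 0" and W: "W = - p * Y"
      using x by (auto simp: S_def tangency_def Y_def W_def p_def algebra_simps)
    let ?u = "plan_velocity K i s + p * of_real (depth_velocity K i s)"
    let ?v = "plan_velocity K j t + p * of_real (depth_velocity K j t)"
    have W': "((\<lambda>x. plan K i (fst x) - plan K j (snd x)) has_derivative
        (\<lambda>(a, b). a *\<^sub>R plan_velocity K i s - b *\<^sub>R plan_velocity K j t)) (at x)"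
    proof -
      have "((\<lambda>x. plan K i (fst x)) has_derivative (\<lambda>h. fst h *\<^sub>R plan_velocity K i s)) (at x)"
        using plan_depth_derivative(1)[OF reg i, of s] unfolding has_vector_derivative_def
        by (intro has_derivative_compose[of fst fst, where g = "plan K i"]) (auto intro!: derivative_eq_intros)
      moreover have "((\<lambda>x. plan K j (snd x)) has_derivative (\<lambda>h. snd h *\<^sub>R plan_velocity K j t)) (at x)"
        using plan_depth_derivative(1)[OF reg j, of t] unfolding has_vector_derivative_def
        by (intro has_derivative_compose[of snd snd, where g = "plan K j"]) (auto intro!: derivative_eq_intros)
      ultimately show ?thesis
        unfolding case_prod_unfold by (rule has_derivative_diff)
    qed
    have Y': "((\<lambda>x. complex_of_real (depth K i (fst x) - depth K j (snd x))) has_derivative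
        (\<lambda>(a, b). of_real (a * depth_velocity K i s - b * depth_velocity K j t))) (at x)"
    proof -
      have "((\<lambda>x. depth K i (fst x)) has_derivative (\<lambda>h. fst h * depth_velocity K i s)) (at x)"
        using plan_depth_derivative(2)[OF reg i, of s]
        by (intro DERIV_compose_FDERIV) (auto intro!: derivative_eq_intros)
      moreover have "((\<lambda>x. depth K j (snd x)) has_derivative (\<lambda>h. snd h * depth_velocity K j t)) (at x)"
        using plan_depth_derivative(2)[OF reg j, of t]
        by (intro DERIV_compose_FDERIV) (auto intro!: derivative_eq_intros)
      ultimately show ?thesis
        unfolding case_prod_unfold by (intro has_derivative_of_real has_derivative_diff)
    qed
    define F' where "F' = (\<lambda>(a, b). - (a *\<^sub>R ?u - b *\<^sub>R ?v) / Y)"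
    have "((\<lambda>x. - (plan K i (fst x) - plan K j (snd x)) / of_real (depth K i (fst x) - depth K j (snd x)))
        has_derivative F') (at x)"
    proof -
      define W' where "W' = (\<lambda>(a, b). a *\<^sub>R plan_velocity K i s - b *\<^sub>R plan_velocity K j t)"
      define Y' where "Y' = (\<lambda>(a, b). complex_of_real (a * depth_velocity K i s - b * depth_velocity K j t))"
      have "((\<lambda>x. - (plan K i (fst x) - plan K j (snd x)) / of_real (depth K i (fst x) - depth K j (snd x)))
          has_derivative (\<lambda>h. (- W' h * Y - - W * Y' h) / (Y * Y))) (at x)"
        using has_derivative_divide'[OF has_derivative_minus[OF W'] Y'] Y
        by (simp add: W_def Y_def W'_def Y'_def)
      moreover have "(\<lambda>h. (- W' h * Y - - W * Y' h) / (Y * Y)) = F'"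
      proof
        fix h :: "real \<times> real"
        have "- W' h * Y - - W * Y' h = - (W' h + p * Y' h) * Y"
          unfolding W by (simp add: algebra_simps)
        moreover have "W' h + p * Y' h = fst h *\<^sub>R ?u - snd h *\<^sub>R ?v"
          by (simp add: W'_def Y'_def case_prod_unfold scaleR_conv_of_real algebra_simps)
        ultimately show "(- W' h * Y - - W * Y' h) / (Y * Y) = F' h"
          using Y by (simp add: F'_def case_prod_unfold)
      qed
      ultimately show ?thesis by simp
    qed
    then have "(F i j has_derivative F') (at x)"
      unfolding F_def[abs_def] .
    moreover have "cross ?u ?v = 0"
      using x by (simp add: S_def tangency_def p_def)
    then obtain a b where "(a, b) \<noteq> (0, 0)" "a *\<^sub>R ?u = b *\<^sub>R ?v"
      using cross_zero_dependent by blast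
    then have "(a, b) \<noteq> 0 \<and> F' (a, b) = 0"
      by (auto simp: F'_def zero_prod_def)
    ultimately show "\<exists>F'. (F i j has_derivative F') (at x) \<and> (\<exists>v. v \<noteq> 0 \<and> F' v = 0)"
      by blast
  qed
  have "negligible (\<Union>i\<in>{..<?n}. \<Union>j\<in>{..<?n}. F i j ` S i j)"
    by (intro negligible_UNION_finite neg) auto
  moreover have "{p. \<exists>i<?n. \<exists>j<?n. \<exists>s t. tangency K p i s j t} \<subseteq> (\<Union>i\<in>{..<?n}. \<Union>j\<in>{..<?n}. F i j ` S i j)"
  proof clarify
    fix p i j s t assume ij: "i < ?n" "j < ?n" and tan: "tangency K p i s j t"
    have "p = F i j (s, t)"
      using tan by (simp add: tangency_def F_def field_simps)
    moreover from this tan have "(s, t) \<in> S i j"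
      by (simp add: S_def)
    ultimately have "p \<in> F i j ` S i j"
      by (rule image_eqI)
    with ij show "p \<in> (\<Union>i\<in>{..<?n}. \<Union>j\<in>{..<?n}. F i j ` S i j)" by blast
  qed
  ultimately show ?thesis
    by (rule negligible_subset)
qed

definition triple_point :: "link \<Rightarrow> complex \<Rightarrow> complex \<Rightarrow> nat \<Rightarrow> real \<Rightarrow> nat \<Rightarrow> real \<Rightarrow> nat \<Rightarrow> real \<Rightarrow> bool" where
  "triple_point K q p i s j t k u \<longleftrightarrow>
     depth K i s \<noteq> depth K j t \<and> depth K j t \<noteq> depth K k u \<and> depth K i s \<noteq> depth K k u \<and>
     plan K i s + p * of_real (depth K i s) + q * (of_real (depth K i s))\<^sup>2 =
       plan K j t + p * of_real (depth K j t) + q * (of_real (depth K j t))\<^sup>2 \<and>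
     plan K j t + p * of_real (depth K j t) + q * (of_real (depth K j t))\<^sup>2 =
       plan K k u + p * of_real (depth K k u) + q * (of_real (depth K k u))\<^sup>2"

text \<open>
  Quadratic polynomials interpolate at three different depths, so three points determine the
  quadratic shear that makes them coincide in the projection; the formulas are divided differences.
  Three real parameters do not fill the four-dimensional space of pairs \<open>(q, p)\<close>.
\<close>

lemma negligible_triple_points:
  assumes K: "smooth_link K"
  shows "negligible {(q, p). \<exists>i<components K. \<exists>j<components K. \<exists>k<components K. \<exists>s t u. triple_point K q p i s j t k u}"
proof -
  let ?n = "components K"
  define A where "A i j s t = - (plan K i s - plan K j t) / of_real (depth K i s - depth K j t)" for i j s t
  define Q where "Q i j k x = (case x of (s, t, u) \<Rightarrow> (A i j s t - A j k t u) / of_real (depth K i s - depth K k u))" for i j k x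
  define G where "G i j k x = (Q i j k x, A i j (fst x) (fst (snd x)) - Q i j k x * of_real (depth K i (fst x) + depth K j (fst (snd x))))" for i j k x
  define S where "S i j k = {(s, t, u). depth K i s \<noteq> depth K j t \<and> depth K j t \<noteq> depth K k u \<and> depth K i s \<noteq> depth K k u}" for i j k
  have neg: "negligible (G i j k ` S i j k)" if ijk: "i < ?n" "j < ?n" "k < ?n" for i j k
  proof (rule negligible_differentiable_image_lowdim)
    note d = plan_depth_differentiable(1,2)[OF K]
    have sub: "(\<lambda>x :: real \<times> real \<times> real. fst x) differentiable (at x)"
        "(\<lambda>x :: real \<times> real \<times> real. fst (snd x)) differentiable (at x)"
        "(\<lambda>x :: real \<times> real \<times> real. snd (snd x)) differentiable (at x)" for x
      by (auto intro!: bounded_linear_imp_differentiable bounded_linear_fst bounded_linear_snd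
          bounded_linear_compose[of fst snd] bounded_linear_compose[of snd snd])
    have P: "(\<lambda>x. plan K l (g x)) differentiable (at x)" "(\<lambda>x. depth K l (g x)) differentiable (at x)"
      if "l < ?n" "g differentiable (at x)" for l g and x :: "real \<times> real \<times> real"
      using that d differentiable_compose_at by blast+
    show "G i j k differentiable_on S i j k"
    proof (rule differentiable_on_shift_domain)
      fix x assume "x \<in> S i j k"
      then have nz: "depth K i (fst x) \<noteq> depth K j (fst (snd x))" "depth K j (fst (snd x)) \<noteq> depth K k (snd (snd x))"
          "depth K i (fst x) \<noteq> depth K k (snd (snd x))"
        by (auto simp: S_def)
      have A1: "(\<lambda>x. A i j (fst x) (fst (snd x))) differentiable (at x)"
        unfolding A_def
        by (intro differentiable_of_real differentiable_divide differentiable_minus differentiable_diff P ijk sub) (use nz in auto)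
      have A2: "(\<lambda>x. A j k (fst (snd x)) (snd (snd x))) differentiable (at x)"
        unfolding A_def
        by (intro differentiable_of_real differentiable_divide differentiable_minus differentiable_diff P ijk sub) (use nz in auto)
      have Q: "Q i j k differentiable (at x)"
        unfolding Q_def[abs_def] case_prod_unfold
        by (intro differentiable_of_real differentiable_divide differentiable_diff A1 A2 P ijk sub) (use nz in auto)
      have "(\<lambda>x. A i j (fst x) (fst (snd x)) - Q i j k x * of_real (depth K i (fst x) + depth K j (fst (snd x)))) differentiable (at x)"
        by (intro differentiable_of_real differentiable_mult differentiable_diff differentiable_add A1 Q P ijk sub)
      with Q obtain D1 D2 where "(Q i j k has_derivative D1) (at x)"
        "((\<lambda>x. A i j (fst x) (fst (snd x)) - Q i j k x * of_real (depth K i (fst x) + depth K j (fst (snd x)))) has_derivative D2) (at x)"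
        unfolding differentiable_def by blast
      from has_derivative_Pair[OF this] show "G i j k differentiable (at x)"
        unfolding G_def[abs_def] differentiable_def by blast
    qed
  qed simp
  have "negligible (\<Union>i\<in>{..<?n}. \<Union>j\<in>{..<?n}. \<Union>k\<in>{..<?n}. G i j k ` S i j k)"
    by (intro negligible_UNION_finite neg) auto
  moreover have "{(q, p). \<exists>i<?n. \<exists>j<?n. \<exists>k<?n. \<exists>s t u. triple_point K q p i s j t k u} \<subseteq>
     (\<Union>i\<in>{..<?n}. \<Union>j\<in>{..<?n}. \<Union>k\<in>{..<?n}. G i j k ` S i j k)"
  proof clarify
    fix q p i j k s t u assume ijk: "i < ?n" "j < ?n" "k < ?n" and tr: "triple_point K q p i s j t k u"
    define x where "x = complex_of_real (depth K i s)"
    define y where "y = complex_of_real (depth K j t)"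
    define z where "z = complex_of_real (depth K k u)"
    have ne: "x \<noteq> y" "y \<noteq> z" "x \<noteq> z"
      using tr by (auto simp: triple_point_def x_def y_def z_def)
    have e1: "plan K i s + p * x + q * x\<^sup>2 = plan K j t + p * y + q * y\<^sup>2"
      and e2: "plan K j t + p * y + q * y\<^sup>2 = plan K k u + p * z + q * z\<^sup>2"
      using tr by (auto simp: triple_point_def x_def y_def z_def)
    have "- (plan K i s - plan K j t) = (p + q * (x + y)) * (x - y)"
      using e1 by (simp add: algebra_simps power2_eq_square)
    then have A1: "A i j s t = p + q * (x + y)"
      using ne unfolding A_def of_real_diff x_def[symmetric] y_def[symmetric] by simp
    have "- (plan K j t - plan K k u) = (p + q * (y + z)) * (y - z)"
      using e2 by (simp add: algebra_simps power2_eq_square)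
    then have A2: "A j k t u = p + q * (y + z)"
      using ne unfolding A_def of_real_diff y_def[symmetric] z_def[symmetric] by simp
    have "A i j s t - A j k t u = q * (x - z)"
      by (simp add: A1 A2 algebra_simps)
    then have "Q i j k (s, t, u) = q"
      using ne by (simp add: Q_def flip: x_def z_def)
    then have "(q, p) = G i j k (s, t, u)"
      by (simp add: G_def A1 flip: x_def y_def)
    moreover have "(s, t, u) \<in> S i j k"
      using tr by (simp add: S_def triple_point_def)
    ultimately have "(q, p) \<in> G i j k ` S i j k"
      by (rule image_eqI)
    with ijk show "(q, p) \<in> (\<Union>i\<in>{..<?n}. \<Union>j\<in>{..<?n}. \<Union>k\<in>{..<?n}. G i j k ` S i j k)"
      by blast
  qed
  ultimately show ?thesis
    by (rule negligible_subset)
qed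

lemma negligible_imp_AE_lborel: "negligible N \<Longrightarrow> AE x in lborel. x \<notin> N"
  using AE_not_in[of N lebesgue] by (simp add: AE_completion_iff negligible_iff_null_sets)

lemma AE_lborel_ball:
  assumes "AE x in (lborel :: 'a::euclidean_space measure). P x" "e > 0"
  shows "\<exists>x\<in>ball 0 e. P x"
proof (rule ccontr)
  assume no: "\<not> ?thesis"
  have "AE x in (lebesgue :: 'a measure). P x"
    using assms(1) by (simp add: AE_completion_iff)
  then obtain N where N: "N \<in> null_sets lebesgue" "{x \<in> space lebesgue. \<not> P x} \<subseteq> N"
    unfolding eventually_ae_filter by blast
  then have "ball 0 e \<subseteq> N"
    using no by auto
  with N(1) have "negligible (ball (0 :: 'a) e)"
    by (meson negligible_iff_null_sets negligible_subset)
  then show False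
    using assms(2) open_not_negligible[of "ball (0 :: 'a) e"] by auto
qed


section \<open>Diagrams of links\<close>

definition shadow :: "link \<Rightarrow> diagram" where
  "shadow K = \<lparr>components = components K, curve = plan K, over = (\<lambda>i s j t. depth K i s > depth K j t)\<rparr>"

definition rotation :: "link \<Rightarrow> complex" where
  "rotation K = (\<Sum>i<components K. winding_number (plan_velocity K i) 0)"

definition immersed :: "link \<Rightarrow> bool" where
  "immersed K \<longleftrightarrow> (\<forall>i<components K. \<forall>s. plan_velocity K i s \<noteq> 0)"

definition generic_link :: "link \<Rightarrow> bool" where
  "generic_link K \<longleftrightarrow> is_link K \<and> immersed K \<and>
     (\<forall>i<components K. \<forall>j<components K. \<forall>s t. \<not> tangency K 0 i s j t) \<and>
     (\<forall>i<components K. \<forall>j<components K. \<forall>k<components K. \<forall>s t u. \<not> triple_point K 0 0 i s j t k u)"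

lemma shadow_simps [simp]:
  "components (shadow K) = components K" "curve (shadow K) = plan K"
  "over (shadow K) i s j t \<longleftrightarrow> depth K i s > depth K j t"
  by (simp_all add: shadow_def)

lemma velocity_shadow:
  assumes "regular_closed_curves K" "i < components K"
  shows "velocity (shadow K) i s = plan_velocity K i s"
  using plan_depth_derivative(1)[OF assms] by (simp add: vector_derivative_at)

lemma total_winding_shadow: "regular_closed_curves K \<Longrightarrow> total_winding (shadow K) = rotation K"
proof -
  assume "regular_closed_curves K"
  then have "velocity (shadow K) i = plan_velocity K i" if "i < components K" for i
    using velocity_shadow that by blast
  then show ?thesis by (simp add: total_winding_def rotation_def)
qed

text \<open>
  A link has no double points, so two branches over the same point of the plane differ in depth.
\<close>

lemma double_point_shadow:
  assumes "is_link K"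
  shows "double_point (shadow K) i s j t \<longleftrightarrow>
    i < components K \<and> j < components K \<and> plan K i s = plan K j t \<and> depth K i s \<noteq> depth K j t"
proof (cases "i < components K \<and> j < components K")
  case True
  have reg: "regular_closed_curves K"
    using assms by (simp add: is_link_def)
  have "depth K i s = depth K j t" if "same_parameter i s j t"
    using that True plan_depth_periodic(2)[OF reg] periodic_Ints[of "depth K i" s t]
    by (auto simp: same_parameter_def)
  moreover have "same_parameter i s j t" if "plan K i s = plan K j t" "depth K i s = depth K j t"
    using assms True that by (auto simp: is_link_def double_point_def plan_def depth_def prod_eq_iff)
  ultimately show ?thesis
    using True by (auto simp: double_point_def)
qed (auto simp: double_point_def)

lemma generic_link_is_diagram:
  assumes K: "generic_link K"
  shows "is_diagram (shadow K)"
proof -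
  have link: "is_link K" and reg: "regular_closed_curves K"
    using K by (auto simp: generic_link_def is_link_def)
  note dp = double_point_shadow[OF link]
  have "regular_closed_curves (shadow K)"
    unfolding regular_closed_curves_def
  proof (intro conjI allI impI)
    show "components (shadow K) \<ge> 1"
      using reg by (simp add: regular_closed_curves_def)
    fix i s assume "i < components (shadow K)"
    then have i: "i < components K" by simp
    show "curve (shadow K) i C1_differentiable_on UNIV"
      using plan_depth_derivative(1)[OF reg i] plan_depth_continuous(3)[OF reg i]
      by (auto simp: C1_differentiable_on_def)
    show "curve (shadow K) i (s + 1) = curve (shadow K) i s"
      using plan_depth_periodic(1)[OF reg i] by simp
    show "velocity (shadow K) i s \<noteq> 0"
      using K i unfolding velocity_shadow[OF reg i] by (simp add: generic_link_def immersed_def)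
  qed
  moreover have "cross (velocity (shadow K) i s) (velocity (shadow K) j t) \<noteq> 0 \<and>
        over (shadow K) i (s + 1) j t = over (shadow K) i s j t \<and>
        (over (shadow K) i s j t \<longleftrightarrow> \<not> over (shadow K) j t i s)"
    if d: "double_point (shadow K) i s j t" for i s j t
  proof -
    have ij: "i < components K" "j < components K" and d': "plan K i s = plan K j t" "depth K i s \<noteq> depth K j t"
      using d dp by auto
    have "\<not> tangency K 0 i s j t"
      using K ij by (simp add: generic_link_def)
    then have "cross (velocity (shadow K) i s) (velocity (shadow K) j t) \<noteq> 0"
      using d' unfolding velocity_shadow[OF reg ij(1)] velocity_shadow[OF reg ij(2)] by (simp add: tangency_def)
    then show ?thesis
      using d' plan_depth_periodic(2)[OF reg ij(1)] by auto
  qed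
  moreover have "\<not> (double_point (shadow K) i s j t \<and> double_point (shadow K) j t k u \<and> double_point (shadow K) i s k u)"
    for i s j t k u
  proof
    assume "double_point (shadow K) i s j t \<and> double_point (shadow K) j t k u \<and> double_point (shadow K) i s k u"
    then have "i < components K" "j < components K" "k < components K" "triple_point K 0 0 i s j t k u"
      using dp by (auto simp: triple_point_def)
    then show False
      using K by (simp add: generic_link_def)
  qed
  ultimately show ?thesis
    unfolding is_diagram_def by blast
qed

lemma generic_link_diagram_of:
  assumes "generic_link K" "link_isotopic L K"
  shows "diagram_of L (shadow K)"
  unfolding diagram_of_def
  using generic_link_is_diagram[OF assms(1)] assms(2)
  by (auto simp: plan_def depth_def intro!: exI[of _ K])

lemma rotation_nearby:
  assumes reg: "regular_closed_curves K" "regular_closed_curves K'" and c: "components K' = components K"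
    and near: "\<And>i s. i < components K \<Longrightarrow> cmod (plan_velocity K' i s - plan_velocity K i s) < cmod (plan_velocity K i s)"
  shows "rotation K' = rotation K" "immersed K'"
proof -
  have "winding_number (plan_velocity K' i) 0 = winding_number (plan_velocity K i) 0" if i: "i < components K" for i
  proof (rule winding_number_nearby_loops_eq)
    have i': "i < components K'" using i c by simp
    show "path (plan_velocity K i)" "path (plan_velocity K' i)"
      using plan_depth_continuous(3)[OF reg(1) i] plan_depth_continuous(3)[OF reg(2) i'] by (auto simp: path_def)
    show "pathfinish (plan_velocity K i) = pathstart (plan_velocity K i)"
      "pathfinish (plan_velocity K' i) = pathstart (plan_velocity K' i)"
      using plan_depth_periodic(3)[OF reg(1) i, of 0] plan_depth_periodic(3)[OF reg(2) i', of 0]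
      by (auto simp: pathstart_def pathfinish_def)
  qed (use near[OF i] in simp)
  then show "rotation K' = rotation K"
    by (simp add: rotation_def c)
  show "immersed K'"
    unfolding immersed_def
  proof (intro allI impI notI)
    fix i s assume "i < components K'" "plan_velocity K' i s = 0"
    with near[of i s] c show False by simp
  qed
qed

text \<open>
  By periodicity the quotient of \<open>N\<close> by the speed of the projection is bounded.
\<close>

lemma uniform_perturbation_bound:
  assumes reg: "regular_closed_curves K" and imm: "immersed K"
    and N: "\<And>i. i < components K \<Longrightarrow> continuous_on UNIV (N i)" "\<And>i s. i < components K \<Longrightarrow> N i (s + 1) = N i s"
  shows "\<exists>e>0. \<forall>i<components K. \<forall>s. e * \<bar>N i s\<bar> < cmod (plan_velocity K i s)"
proof -
  have nz: "plan_velocity K i s \<noteq> 0" if "i < components K" for i s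
    using imm that by (simp add: immersed_def)
  have "compact ((\<lambda>s. N i s / cmod (plan_velocity K i s)) ` {0..1})" if i: "i < components K" for i
    using continuous_on_subset[OF N(1)[OF i]] plan_depth_continuous(3)[OF reg i] nz[OF i]
    by (intro compact_continuous_image continuous_intros) auto
  then have "bounded (\<Union>i\<in>{..<components K}. (\<lambda>s. N i s / cmod (plan_velocity K i s)) ` {0..1})"
    by (intro bounded_UN) (auto intro: compact_imp_bounded)
  then obtain B where B: "B > 0" "\<And>i s. i < components K \<Longrightarrow> s \<in> {0..1} \<Longrightarrow> \<bar>N i s / cmod (plan_velocity K i s)\<bar> \<le> B"
    unfolding bounded_pos by force
  have "(1 / (B + 1)) * \<bar>N i s\<bar> < cmod (plan_velocity K i s)" if i: "i < components K" for i s
  proof -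
    have "frac s \<in> {0..1}" using frac_lt_1[of s] by auto
    from B(2)[OF i this] have "\<bar>N i (frac s)\<bar> \<le> B * cmod (plan_velocity K i (frac s))"
      using nz[OF i, of "frac s"] by (simp add: abs_divide field_simps)
    moreover have "N i (frac s) = N i s"
      by (rule periodic_Ints[of "N i"]) (use N(2)[OF i] in auto)
    moreover have "plan_velocity K i (frac s) = plan_velocity K i s"
      by (rule periodic_Ints[of "plan_velocity K i"]) (use plan_depth_periodic(3)[OF reg i] in auto)
    ultimately have "\<bar>N i s\<bar> \<le> B * cmod (plan_velocity K i s)" by simp
    also have "\<dots> < (B + 1) * cmod (plan_velocity K i s)"
      using nz[OF i] by simp
    finally show ?thesis
      using B(1) by (simp add: field_simps)
  qed
  with B(1) show ?thesis
    by (intro exI[of _ "1 / (B + 1)"]) auto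
qed

definition quadratic_shear :: "complex \<Rightarrow> complex \<Rightarrow> complex \<times> real \<Rightarrow> complex \<times> real" where
  "quadratic_shear p q x = x + (p * of_real (snd x) + q * (of_real (snd x))\<^sup>2, 0)"

lemma quadratic_shear_link:
  fixes p q K
  defines "K' \<equiv> map_curves (quadratic_shear p q) K"
  assumes K: "smooth_link K"
  shows "smooth_link K'" "link_isotopic L K \<Longrightarrow> link_isotopic L K'"
    "components K' = components K" "depth K' i s = depth K i s"
    "plan K' i s = plan K i s + p * of_real (depth K i s) + q * (of_real (depth K i s))\<^sup>2"
    "i < components K \<Longrightarrow> depth_velocity K' i s = depth_velocity K i s"
    "i < components K \<Longrightarrow> plan_velocity K' i s =
       plan_velocity K i s + p * of_real (depth_velocity K i s) + 2 * q * of_real (depth K i s * depth_velocity K i s)"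
proof -
  define g where "g x = (p * of_real (snd x) + q * (of_real (snd x))\<^sup>2, 0 :: real)" for x :: "complex \<times> real"
  define g' where "g' x v = (p * of_real (snd v) + 2 * q * of_real (snd x * snd v), 0 :: real)" for x v :: "complex \<times> real"
  have K'_eq: "K' = map_curves (\<lambda>x. x + g x) K"
    unfolding K'_def g_def quadratic_shear_def[abs_def] ..
  have g: "(g has_derivative g' x) (at x)" for x
    unfolding g_def g'_def power2_eq_square
    by (auto intro!: derivative_eq_intros simp: algebra_simps)
  have cont: "continuous_on UNIV (\<lambda>x. g' x v)" for v
    unfolding g'_def by (intro continuous_intros)
  have inv: "g (x + t *\<^sub>R g x) = g x" for t x
    by (simp add: g_def)
  have d: "(\<lambda>(x, v). g' x v) differentiable (at z)" for z
    unfolding g'_def case_prod_unfold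
    by (intro derivative_intros differentiable_Pair differentiable_of_real
        differentiable_bounded_linear[OF bounded_linear_fst] differentiable_bounded_linear[OF bounded_linear_snd])
  note s = shear_link[where g = g and g' = g' and K = K, OF g cont inv d K, folded K'_eq]
  show "smooth_link K'" "link_isotopic L K \<Longrightarrow> link_isotopic L K'" "components K' = components K"
    using s by (auto simp: K'_def)
  show "depth K' i s = depth K i s"
    "plan K' i s = plan K i s + p * of_real (depth K i s) + q * (of_real (depth K i s))\<^sup>2"
    by (simp_all add: K'_def plan_def depth_def quadratic_shear_def)
  assume "i < components K"
  then show "depth_velocity K' i s = depth_velocity K i s"
    "plan_velocity K' i s =
       plan_velocity K i s + p * of_real (depth_velocity K i s) + 2 * q * of_real (depth K i s * depth_velocity K i s)"
    using s(3) by (simp_all add: g'_def depth_velocity_def plan_velocity_def depth_def)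
qed

lemma immersed_after_shear:
  assumes K: "smooth_link K"
  shows "\<exists>p. immersed (map_curves (quadratic_shear p 0) K)"
proof -
  let ?N = "{p. \<exists>i<components K. \<exists>s. plan_velocity K i s + p * of_real (depth_velocity K i s) = 0}"
  have "?N \<noteq> UNIV"
    using negligible_not_immersed[OF K] non_negligible_UNIV by metis
  then obtain p where "p \<notin> ?N" by blast
  then show ?thesis
    using quadratic_shear_link[OF K] by (auto simp: immersed_def intro!: exI[of _ p])
qed

text \<open>
  Triple points are controlled for almost every pair \<open>(q, p)\<close>, the other two conditions for almost every
  \<open>p\<close> when \<open>q\<close> is fixed; the latter are the statements about linear shears for the link already
  sheared by \<open>q\<close>.  Fubini's theorem brings the two together.
\<close>

lemma generic_after_small_shear:
  assumes K: "smooth_link K" and "e > 0"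
  shows "\<exists>p q. cmod p < e \<and> cmod q < e \<and> generic_link (map_curves (quadratic_shear p q) K)"
proof -
  let ?n = "components K"
  let ?T = "{(q, p). \<exists>i<?n. \<exists>j<?n. \<exists>k<?n. \<exists>s t u. triple_point K q p i s j t k u}"
  have "AE x in lborel \<Otimes>\<^sub>M lborel. x \<notin> ?T"
    unfolding lborel_prod by (rule negligible_imp_AE_lborel[OF negligible_triple_points[OF K]])
  then have T: "AE q in lborel. AE p in lborel. (q, p) \<notin> ?T"
    by (rule lborel_pair.AE_pair)
  define good where "good q p \<longleftrightarrow> (q, p) \<notin> ?T \<and>
    (let K' = map_curves (quadratic_shear 0 q) K in
      p \<notin> {p. \<exists>i<?n. \<exists>s. plan_velocity K' i s + p * of_real (depth_velocity K' i s) = 0} \<and>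
      p \<notin> {p. \<exists>i<?n. \<exists>j<?n. \<exists>s t. tangency K' p i s j t})" for q p
  have "AE q in lborel. AE p in lborel. good q p"
    using T
  proof eventually_elim
    case (elim q)
    define K' where "K' = map_curves (quadratic_shear 0 q) K"
    have K': "smooth_link K'" and n: "components K' = ?n"
      unfolding K'_def using quadratic_shear_link[OF K] by blast+
    have "AE p in lborel. p \<notin> {p. \<exists>i<?n. \<exists>s. plan_velocity K' i s + p * of_real (depth_velocity K' i s) = 0}"
      using negligible_imp_AE_lborel[OF negligible_not_immersed[OF K']] by (simp add: n)
    moreover have "AE p in lborel. p \<notin> {p. \<exists>i<?n. \<exists>j<?n. \<exists>s t. tangency K' p i s j t}"
      using negligible_imp_AE_lborel[OF negligible_tangency[OF smooth_link_regular[OF K']]] by (simp add: n)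
    ultimately show ?case
      using elim unfolding good_def Let_def K'_def[symmetric] by eventually_elim blast
  qed
  from AE_lborel_ball[OF this \<open>e > 0\<close>] obtain q where q: "cmod q < e" "AE p in lborel. good q p"
    by auto
  from AE_lborel_ball[OF q(2) \<open>e > 0\<close>] obtain p where p: "cmod p < e" "good q p"
    by auto
  define K' where "K' = map_curves (quadratic_shear 0 q) K"
  define K'' where "K'' = map_curves (quadratic_shear p q) K"
  note s' = quadratic_shear_link[OF K, where p = 0 and q = q, folded K'_def] and s'' = quadratic_shear_link[OF K, where p = p and q = q, folded K''_def]
  have imm: "\<And>i s. i < ?n \<Longrightarrow> plan_velocity K' i s + p * of_real (depth_velocity K' i s) \<noteq> 0"
    and tan: "\<And>i s j t. i < ?n \<Longrightarrow> j < ?n \<Longrightarrow> \<not> tangency K' p i s j t"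
    and tri: "\<And>i s j t k u. i < ?n \<Longrightarrow> j < ?n \<Longrightarrow> k < ?n \<Longrightarrow> \<not> triple_point K q p i s j t k u"
    using p(2) unfolding good_def Let_def K'_def[symmetric] by auto
  have pv: "plan_velocity K'' i s = plan_velocity K' i s + p * of_real (depth_velocity K' i s)" if "i < ?n" for i s
    using s'(6,7)[OF that] s''(7)[OF that] by simp
  have pl: "plan K'' i s = plan K' i s + p * of_real (depth K' i s)" for i s
    using s'(4,5) s''(5) by simp
  have "generic_link K''"
    unfolding generic_link_def
  proof (intro conjI allI impI)
    show "is_link K''"
      using s''(1) by (simp add: smooth_link_def)
    show "immersed K''"
      using imm pv s''(3) by (simp add: immersed_def)
    show "\<not> tangency K'' 0 i s j t" if "i < components K''" "j < components K''" for i s j t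
      using tan[of i j s t] that s''(3) pv s'(4) s''(4) by (simp add: tangency_def pl)
    show "\<not> triple_point K'' 0 0 i s j t k u" if "i < components K''" "j < components K''" "k < components K''" for i s j t k u
      using tri[of i j k s t u] that s''(3,4,5) by (simp add: triple_point_def)
  qed
  with p(1) q(1) show ?thesis
    unfolding K''_def by blast
qed

lemma generic_perturbation:
  assumes K: "smooth_link K" and imm: "immersed K" and L: "link_isotopic L K"
  shows "\<exists>K'. generic_link K' \<and> link_isotopic L K' \<and> rotation K' = rotation K"
proof -
  have reg: "regular_closed_curves K" using K by (rule smooth_link_regular)
  define N where "N i s = \<bar>depth_velocity K i s\<bar> + 2 * \<bar>depth K i s * depth_velocity K i s\<bar>" for i s
  obtain e where e: "e > 0" "\<And>i s. i < components K \<Longrightarrow> e * \<bar>N i s\<bar> < cmod (plan_velocity K i s)"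
  proof -
    have "\<exists>e>0. \<forall>i<components K. \<forall>s. e * \<bar>N i s\<bar> < cmod (plan_velocity K i s)"
    proof (rule uniform_perturbation_bound[OF reg imm])
      show "continuous_on UNIV (N i)" if "i < components K" for i
        unfolding N_def by (intro continuous_intros plan_depth_continuous[OF reg that])
      show "N i (s + 1) = N i s" if "i < components K" for i s
        using plan_depth_periodic[OF reg that] by (simp add: N_def)
    qed
    then show ?thesis using that by blast
  qed
  obtain p q where pq: "cmod p < e" "cmod q < e" and gen: "generic_link (map_curves (quadratic_shear p q) K)"
    using generic_after_small_shear[OF K e(1)] by blast
  define K' where "K' = map_curves (quadratic_shear p q) K"
  note s = quadratic_shear_link[OF K, where p = p and q = q, folded K'_def]
  have "rotation K' = rotation K"
  proof (rule rotation_nearby[OF reg smooth_link_regular[OF s(1)] s(3)])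
    fix i t assume i: "i < components K"
    have "plan_velocity K' i t - plan_velocity K i t =
        p * of_real (depth_velocity K i t) + 2 * q * of_real (depth K i t * depth_velocity K i t)"
      using s(7)[OF i] by simp
    also have "cmod \<dots> \<le> cmod p * \<bar>depth_velocity K i t\<bar> + 2 * cmod q * \<bar>depth K i t * depth_velocity K i t\<bar>"
      by (rule norm_triangle_le) (simp add: norm_mult abs_mult)
    also have "\<dots> \<le> e * \<bar>depth_velocity K i t\<bar> + 2 * e * \<bar>depth K i t * depth_velocity K i t\<bar>"
      using pq by (intro add_mono mult_right_mono) auto
    also have "\<dots> = e * \<bar>N i t\<bar>"
      by (simp add: N_def algebra_simps)
    also have "\<dots> < cmod (plan_velocity K i t)"
      by (rule e(2)[OF i])
    finally show "cmod (plan_velocity K' i t - plan_velocity K i t) < cmod (plan_velocity K i t)" .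
  qed
  with gen s(2)[OF L] show ?thesis
    unfolding K'_def by blast
qed


section \<open>A single highest point\<close>

text \<open>
  The height is lowered by a multiple of the squared distance from the vertical line through \<open>z\<close>.  For a
  highest point \<open>z\<close> of a link and \<open>c > 0\<close> this leaves \<open>z\<close> in place and makes it the only highest point, with
  negative second derivative of the height.
\<close>

definition paraboloid_shear :: "real \<Rightarrow> complex \<times> real \<Rightarrow> complex \<times> real \<Rightarrow> complex \<times> real" where
  "paraboloid_shear c z x = x + (- \<i> * of_real (c * ((Re (fst x) - Re (fst z))\<^sup>2 + (snd x - snd z)\<^sup>2)), 0)"

lemma paraboloid_shear_link:
  fixes c z K
  defines "K' \<equiv> map_curves (paraboloid_shear c z) K"
  assumes K: "smooth_link K"
  shows "smooth_link K'" "link_isotopic L K \<Longrightarrow> link_isotopic L K'" "components K' = components K"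
    "plan K' i s = plan K i s - \<i> * of_real (c * ((Re (plan K i s) - Re (fst z))\<^sup>2 + (depth K i s - snd z)\<^sup>2))"
    "i < components K \<Longrightarrow> plan_velocity K' i s = plan_velocity K i s - \<i> * of_real (2 * c *
       ((Re (plan K i s) - Re (fst z)) * Re (plan_velocity K i s) + (depth K i s - snd z) * depth_velocity K i s))"
proof -
  define g where "g x = (- \<i> * of_real (c * ((Re (fst x) - Re (fst z))\<^sup>2 + (snd x - snd z)\<^sup>2)), 0 :: real)" for x
  define g' where "g' x v = (- \<i> * of_real (2 * c * ((Re (fst x) - Re (fst z)) * Re (fst v) + (snd x - snd z) * snd v)), 0 :: real)"
    for x v :: "complex \<times> real"
  have K'_eq: "K' = map_curves (\<lambda>x. x + g x) K"
    unfolding K'_def g_def paraboloid_shear_def[abs_def] ..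
  have g: "(g has_derivative g' x) (at x)" for x
    unfolding g_def g'_def power2_eq_square
    by (auto intro!: derivative_eq_intros simp: algebra_simps)
  have cont: "continuous_on UNIV (\<lambda>x. g' x v)" for v
    unfolding g'_def by (intro continuous_intros)
  have inv: "g (x + t *\<^sub>R g x) = g x" for t x
    by (simp add: g_def)
  have d: "(\<lambda>(x, v). g' x v) differentiable (at z)" for z
    unfolding g'_def case_prod_unfold
    by (intro differentiable_mult differentiable_add differentiable_diff differentiable_const
        differentiable_Pair differentiable_of_real differentiable_bounded_linear[OF bounded_linear_Re]
        differentiable_bounded_linear[OF bounded_linear_fst] differentiable_bounded_linear[OF bounded_linear_snd] differentiable_ident)
  note s = shear_link[where g = g and g' = g' and K = K, OF g cont inv d K, folded K'_eq]
  show "smooth_link K'" "link_isotopic L K \<Longrightarrow> link_isotopic L K'" "components K' = components K"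
    using s by (auto simp: K'_def)
  show "plan K' i s = plan K i s - \<i> * of_real (c * ((Re (plan K i s) - Re (fst z))\<^sup>2 + (depth K i s - snd z)\<^sup>2))"
    by (simp add: K'_def plan_def depth_def paraboloid_shear_def)
  show "plan_velocity K' i s = plan_velocity K i s - \<i> * of_real (2 * c *
       ((Re (plan K i s) - Re (fst z)) * Re (plan_velocity K i s) + (depth K i s - snd z) * depth_velocity K i s))"
    if "i < components K"
    using s(3)[OF that] by (simp add: plan_velocity_def depth_velocity_def plan_def depth_def g'_def)
qed

lemma derivative_at_max:
  fixes h :: "real \<Rightarrow> real"
  assumes h: "\<And>s. (h has_real_derivative h' s) (at s)" and max: "\<And>s. h s \<le> h s0"
  shows "h' s0 = 0"
  using DERIV_local_max[OF h, of 1 s0] max by auto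

lemma second_derivative_at_max:
  fixes h :: "real \<Rightarrow> real"
  assumes h: "\<And>s. (h has_real_derivative h' s) (at s)" and max: "\<And>s. h s \<le> h s0"
    and d: "(h' has_real_derivative d) (at s0)"
  shows "d \<le> 0"
proof (rule ccontr)
  assume "\<not> d \<le> 0"
  then obtain e where e: "e > 0" "\<And>t. 0 < t \<Longrightarrow> t < e \<Longrightarrow> h' s0 < h' (s0 + t)"
    using DERIV_pos_inc_right[OF d] by auto
  obtain z where z: "s0 < z" "z < s0 + e" "h (s0 + e) - h s0 = (s0 + e - s0) * h' z"
    using MVT2[of s0 "s0 + e" h h'] h e(1) by auto
  have "h' z > 0"
    using e(2)[of "z - s0"] z derivative_at_max[OF h max] by simp
  then have "h (s0 + e) > h s0"
    using z(3) e(1) by (smt (verit) mult_pos_pos)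
  with max[of "s0 + e"] show False by simp
qed

lemma highest_point:
  assumes reg: "regular_closed_curves K"
  shows "\<exists>i0<components K. \<exists>s0. \<forall>i<components K. \<forall>s. Im (plan K i s) \<le> Im (plan K i0 s0)"
proof -
  let ?n = "components K"
  have "\<exists>s0. \<forall>s. Im (plan K i s) \<le> Im (plan K i s0)" if i: "i < ?n" for i
  proof -
    have "continuous_on {0..1} (\<lambda>s. Im (plan K i s))"
      by (intro continuous_intros plan_depth_continuous(1)[OF reg i])
    then have "\<exists>s0\<in>{0..1}. \<forall>s\<in>{0..1}. Im (plan K i s) \<le> Im (plan K i s0)"
      by (intro continuous_attains_sup) auto
    then obtain s0 where s0: "\<And>s. s \<in> {0..1} \<Longrightarrow> Im (plan K i s) \<le> Im (plan K i s0)"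
      by blast
    have "Im (plan K i s) \<le> Im (plan K i s0)" for s
    proof -
      have "plan K i (frac s) = plan K i s"
        by (rule periodic_Ints[of "plan K i"]) (use plan_depth_periodic(1)[OF reg i] in auto)
      moreover have "frac s \<in> {0..1}" using frac_lt_1[of s] by auto
      ultimately show ?thesis using s0[of "frac s"] by simp
    qed
    then show ?thesis by blast
  qed
  then obtain \<sigma> where \<sigma>: "\<And>i s. i < ?n \<Longrightarrow> Im (plan K i s) \<le> Im (plan K i (\<sigma> i))"
    by metis
  define M where "M = Max ((\<lambda>i. Im (plan K i (\<sigma> i))) ` {..<?n})"
  have "?n \<ge> 1" using reg by (simp add: regular_closed_curves_def)
  then have ne: "(\<lambda>i. Im (plan K i (\<sigma> i))) ` {..<?n} \<noteq> {}"
    by (auto simp: lessThan_empty_iff)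
  then have "M \<in> (\<lambda>i. Im (plan K i (\<sigma> i))) ` {..<?n}"
    unfolding M_def by (intro Max_in) auto
  then obtain i0 where "i0 < ?n" "M = Im (plan K i0 (\<sigma> i0))" by auto
  moreover have "Im (plan K i s) \<le> M" if "i < ?n" for i s
    using \<sigma>[OF that, of s] that unfolding M_def
    by (meson Max_ge finite_imageI finite_lessThan image_eqI lessThan_iff order_trans)
  ultimately show ?thesis by metis
qed

text \<open>
  By \<open>\<delta> < 1/2\<close> the interval from \<open>s0 - \<delta>\<close> to \<open>s0 + \<delta>\<close> is shorter than a period.  The signs are required at
  its ends as well, because the turning on this closed interval is compared before and after the twist.
\<close>

definition summit :: "link \<Rightarrow> nat \<Rightarrow> real \<Rightarrow> real \<Rightarrow> bool" where
  "summit K i0 s0 \<delta> \<longleftrightarrow> i0 < components K \<and> 0 < \<delta> \<and> \<delta> < 1/2 \<and>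
     (\<forall>i<components K. \<forall>s. \<not> same_parameter i s i0 s0 \<longrightarrow> Im (plan K i s) < Im (plan K i0 s0)) \<and>
     (\<forall>s\<in>{s0 - \<delta>..<s0}. Im (plan_velocity K i0 s) > 0) \<and>
     (\<forall>s\<in>{s0<..s0 + \<delta>}. Im (plan_velocity K i0 s) < 0) \<and>
     Im (plan_velocity K i0 s0) = 0"

lemma summit_exists:
  assumes K: "smooth_link K" and imm: "immersed K" and L: "link_isotopic L K"
  shows "\<exists>K' i0 s0 \<delta>. smooth_link K' \<and> immersed K' \<and> link_isotopic L K' \<and> summit K' i0 s0 \<delta>"
proof -
  have reg: "regular_closed_curves K" using K by (rule smooth_link_regular)
  obtain i0 s0 where i0: "i0 < components K"
    and max: "\<And>i s. i < components K \<Longrightarrow> Im (plan K i s) \<le> Im (plan K i0 s0)"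
    using highest_point[OF reg] by blast
  define z where "z = curve K i0 s0"
  define N where "N i s = 2 * ((Re (plan K i s) - Re (fst z)) * Re (plan_velocity K i s) + (depth K i s - snd z) * depth_velocity K i s)" for i s
  have "\<exists>c>0. \<forall>i<components K. \<forall>s. c * \<bar>N i s\<bar> < cmod (plan_velocity K i s)"
  proof (rule uniform_perturbation_bound[OF reg imm])
    show "continuous_on UNIV (N i)" if "i < components K" for i
      unfolding N_def by (intro continuous_intros plan_depth_continuous[OF reg that])
    show "N i (s + 1) = N i s" if "i < components K" for i s
      using plan_depth_periodic[OF reg that] by (simp add: N_def)
  qed
  then obtain c where c: "c > 0" "\<And>i s. i < components K \<Longrightarrow> c * \<bar>N i s\<bar> < cmod (plan_velocity K i s)"
    by blast
  define K' where "K' = map_curves (paraboloid_shear c z) K"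
  note s = paraboloid_shear_link[OF K, where c = c and z = z, folded K'_def]
  have reg': "regular_closed_curves K'" using s(1) by (rule smooth_link_regular)
  have i0': "i0 < components K'" using i0 s(3) by simp
  have vel: "plan_velocity K' i t = plan_velocity K i t - \<i> * of_real (c * N i t)" if "i < components K" for i t
    using s(5)[OF that] by (simp add: N_def algebra_simps)
  have "immersed K'"
  proof (rule rotation_nearby(2)[OF reg reg' s(3)])
    show "cmod (plan_velocity K' i t - plan_velocity K i t) < cmod (plan_velocity K i t)" if "i < components K" for i t
      using c(2)[OF that, of t] c(1) unfolding vel[OF that] by (simp add: norm_mult abs_mult)
  qed
  have Im': "Im (plan K' i t) = Im (plan K i t) - c * ((Re (plan K i t) - Re (fst z))\<^sup>2 + (depth K i t - snd z)\<^sup>2)" for i t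
    by (simp add: s(4))
  have top: "Im (plan K' i0 s0) = Im (plan K i0 s0)"
    unfolding Im' by (simp add: z_def plan_def depth_def)
  have strict: "Im (plan K' i t) < Im (plan K' i0 s0)" if i: "i < components K" and ns: "\<not> same_parameter i t i0 s0" for i t
  proof -
    let ?r = "(Re (plan K i t) - Re (fst z))\<^sup>2 + (depth K i t - snd z)\<^sup>2"
    show ?thesis
    proof (cases "?r = 0")
      case False
      then have "c * ?r > 0"
        using c(1) by (intro mult_pos_pos) (auto simp: sum_power2_gt_zero_iff)
      then show ?thesis
        using max[OF i, of t] unfolding top Im'[of i t] by simp
    next
      case True
      then have eq: "Re (plan K i t) = Re (fst z)" "depth K i t = snd z"
        by (auto simp: sum_power2_eq_zero_iff)
      have "\<not> double_point K i t i0 s0"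
        using K by (simp add: smooth_link_def is_link_def)
      then have "curve K i t \<noteq> curve K i0 s0"
        using i i0 ns by (simp add: double_point_def)
      then have "Im (plan K i t) \<noteq> Im (plan K i0 s0)"
        using eq by (auto simp: z_def plan_def depth_def prod_eq_iff complex_eq_iff)
      then show ?thesis
        using max[OF i, of t] True unfolding top Im'[of i t] by simp
    qed
  qed
  have le: "Im (plan K' i0 t) \<le> Im (plan K' i0 s0)" for t
    using max[OF i0, of t] c(1) unfolding top Im'[of i0 t]
    by (smt (verit) mult_nonneg_nonneg sum_power2_ge_zero)
  \<comment> \<open>The shear bends the curve downwards, so that the second derivative of the height is negative.\<close>
  define h where "h t = Im (plan_velocity K i0 t)" for t
  have ImK: "((\<lambda>t. Im (plan K i0 t)) has_real_derivative h t) (at t)" for t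
    using bounded_linear.has_vector_derivative[OF bounded_linear_Im plan_depth_derivative(1)[OF reg i0, of t]]
    by (simp add: h_def has_real_derivative_iff_has_vector_derivative)
  have ReK: "((\<lambda>t. Re (plan K i0 t)) has_real_derivative Re (plan_velocity K i0 t)) (at t)" for t
    using bounded_linear.has_vector_derivative[OF bounded_linear_Re plan_depth_derivative(1)[OF reg i0, of t]]
    by (simp add: has_real_derivative_iff_has_vector_derivative)
  have ImK': "((\<lambda>t. Im (plan K' i0 t)) has_real_derivative Im (plan_velocity K' i0 t)) (at t)" for t
    using bounded_linear.has_vector_derivative[OF bounded_linear_Im plan_depth_derivative(1)[OF reg' i0', of t]]
    by (simp add: has_real_derivative_iff_has_vector_derivative)
  have diff: "(\<lambda>t. h t) differentiable (at t)" "(\<lambda>t. Re (plan_velocity K i0 t)) differentiable (at t)"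
      "(\<lambda>t. depth_velocity K i0 t) differentiable (at t)" for t
    unfolding h_def using plan_depth_differentiable(3,4)[OF K i0]
    by (auto intro: differentiable_bounded_linear[OF bounded_linear_Im] differentiable_bounded_linear[OF bounded_linear_Re])
  obtain h2 x2 y2 where d2: "(h has_real_derivative h2) (at s0)"
      "((\<lambda>t. Re (plan_velocity K i0 t)) has_real_derivative x2) (at s0)"
      "(depth_velocity K i0 has_real_derivative y2) (at s0)"
    using diff[of s0] unfolding real_differentiable_def by blast
  have h0: "h s0 = 0" "h2 \<le> 0"
    using derivative_at_max[OF ImK, of s0] second_derivative_at_max[OF ImK _ d2(1)] max[OF i0] by auto
  let ?v = "(Re (plan_velocity K i0 s0))\<^sup>2 + (depth_velocity K i0 s0)\<^sup>2"
  have "?v > 0"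
    using velocity_components_nonzero[OF reg i0, of s0] h0(1)
    by (auto simp: h_def sum_power2_gt_zero_iff complex_eq_iff)
  have "((\<lambda>t. h t - c * N i0 t) has_real_derivative h2 - c * (2 * ?v)) (at s0)"
    unfolding N_def
    by (rule derivative_eq_intros d2 ReK plan_depth_derivative(2)[OF reg i0] refl)+
       (simp add: z_def plan_def depth_def power2_eq_square)
  moreover have "(\<lambda>t. h t - c * N i0 t) = (\<lambda>t. Im (plan_velocity K' i0 t))"
    by (auto simp: vel[OF i0] h_def)
  ultimately have d: "((\<lambda>t. Im (plan_velocity K' i0 t)) has_real_derivative h2 - c * (2 * ?v)) (at s0)"
    by simp
  have neg: "h2 - c * (2 * ?v) < 0"
    using h0(2) c(1) \<open>?v > 0\<close> by (smt (verit) mult_pos_pos)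
  have 0: "Im (plan_velocity K' i0 s0) = 0"
    using derivative_at_max[OF ImK', of s0] le by auto
  obtain e1 where e1: "e1 > 0" "\<And>t. 0 < t \<Longrightarrow> t < e1 \<Longrightarrow> Im (plan_velocity K' i0 (s0 - t)) > 0"
    using DERIV_neg_dec_left[OF d neg] 0 by auto
  obtain e2 where e2: "e2 > 0" "\<And>t. 0 < t \<Longrightarrow> t < e2 \<Longrightarrow> Im (plan_velocity K' i0 (s0 + t)) < 0"
    using DERIV_neg_dec_right[OF d neg] 0 by auto
  define \<delta> where "\<delta> = min (min e1 e2) (1/2) / 2"
  have \<delta>: "0 < \<delta>" "\<delta> < e1" "\<delta> < e2" "\<delta> < 1/2"
    using e1(1) e2(1) by (auto simp: \<delta>_def min_def)
  have "summit K' i0 s0 \<delta>"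
    unfolding summit_def
  proof (intro conjI ballI)
    show "Im (plan_velocity K' i0 s) > 0" if "s \<in> {s0 - \<delta>..<s0}" for s
      using e1(2)[of "s0 - s"] that \<delta> by auto
    show "Im (plan_velocity K' i0 s) < 0" if "s \<in> {s0<..s0 + \<delta>}" for s
      using e2(2)[of "s - s0"] that \<delta> by auto
  qed (use i0' \<delta> strict 0 s(3) in auto)
  then show ?thesis
    using s(1) s(2)[OF L] \<open>immersed K'\<close> by blast
qed


section \<open>Twisting the summit\<close>

text \<open>
  The rotation of the coordinates \<open>Re (fst x)\<close> and \<open>snd x\<close>, about the axis along which \<open>Im (fst x)\<close> varies, by
  an angle depending on the position along this axis.
\<close>

definition twist :: "(real \<Rightarrow> real) \<Rightarrow> complex \<times> real \<Rightarrow> complex \<times> real" where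
  "twist \<theta> x =
     (let a = \<theta> (Im (fst x)); r = Re (fst x); y = snd x
      in (of_real (cos a * r - sin a * y) + \<i> * of_real (Im (fst x)), sin a * r + cos a * y))"

definition twist' :: "(real \<Rightarrow> real) \<Rightarrow> (real \<Rightarrow> real) \<Rightarrow> complex \<times> real \<Rightarrow> complex \<times> real \<Rightarrow> complex \<times> real" where
  "twist' \<theta> \<theta>' x v =
     (let a = \<theta> (Im (fst x)); b = \<theta>' (Im (fst x)) * Im (fst v); r = Re (fst x); y = snd x
      in (of_real (cos a * Re (fst v) - sin a * snd v - b * (sin a * r + cos a * y)) + \<i> * of_real (Im (fst v)),
          sin a * Re (fst v) + cos a * snd v + b * (cos a * r - sin a * y)))"

lemma twist_has_derivative:
  assumes "\<And>h. (\<theta> has_real_derivative \<theta>' h) (at h)"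
  shows "(twist \<theta> has_derivative twist' \<theta> \<theta>' x) (at x)"
proof -
  have a: "((\<lambda>x. \<theta> (Im (fst x))) has_derivative (\<lambda>v. Im (fst v) * \<theta>' (Im (fst x)))) (at x)"
    by (rule DERIV_compose_FDERIV[OF assms]) (auto intro!: derivative_eq_intros)
  show ?thesis
    unfolding twist_def[abs_def] twist'_def[abs_def] Let_def
    by (rule derivative_eq_intros a refl)+ (auto simp: fun_eq_iff algebra_simps)
qed

lemma twist_inverse: "twist (\<lambda>h. - \<theta> h) (twist \<theta> x) = x"
proof -
  let ?a = "\<theta> (Im (fst x))" and ?r = "Re (fst x)" and ?y = "snd x"
  have cs: "cos ?a * cos ?a + sin ?a * sin ?a = 1"
    using sin_cos_squared_add3[of ?a] by simp
  have "z * (cos ?a * cos ?a) + z * (sin ?a * sin ?a) = z" for z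
    using cs by (simp flip: distrib_left)
  then show ?thesis
    by (simp add: twist_def Let_def prod_eq_iff complex_eq_iff algebra_simps)
qed

lemma twist_ambient:
  assumes \<theta>: "\<And>h. (\<theta> has_real_derivative \<theta>' h) (at h)" and \<theta>': "continuous_on UNIV \<theta>'"
  shows "ambient_isotopy (\<lambda>\<tau>. twist (\<lambda>h. \<tau> * \<theta> h)) (\<lambda>\<tau>. twist' (\<lambda>h. \<tau> * \<theta> h) (\<lambda>h. \<tau> * \<theta>' h))"
proof (rule ambient_isotopyI[where \<Psi> = "\<lambda>\<tau>. twist (\<lambda>h. - (\<tau> * \<theta> h))"])
  have cont: "continuous_on UNIV \<theta>"
    by (meson DERIV_continuous \<theta> continuous_at_imp_continuous_on)
  have \<tau>\<theta>: "((\<lambda>h. \<tau> * \<theta> h) has_real_derivative \<tau> * \<theta>' h) (at h)" for \<tau> h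
    by (auto intro!: derivative_eq_intros \<theta>)
  show "twist (\<lambda>h. 0 * \<theta> h) x = x" for x
    by (simp add: twist_def Let_def prod_eq_iff complex_eq_iff)
  show "twist (\<lambda>h. - (\<tau> * \<theta> h)) (twist (\<lambda>h. \<tau> * \<theta> h) x) = x" for \<tau> x
    by (rule twist_inverse)
  show "twist (\<lambda>h. - (\<tau> * \<theta> h)) differentiable at x" for \<tau> x
    using twist_has_derivative[OF DERIV_minus[OF \<tau>\<theta>]] unfolding differentiable_def by blast
  show "(twist (\<lambda>h. \<tau> * \<theta> h) has_derivative twist' (\<lambda>h. \<tau> * \<theta> h) (\<lambda>h. \<tau> * \<theta>' h) x) (at x)" for \<tau> x
    by (rule twist_has_derivative[OF \<tau>\<theta>])
  show "continuous_on ({0..1} \<times> UNIV) (\<lambda>(\<tau>, x). twist (\<lambda>h. \<tau> * \<theta> h) x)"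
    unfolding twist_def Let_def case_prod_unfold
    by (intro continuous_intros continuous_on_compose2[OF cont]) auto
  show "continuous_on ({0..1} \<times> UNIV) (\<lambda>(\<tau>, x). twist' (\<lambda>h. \<tau> * \<theta> h) (\<lambda>h. \<tau> * \<theta>' h) x v)" for v
    unfolding twist'_def Let_def case_prod_unfold
    by (intro continuous_intros continuous_on_compose2[OF cont] continuous_on_compose2[OF \<theta>']) auto
qed

lemma twist_link:
  assumes \<theta>: "\<And>h. (\<theta> has_real_derivative \<theta>' h) (at h)" and \<theta>': "continuous_on UNIV \<theta>'"
  shows "is_link K \<Longrightarrow> is_link (map_curves (twist \<theta>) K)"
    "link_isotopic L K \<Longrightarrow> link_isotopic L (map_curves (twist \<theta>) K)"
    "regular_closed_curves K \<Longrightarrow> i < components K \<Longrightarrow>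
       velocity (map_curves (twist \<theta>) K) i s = twist' \<theta> \<theta>' (curve K i s) (velocity K i s)"
  using ambient_is_link[OF twist_ambient[OF \<theta> \<theta>'], of 1 K] link_isotopic_ambient[OF twist_ambient[OF \<theta> \<theta>'], of L K]
    ambient_velocity(2)[OF twist_ambient[OF \<theta> \<theta>'], of 1 K i s]
  by simp_all

lemma twist_smooth_link:
  assumes \<theta>: "\<And>h. (\<theta> has_real_derivative \<theta>' h) (at h)" and \<theta>': "\<And>h. \<theta>' differentiable (at h)"
    and K: "smooth_link K"
  shows "smooth_link (map_curves (twist \<theta>) K)"
proof -
  have c: "continuous_on UNIV \<theta>'"
    using \<theta>' differentiable_imp_continuous_within continuous_at_imp_continuous_on by blast
  have t: "\<theta> differentiable (at h)" "cos differentiable (at h)" "sin differentiable (at h)" for h :: real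
    using \<theta>[of h] DERIV_cos[of h] DERIV_sin[of h] unfolding real_differentiable_def by blast+
  have Imf: "(\<lambda>z :: (complex \<times> real) \<times> (complex \<times> real). Im (fst (fst z))) differentiable (at z)" for z
    by (intro differentiable_bounded_linear[OF bounded_linear_Im] differentiable_bounded_linear[OF bounded_linear_fst] differentiable_ident)
  note cc = differentiable_compose_at[OF t(2) differentiable_compose_at[OF t(1) Imf]]
    differentiable_compose_at[OF t(3) differentiable_compose_at[OF t(1) Imf]]
    differentiable_compose_at[OF \<theta>' Imf]
  have "(\<lambda>(x, v). twist' (\<lambda>h. 1 * \<theta> h) (\<lambda>h. 1 * \<theta>' h) x v) differentiable (at z)" for z
    unfolding twist'_def Let_def case_prod_unfold mult_1
    by (intro differentiable_mult differentiable_add differentiable_diff differentiable_const cc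
        differentiable_Pair differentiable_of_real differentiable_bounded_linear[OF bounded_linear_Re]
        differentiable_bounded_linear[OF bounded_linear_Im]
        differentiable_bounded_linear[OF bounded_linear_fst] differentiable_bounded_linear[OF bounded_linear_snd] differentiable_ident)
  from smooth_link_ambient[OF twist_ambient[OF \<theta> c] this K] show ?thesis
    by simp
qed

text \<open>
  Both curves pass from the upper to the lower half-plane, \<open>f\<close> through the positive and \<open>g\<close> through the
  negative real axis.  So \<open>f\<close> avoids one ray and \<open>g\<close> the opposite one, and the two branches of the
  logarithm differ by \<open>\<pi>\<i>\<close> with opposite signs at the two ends.
\<close>

lemma turning_opposite_ways:
  assumes f: "continuous_on {a..b} f" and g: "continuous_on {a..b} g" and abm: "a < m" "m < b"
    and Im: "\<And>s. s \<in> {a..b} \<Longrightarrow> Im (g s) = Im (f s)"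
    and pos: "\<And>s. s \<in> {a..<m} \<Longrightarrow> Im (f s) > 0" and neg: "\<And>s. s \<in> {m<..b} \<Longrightarrow> Im (f s) < 0"
    and m: "Re (f m) > 0" "Re (g m) < 0" and ends: "g a = f a" "g b = f b"
  shows "turning g a b \<noteq> turning f a b"
proof -
  have "f s / 1 \<notin> \<real>\<^sub>\<le>\<^sub>0" if s: "s \<in> {a..b}" for s
    using s pos[of s] neg[of s] m(1) by (cases s m rule: linorder_cases) (auto simp: complex_nonpos_Reals_iff)
  then have 1: "turning f a b = Ln (f b) - Ln (f a)"
    using turning_slit_plane[OF f, of 1] abm by simp
  have "g s / (- 1) \<notin> \<real>\<^sub>\<le>\<^sub>0" if s: "s \<in> {a..b}" for s
    using s pos[of s] neg[of s] m(2) Im[OF s] by (cases s m rule: linorder_cases) (auto simp: complex_nonpos_Reals_iff)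
  then have 2: "turning g a b = Ln (- f b) - Ln (- f a)"
    using turning_slit_plane[OF g, of "- 1"] abm ends by simp
  have "Im (f a) > 0" "Im (f b) < 0"
    using pos[of a] neg[of b] abm by auto
  then have "Ln (- f a) = Ln (f a) - \<i> * pi" "Ln (- f b) = Ln (f b) + \<i> * pi"
    by (subst Ln_minus; auto)+
  with 1 2 have "turning g a b = turning f a b + 2 * \<i> * pi"
    by simp
  then show ?thesis by simp
qed

text \<open>
  The angle of the twist: zero up to level \<open>c\<close>, and with a differentiable derivative, so that the twisted
  link remains smooth.
\<close>

lemma cube_positive_part_derivative:
  "((\<lambda>h. k * (max 0 (h - c)) ^ 3) has_real_derivative 3 * k * (max 0 (h - c))\<^sup>2) (at h)"
  "(\<lambda>h. 3 * k * (max 0 (h - c))\<^sup>2) differentiable (at (h :: real))"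
proof -
  have pw: "((\<lambda>h. (max 0 (h - c)) ^ Suc (Suc n)) has_real_derivative of_nat (Suc (Suc n)) * (max 0 (h - c)) ^ Suc n) (at h)" for n and h :: real
  proof (cases h c rule: linorder_cases)
    case less
    have "((\<lambda>_. 0) has_real_derivative 0) (at h)" by simp
    then have "((\<lambda>h. (max 0 (h - c)) ^ Suc (Suc n)) has_real_derivative 0) (at h)"
      by (rule has_field_derivative_transform_within_open[where S = "{..<c}"]) (use less in auto)
    with less show ?thesis by simp
  next
    case greater
    have "((\<lambda>h. h - c) has_real_derivative 1) (at h)"
      by (auto intro!: derivative_eq_intros)
    from DERIV_power[OF this, of "Suc (Suc n)"]
    have "((\<lambda>h. (h - c) ^ Suc (Suc n)) has_real_derivative of_nat (Suc (Suc n)) * (h - c) ^ Suc n) (at h)"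
      by simp
    then have "((\<lambda>h. (max 0 (h - c)) ^ Suc (Suc n)) has_real_derivative of_nat (Suc (Suc n)) * (h - c) ^ Suc n) (at h)"
      by (rule has_field_derivative_transform_within_open[where S = "{c<..}"]) (use greater in auto)
    with greater show ?thesis by simp
  next
    case equal
    have "((\<lambda>x. (max 0 (x - c)) ^ Suc n) \<longlongrightarrow> (max 0 (c - c)) ^ Suc n) (at c)"
      by (intro tendsto_intros)
    then have "((\<lambda>x. (max 0 (x - c)) ^ Suc n) \<longlongrightarrow> 0) (at c)" by simp
    then have "((\<lambda>x. (max 0 (x - c)) ^ Suc (Suc n) / (x - c)) \<longlongrightarrow> 0) (at c)"
    proof (rule Lim_null_comparison[rotated])
      show "\<forall>\<^sub>F x in at c. norm ((max 0 (x - c)) ^ Suc (Suc n) / (x - c)) \<le> (max 0 (x - c)) ^ Suc n"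
        by (rule always_eventually) (auto simp: max_def)
    qed
    then show ?thesis
      by (simp add: equal has_field_derivative_iff)
  qed
  show "((\<lambda>h. k * (max 0 (h - c)) ^ 3) has_real_derivative 3 * k * (max 0 (h - c))\<^sup>2) (at h)"
    using DERIV_cmult[OF pw[of 1 h], of k] by (simp add: numeral_eq_Suc algebra_simps)
  show "(\<lambda>h. 3 * k * (max 0 (h - c))\<^sup>2) differentiable (at h)"
    using DERIV_cmult[OF pw[of 0 h], of "3 * k"] unfolding real_differentiable_def
    by (auto simp: numeral_eq_Suc)
qed

text \<open>
  Away from the interval around \<open>s0\<close> the height stays below its maximum by compactness, which leaves room
  for a twist acting on the top only.
\<close>

lemma summit_isolated:
  assumes reg: "regular_closed_curves K" and top: "summit K i0 s0 \<delta>"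
  shows "\<exists>c < Im (plan K i0 s0).
     (\<forall>i<components K. i \<noteq> i0 \<longrightarrow> (\<forall>s. Im (plan K i s) \<le> c)) \<and>
     (\<forall>s\<in>{s0 + \<delta>..s0 - \<delta> + 1}. Im (plan K i0 s) \<le> c)"
proof -
  let ?n = "components K"
  let ?h = "\<lambda>i s. Im (plan K i s)"
  have i0: "i0 < ?n" and \<delta>: "0 < \<delta>" "\<delta> < 1/2"
    and strict: "\<And>i s. i < ?n \<Longrightarrow> \<not> same_parameter i s i0 s0 \<Longrightarrow> ?h i s < ?h i0 s0"
    using top by (auto simp: summit_def)
  define U where "U = (\<Union>i\<in>{..<?n} - {i0}. ?h i ` {0..1}) \<union> ?h i0 ` {s0 + \<delta>..s0 - \<delta> + 1}"
  have cont: "continuous_on A (?h i)" if "i < ?n" for i A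
    by (intro continuous_intros plan_depth_continuous(1)[OF reg that])
  have "compact U"
    unfolding U_def
    by (intro compact_Un compact_UN compact_continuous_image cont i0) (auto intro!: compact_continuous_image cont)
  moreover have "U \<noteq> {}"
    using \<delta> by (auto simp: U_def)
  ultimately obtain c where c: "c \<in> U" "\<And>x. x \<in> U \<Longrightarrow> x \<le> c"
    using compact_attains_sup by metis
  have "x < ?h i0 s0" if "x \<in> U" for x
  proof -
    from that consider i s where "i < ?n" "i \<noteq> i0" "x = ?h i s" | s where "s \<in> {s0 + \<delta>..s0 - \<delta> + 1}" "x = ?h i0 s"
      unfolding U_def by auto
    then show ?thesis
    proof cases
      case 1
      then show ?thesis using strict[of i s] by (auto simp: same_parameter_def)
    next
      case 2
      have "s - s0 \<notin> \<int>"
      proof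
        assume "s - s0 \<in> \<int>"
        then have "s - s0 = 0"
          by (rule Ints_small_eq_0) (use 2 \<delta> in auto)
        with 2 \<delta> show False by auto
      qed
      then show ?thesis using strict[of i0 s] i0 2 by (auto simp: same_parameter_def)
    qed
  qed
  with c(1) have "c < ?h i0 s0" by blast
  moreover have "?h i s \<le> c" if i: "i < ?n" "i \<noteq> i0" for i s
  proof -
    have "plan K i (frac s) = plan K i s"
      by (rule periodic_Ints[of "plan K i"]) (use plan_depth_periodic(1)[OF reg i(1)] in auto)
    moreover have "?h i (frac s) \<in> U"
      using i frac_lt_1[of s] by (force simp: U_def)
    ultimately show ?thesis using c(2)[of "?h i (frac s)"] by simp
  qed
  moreover have "?h i0 s \<le> c" if "s \<in> {s0 + \<delta>..s0 - \<delta> + 1}" for s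
    using that by (intro c(2)) (auto simp: U_def)
  ultimately show ?thesis by blast
qed

text \<open>
  Rotations about the vertical axis preserve heights, so the vertical velocity is unaffected, and at the
  summit, where it vanishes, the half turn reverses the horizontal velocity.  The projection
  therefore stays immersed and the tangent passes the summit the other way round.
\<close>

lemma twisted_summit:
  assumes K: "smooth_link K" and imm: "immersed K" and L: "link_isotopic L K" and top: "summit K i0 s0 \<delta>"
  shows "\<exists>K'. smooth_link K' \<and> immersed K' \<and> link_isotopic L K' \<and> rotation K' \<noteq> rotation K"
proof -
  let ?n = "components K"
  let ?h = "\<lambda>i s. Im (plan K i s)"
  have reg: "regular_closed_curves K" using K by (rule smooth_link_regular)
  have i0: "i0 < ?n" and \<delta>: "0 < \<delta>" "\<delta> < 1/2"
    and up: "\<And>s. s \<in> {s0 - \<delta>..<s0} \<Longrightarrow> Im (plan_velocity K i0 s) > 0"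
    and down: "\<And>s. s \<in> {s0<..s0 + \<delta>} \<Longrightarrow> Im (plan_velocity K i0 s) < 0"
    and flat: "Im (plan_velocity K i0 s0) = 0"
    using top by (auto simp: summit_def)
  obtain c where c: "c < ?h i0 s0" "\<And>i s. i < ?n \<Longrightarrow> i \<noteq> i0 \<Longrightarrow> ?h i s \<le> c"
      "\<And>s. s \<in> {s0 + \<delta>..s0 - \<delta> + 1} \<Longrightarrow> ?h i0 s \<le> c"
    using summit_isolated[OF reg top] by metis
  define k where "k = pi / (?h i0 s0 - c) ^ 3"
  define \<theta> where "\<theta> h = k * (max 0 (h - c)) ^ 3" for h
  define \<theta>' where "\<theta>' h = 3 * k * (max 0 (h - c))\<^sup>2" for h
  have \<theta>: "(\<theta> has_real_derivative \<theta>' h) (at h)" and \<theta>': "\<theta>' differentiable (at h)" for h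
    unfolding \<theta>_def \<theta>'_def by (rule cube_positive_part_derivative)+
  have \<theta>'_cont: "continuous_on UNIV \<theta>'"
    unfolding \<theta>'_def by (intro continuous_intros)
  have \<theta>_top: "\<theta> (?h i0 s0) = pi"
    using c(1) by (simp add: \<theta>_def k_def)
  define K' where "K' = map_curves (twist \<theta>) K"
  have K': "smooth_link K'" "link_isotopic L K'" "components K' = ?n"
    unfolding K'_def using twist_smooth_link[OF \<theta> \<theta>' K] twist_link(2)[OF \<theta> \<theta>'_cont L] by simp_all
  have reg': "regular_closed_curves K'" using K'(1) by (rule smooth_link_regular)
  have vel: "plan_velocity K' i s = fst (twist' \<theta> \<theta>' (curve K i s) (velocity K i s))" if "i < ?n" for i s
    using twist_link(3)[OF \<theta> \<theta>'_cont reg that] by (simp add: plan_velocity_def K'_def)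
  have Im_vel: "Im (plan_velocity K' i s) = Im (plan_velocity K i s)" if "i < ?n" for i s
    unfolding vel[OF that] by (simp add: twist'_def Let_def plan_velocity_def)
  have low: "plan_velocity K' i s = plan_velocity K i s" if "i < ?n" "?h i s \<le> c" for i s
    using that(2) unfolding vel[OF that(1)] by (simp add: twist'_def Let_def plan_velocity_def plan_def \<theta>_def \<theta>'_def complex_eq_iff)
  have summit_vel: "plan_velocity K' i0 s0 = - plan_velocity K i0 s0"
    using \<theta>_top flat unfolding vel[OF i0] by (simp add: twist'_def Let_def plan_velocity_def plan_def complex_eq_iff)
  have nz: "plan_velocity K i s \<noteq> 0" if "i < ?n" for i s
    using imm that by (simp add: immersed_def)
  have nz0: "plan_velocity K' i0 s \<noteq> 0" if s: "s \<in> {s0 - \<delta>..s0 - \<delta> + 1}" for s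
  proof -
    consider "s < s0" | "s = s0" | "s0 < s" "s \<le> s0 + \<delta>" | "s > s0 + \<delta>" by linarith
    then show ?thesis
    proof cases
      case 1
      then show ?thesis using up[of s] s Im_vel[OF i0, of s] by auto
    next
      case 2
      then show ?thesis using summit_vel nz[OF i0] by simp
    next
      case 3
      then show ?thesis using down[of s] Im_vel[OF i0, of s] by auto
    next
      case 4
      then show ?thesis using c(3)[of s] low[OF i0, of s] nz[OF i0] s by simp
    qed
  qed
  have imm': "plan_velocity K' i s \<noteq> 0" if i: "i < ?n" for i s
  proof (cases "i = i0")
    case False
    then show ?thesis using low[OF i c(2)[OF i]] nz[OF i] by simp
  next
    case True
    define t where "t = s0 - \<delta> + frac (s - (s0 - \<delta>))"
    have "t - s = frac (s - (s0 - \<delta>)) - (s - (s0 - \<delta>))"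
      by (simp add: t_def)
    then have "t - s \<in> \<int>"
      using frac_diff_Ints(1)[of "s - (s0 - \<delta>)"] by metis
    then have "plan_velocity K' i0 t = plan_velocity K' i0 s"
      using periodic_Ints[of "plan_velocity K' i0" t s] plan_depth_periodic(3)[OF reg', of i0] i0 K'(3) by auto
    moreover have "t \<in> {s0 - \<delta>..s0 - \<delta> + 1}"
      using frac_lt_1[of "s - (s0 - \<delta>)"] frac_ge_0[of "s - (s0 - \<delta>)"] by (auto simp: t_def)
    ultimately show ?thesis
      using nz0[of t] True by simp
  qed
  let ?f = "plan_velocity K i0" and ?g = "plan_velocity K' i0"
  have i0': "i0 < components K'" using i0 K'(3) by simp
  have f: "continuous_on A ?f" "\<And>s. ?f (s + 1) = ?f s" and g: "continuous_on A ?g" "\<And>s. ?g (s + 1) = ?g s" for A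
    using plan_depth_continuous(3) plan_depth_periodic(3) reg reg' i0 i0' by blast+
  have lower: "?h i0 (s0 - \<delta>) \<le> c" "?h i0 (s0 + \<delta>) \<le> c"
    using c(3)[of "s0 - \<delta> + 1"] c(3)[of "s0 + \<delta>"] plan_depth_periodic(1)[OF reg i0, of "s0 - \<delta>"] \<delta> by auto
  have "turning ?g (s0 - \<delta>) (s0 + \<delta>) \<noteq> turning ?f (s0 - \<delta>) (s0 + \<delta>)"
  proof (cases "Re (?f s0) > 0")
    case True
    then show ?thesis
      by (intro turning_opposite_ways[where m = s0] f g)
         (use \<delta> up down Im_vel[OF i0] summit_vel low[OF i0] lower in auto)
  next
    case False
    then have "Re (?f s0) < 0"
      using nz[OF i0, of s0] flat by (auto simp: complex_eq_iff)
    then have "turning ?f (s0 - \<delta>) (s0 + \<delta>) \<noteq> turning ?g (s0 - \<delta>) (s0 + \<delta>)"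
      by (intro turning_opposite_ways[where m = s0] f g)
         (use \<delta> up down Im_vel[OF i0] summit_vel low[OF i0] lower in auto)
    then show ?thesis by simp
  qed
  moreover have "turning ?g (s0 + \<delta>) (s0 - \<delta> + 1) = turning ?f (s0 + \<delta>) (s0 - \<delta> + 1)"
    by (rule turning_cong) (use c(3) low[OF i0] in auto)
  moreover have "turning ?f (s0 - \<delta>) (s0 - \<delta> + 1) = turning ?f (s0 - \<delta>) (s0 + \<delta>) + turning ?f (s0 + \<delta>) (s0 - \<delta> + 1)"
    by (rule turning_combine) (use f nz[OF i0] \<delta> in auto)
  moreover have "turning ?g (s0 - \<delta>) (s0 - \<delta> + 1) = turning ?g (s0 - \<delta>) (s0 + \<delta>) + turning ?g (s0 + \<delta>) (s0 - \<delta> + 1)"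
    by (rule turning_combine) (use g imm'[OF i0] \<delta> in auto)
  ultimately have ne: "winding_number ?g 0 \<noteq> winding_number ?f 0"
    using turning_period[OF f(1) nz[OF i0] f(2), of "s0 - \<delta>"] turning_period[OF g(1) imm'[OF i0] g(2), of "s0 - \<delta>"]
    by auto
  have "plan_velocity K' i = plan_velocity K i" if "i \<in> {..<?n} - {i0}" for i
    using that low[of i] c(2)[of i] by auto
  then have "(\<Sum>i\<in>{..<?n} - {i0}. winding_number (plan_velocity K' i) 0) = (\<Sum>i\<in>{..<?n} - {i0}. winding_number (plan_velocity K i) 0)"
    by (intro sum.cong) auto
  then have "rotation K' \<noteq> rotation K"
    using ne i0 K'(3) unfolding rotation_def by (simp add: sum.remove[of "{..<?n}" i0])
  moreover have "immersed K'"
    using imm' K'(3) by (simp add: immersed_def)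
  ultimately show ?thesis
    using K' by blast
qed

lemma generic_link_nonzero_rotation:
  assumes "is_link L"
  shows "\<exists>K. generic_link K \<and> link_isotopic L K \<and> rotation K \<noteq> 0"
proof -
  obtain K0 where K0: "link_isotopic L K0" "smooth_link K0"
    using smoothing[OF assms] by blast
  obtain p where p: "immersed (map_curves (quadratic_shear p 0) K0)"
    using immersed_after_shear[OF K0(2)] by blast
  obtain K1 i0 s0 \<delta> where K1: "smooth_link K1" "immersed K1" "link_isotopic L K1" "summit K1 i0 s0 \<delta>"
    using summit_exists[OF quadratic_shear_link(1)[OF K0(2)] p quadratic_shear_link(2)[OF K0(2,1)]] by blast
  obtain K2 where K2: "smooth_link K2" "immersed K2" "link_isotopic L K2" "rotation K2 \<noteq> rotation K1"
    using twisted_summit[OF K1] by blast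
  show ?thesis
  proof (cases "rotation K1 = 0")
    case True
    then show ?thesis using generic_perturbation[OF K2(1-3)] K2(4) by metis
  next
    case False
    then show ?thesis using generic_perturbation[OF K1(1-3)] by metis
  qed
qed


section \<open>Looking from behind\<close>

text \<open>
  Negation is a rotation by \<open>\<pi>\<close>, hence homotopic to the identity.
\<close>

lemma winding_number_reflect:
  assumes f: "continuous_on UNIV f" "\<And>s. f s \<noteq> 0" "\<And>s. f (s + 1) = f s"
  shows "winding_number (\<lambda>s. - cnj (f s)) 0 = - cnj (winding_number f 0)"
proof -
  define H where "H \<tau> s = cis (pi * \<tau>) * cnj (f s)" for \<tau> s
  have "winding_number (H 1) 0 = winding_number (H 0) 0"
  proof (rule winding_number_family)
    show "continuous_on ({0..1} \<times> UNIV) (\<lambda>(\<tau>, s). H \<tau> s)"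
      unfolding H_def case_prod_unfold by (intro continuous_intros continuous_on_compose2[OF f(1)]) auto
  qed (use f in \<open>auto simp: H_def\<close>)
  moreover have "H 1 = (\<lambda>s. - cnj (f s))" "H 0 = cnj \<circ> f"
    by (auto simp: H_def)
  moreover have "winding_number (cnj \<circ> f) (cnj 0) = - cnj (winding_number f 0)"
    by (rule winding_number_cnj) (use f continuous_on_subset[OF f(1), of "{0..1}"] in \<open>auto simp: path_def path_image_def\<close>)
  ultimately show ?thesis by simp
qed

text \<open>
  A half turn about the vertical axis in the plane of projection.  It reflects the plane and exchanges
  upper and lower branches, two changes of sign which cancel in each crossing sign.
\<close>

lemma view_from_behind:
  assumes K: "generic_link K" and L: "link_isotopic L K"
  shows "\<exists>K'. generic_link K' \<and> link_isotopic L K' \<and> rotation K' = - cnj (rotation K) \<and>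
     double_writhe (shadow K') = double_writhe (shadow K)"
proof -
  let ?n = "components K"
  have link: "is_link K" and reg: "regular_closed_curves K" and imm: "\<And>i s. i < ?n \<Longrightarrow> plan_velocity K i s \<noteq> 0"
    using K by (auto simp: generic_link_def is_link_def immersed_def)
  define K' where "K' = map_curves (twist (\<lambda>_. pi)) K"
  note tw = twist_link[of "\<lambda>_. pi" "\<lambda>_. 0", OF DERIV_const continuous_on_const]
  have K': "is_link K'" "link_isotopic L K'" "components K' = ?n"
    using tw(1)[OF link] tw(2)[OF L] by (simp_all add: K'_def)
  have reg': "regular_closed_curves K'" using K'(1) by (simp add: is_link_def)
  have pd: "plan K' i s = - cnj (plan K i s)" "depth K' i s = - depth K i s" for i s
    by (simp_all add: K'_def plan_def depth_def twist_def Let_def complex_eq_iff)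
  have v: "plan_velocity K' i s = - cnj (plan_velocity K i s)" if "i < ?n" for i s
    using tw(3)[OF reg that, of s] by (simp add: K'_def[symmetric] plan_velocity_def twist'_def Let_def complex_eq_iff)
  have eq: "- cnj x = - cnj y \<longleftrightarrow> x = y" for x y
    by (metis complex_cnj_cancel_iff neg_equal_iff_equal)
  have cr: "cross (- cnj x) (- cnj y) = - cross x y" for x y
    by (simp add: cross_def)
  have "generic_link K'"
    unfolding generic_link_def
  proof (intro conjI allI impI)
    show "immersed K'"
      using imm K'(3) v by (simp add: immersed_def)
    show "\<not> tangency K' 0 i s j t" if "i < components K'" "j < components K'" for i s j t
    proof -
      have "\<not> tangency K 0 i s j t"
        using K that K'(3) by (simp add: generic_link_def)
      then show ?thesis
        using that K'(3) v by (simp add: tangency_def pd cr)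
    qed
    show "\<not> triple_point K' 0 0 i s j t k u" if "i < components K'" "j < components K'" "k < components K'" for i s j t k u
    proof -
      have "\<not> triple_point K 0 0 i s j t k u"
        using K that K'(3) by (simp add: generic_link_def)
      then show ?thesis
        by (simp add: triple_point_def pd)
    qed
  qed (rule K'(1))
  moreover have "rotation K' = - cnj (rotation K)"
  proof -
    have "winding_number (plan_velocity K' i) 0 = - cnj (winding_number (plan_velocity K i) 0)" if i: "i < ?n" for i
    proof -
      have "plan_velocity K' i = (\<lambda>s. - cnj (plan_velocity K i s))"
        using v[OF i] by auto
      then show ?thesis
        using winding_number_reflect[of "plan_velocity K i"] plan_depth_continuous(3)[OF reg i] imm[OF i]
          plan_depth_periodic(3)[OF reg i] by simp
    qed
    then show ?thesis
      by (simp add: rotation_def K'(3) sum_negf cnj_sum)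
  qed
  moreover have "double_writhe (shadow K') = double_writhe (shadow K)"
    unfolding double_writhe_def
  proof (rule sum.cong)
    show "ordered_crossings (shadow K') = ordered_crossings (shadow K)"
      using K'(3) by (auto simp: ordered_crossings_def double_point_shadow[OF link] double_point_shadow[OF K'(1)] pd)
    fix x assume "x \<in> ordered_crossings (shadow K)"
    then obtain i s j t where x: "x = (i, s, j, t)" and d: "double_point (shadow K) i s j t"
      by (auto simp: ordered_crossings_def)
    then have ij: "i < ?n" "j < ?n" and ne: "depth K i s \<noteq> depth K j t"
      by (auto simp: double_point_shadow[OF link])
    have vs: "velocity (shadow K') l r = - cnj (velocity (shadow K) l r)" if "l < ?n" for l r
      using velocity_shadow[OF reg that] velocity_shadow[OF reg', of l r] that K'(3) v by simp
    have anti: "- cross x y = cross y x" for x y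
      by (simp add: cross_def)
    have "crossing_sign (shadow K') i s j t = crossing_sign (shadow K) i s j t"
      unfolding crossing_sign_def vs[OF ij(1)] vs[OF ij(2)] cr anti
      using ne by (auto simp: pd)
    then show "(case x of (i, s, j, t) \<Rightarrow> crossing_sign (shadow K') i s j t) =
        (case x of (i, s, j, t) \<Rightarrow> crossing_sign (shadow K) i s j t)"
      by (simp add: x)
  qed
  ultimately show ?thesis
    using K'(2) by blast
qed

lemma diagrams_with_opposite_rotation:
  assumes "is_link L"
  shows "\<exists>D D'. diagram_of L D \<and> diagram_of L D' \<and> double_writhe D' = double_writhe D \<and>
     Re (total_winding D') = - Re (total_winding D) \<and> Re (total_winding D) \<noteq> 0"
proof -
  obtain K where K: "generic_link K" "link_isotopic L K" "rotation K \<noteq> 0"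
    using generic_link_nonzero_rotation[OF assms] by blast
  obtain K' where K': "generic_link K'" "link_isotopic L K'" "rotation K' = - cnj (rotation K)"
      "double_writhe (shadow K') = double_writhe (shadow K)"
    using view_from_behind[OF K(1,2)] by blast
  have reg: "regular_closed_curves K" "regular_closed_curves K'"
    using K K' by (auto simp: generic_link_def is_link_def)
  have "winding_number (plan_velocity K i) 0 \<in> \<int>" if i: "i < components K" for i
  proof (rule integer_winding_number)
    show "path (plan_velocity K i)"
      using plan_depth_continuous(3)[OF reg(1) i] by (auto simp: path_def)
    show "pathfinish (plan_velocity K i) = pathstart (plan_velocity K i)"
      using plan_depth_periodic(3)[OF reg(1) i, of 0] by (auto simp: pathstart_def pathfinish_def)
    show "0 \<notin> path_image (plan_velocity K i)"
      using K(1) i by (auto simp: generic_link_def immersed_def path_image_def)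
  qed
  then have "rotation K \<in> \<int>"
    unfolding rotation_def by (intro Ints_sum) auto
  then have "Re (rotation K) \<noteq> 0"
    using K(3) by (auto elim!: Ints_cases)
  then show ?thesis
    using generic_link_diagram_of[OF K(1,2)] generic_link_diagram_of[OF K'(1,2)] K'(3,4)
      total_winding_shadow[OF reg(1)] total_winding_shadow[OF reg(2)]
    by (intro exI[of _ "shadow K"] exI[of _ "shadow K'"]) simp
qed


theorem corollary8:
  fixes L :: link and A :: "directed_move set"
  assumes "is_link L"
    and "generating L A"
  shows "{Forward Omega1a, Backward Omega1a, Forward Omega1b, Backward Omega1b} \<subseteq> A"
proof -
  obtain D0 D1 where D: "diagram_of L D0" "diagram_of L D1" "double_writhe D1 = double_writhe D0"
      "Re (total_winding D1) = - Re (total_winding D0)" "Re (total_winding D0) \<noteq> 0"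
    using diagrams_with_opposite_rotation[OF assms(1)] by blast
  let ?R = "\<lambda>D D'. planar_isotopic D D' \<or> (\<exists>m\<in>A. performs m D D')"
  have reach: "?R\<^sup>*\<^sup>* D0 D1" "?R\<^sup>*\<^sup>* D1 D0"
    using assms(2) D unfolding generating_def by blast+
  have "Forward x \<in> A \<and> Backward x \<in> A" if x: "x = Omega1a \<and> e = - 1 \<or> x = Omega1b \<and> e = 1" for x and e :: real
  proof -
    have "balance e D1 \<noteq> balance e D0"
      using x D by (auto simp: balance_def)
    then show ?thesis
      using balance_monotone[OF reach(1) x] balance_monotone[OF reach(2) x] by linarith
  qed
  from this[of Omega1a "-1"] this[of Omega1b 1] show ?thesis by simp
qed


end
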